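(* Let $h_0=1-\beta b_0$ with $b_0\in H^1(\mathbb R)$, $0<\beta\le 1$, and suppose $h_0\ge h_{\min}>0$. Let $f\in H^1(\mathbb R)$, $f\not\equiv0$, and let $(\zeta_3,\overline V_3)$ be the solution of $$\partial_t\zeta_3+\partial_X(h_0\overline V_3)=0,\qquad \partial_t\overline V_3+\partial_X\zeta_3=0,\qquad (\zeta_3,\overline V_3)|_{t=0}=(0,f').$$ Then $\zeta_1(t,X)=t\,\zeta_3(t,X)$ is a non-trivial solution of $$\partial_t^2\zeta_1-\partial_X(h_0\partial_X\zeta_1)=\partial_t^2b_m,\qquad \zeta_1|_{t=0}=0,\quad \partial_t\zeta_1|_{t=0}=0,$$ with $$b_m(t,X)=2\int_0^t\zeta_3(s,X)\,ds,$$ and $b_m(t,\cdot)$ is bounded in $L^2(\mathbb R)$ and in $L^\infty(\mathbb R)$ uniformly in $t$: there is a constant $C$ independent of $t$ such that $$|b_m(t,\cdot)|_{L^2}+|b_m(t,\cdot)|_{L^\infty}\le C .$$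
   Context: One space dimension, $X\in\mathbb R$, $t\ge0$. $h_0=1-\beta b_0$ is the nondimensional still water depth over the fixed bottom $b_0$, $b_m$ is the moving part of the bottom and $\zeta_1$ the surface elevation. Solutions are understood in the sense of distributions, with the natural regularity of the first-order linear hyperbolic system for $L^2$ initial data. *)

theory Defs
  imports "HOL-Analysis.Analysis" "HOL-Probability.Essential_Supremum"
begin

section \<open>Test functions\<close>

definition dir_deriv :: "'a::real_normed_vector \<Rightarrow> ('a \<Rightarrow> real) \<Rightarrow> 'a \<Rightarrow> real" where
  "dir_deriv v \<phi> = (\<lambda>x. frechet_derivative \<phi> (at x) v)"

text \<open>In finite dimension this is \<open>C\<^sup>\<infinity>\<close>: every iterated directional derivative is differentiable,
  hence continuous.\<close>

definition smooth :: "('a::real_normed_vector \<Rightarrow> real) \<Rightarrow> bool" where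
  "smooth \<phi> \<longleftrightarrow> (\<forall>vs x. foldr dir_deriv vs \<phi> differentiable at x)"

definition test_fun :: "'a::real_normed_vector set \<Rightarrow> ('a \<Rightarrow> real) \<Rightarrow> bool" where
  "test_fun \<Omega> \<phi> \<longleftrightarrow>
     smooth \<phi> \<and> compact (closure {x. \<phi> x \<noteq> 0}) \<and> closure {x. \<phi> x \<noteq> 0} \<subseteq> \<Omega>"

section \<open>Function spaces on the real line\<close>

definition in_L2 :: "(real \<Rightarrow> real) \<Rightarrow> bool" where
  "in_L2 u \<longleftrightarrow> u \<in> borel_measurable lborel \<and> integrable lborel (\<lambda>x. (u x)\<^sup>2)"

definition L2_norm :: "(real \<Rightarrow> real) \<Rightarrow> real" where
  "L2_norm u = sqrt (LINT x|lborel. (u x)\<^sup>2)"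

definition Linf_norm :: "(real \<Rightarrow> real) \<Rightarrow> ereal" where
  "Linf_norm u = esssup lborel (\<lambda>x. ereal \<bar>u x\<bar>)"

definition weak_deriv :: "(real \<Rightarrow> real) \<Rightarrow> (real \<Rightarrow> real) \<Rightarrow> bool" where
  "weak_deriv u u' \<longleftrightarrow> (\<forall>\<phi>. test_fun UNIV \<phi> \<longrightarrow>
     (LINT x|lborel. u x * deriv \<phi> x) = - (LINT x|lborel. u' x * \<phi> x))"

text \<open>Membership of \<open>u\<close> in \<open>H\<^sup>1(\<real>)\<close>, with \<open>u'\<close> a representative of its weak derivative.\<close>

definition in_H1 :: "(real \<Rightarrow> real) \<Rightarrow> (real \<Rightarrow> real) \<Rightarrow> bool" where
  "in_H1 u u' \<longleftrightarrow> in_L2 u \<and> in_L2 u' \<and> weak_deriv u u'"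

definition H1_norm_test :: "(real \<Rightarrow> real) \<Rightarrow> real" where
  "H1_norm_test \<psi> = sqrt ((L2_norm \<psi>)\<^sup>2 + (L2_norm (deriv \<psi>))\<^sup>2)"

section \<open>Time-dependent functions\<close>

text \<open>\<open>C([0,\<infinity>); L\<^sup>2(\<real>))\<close>, for functions written as \<open>u t x\<close>. Such a curve in \<open>L\<^sup>2\<close> always has a
  jointly Borel measurable representative; \<open>u\<close> is required to be one, so that it is also a
  (locally square integrable) function of \<open>(t, x)\<close>. Values at \<open>t < 0\<close> play no role.\<close>

definition C_L2 :: "(real \<Rightarrow> real \<Rightarrow> real) \<Rightarrow> bool" where
  "C_L2 u \<longleftrightarrow>
     set_borel_measurable lborel ({0..} \<times> UNIV) (\<lambda>p. u (fst p) (snd p)) \<and>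
     (\<forall>t\<ge>0. in_L2 (u t)) \<and>
     (\<forall>t\<^sub>0\<ge>0. ((\<lambda>t. L2_norm (\<lambda>x. u t x - u t\<^sub>0 x)) \<longlongrightarrow> 0) (at t\<^sub>0 within {0..}))"

text \<open>\<open>u\<close>, as a curve of distributions on \<open>\<real>\<close>, has the time derivative \<open>du \<in> C([0,\<infinity>); H\<^sup>-\<^sup>1(\<real>))\<close>
  (one-sided at \<open>t = 0\<close>). An element of \<open>H\<^sup>-\<^sup>1\<close> is represented by its action on test functions,
  bounded in the \<open>H\<^sup>1\<close> norm.\<close>

definition time_deriv_Hm1 ::
  "(real \<Rightarrow> real \<Rightarrow> real) \<Rightarrow> (real \<Rightarrow> (real \<Rightarrow> real) \<Rightarrow> real) \<Rightarrow> bool" where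
  "time_deriv_Hm1 u du \<longleftrightarrow>
     (\<forall>\<psi>. test_fun UNIV \<psi> \<longrightarrow> (\<forall>t\<ge>0.
        ((\<lambda>s. LINT x|lborel. u s x * \<psi> x) has_real_derivative du t \<psi>) (at t within {0..}))) \<and>
     (\<forall>t\<ge>0. \<exists>K. \<forall>\<psi>. test_fun UNIV \<psi> \<longrightarrow> \<bar>du t \<psi>\<bar> \<le> K * H1_norm_test \<psi>) \<and>
     (\<forall>t\<^sub>0\<ge>0. \<forall>\<epsilon>>0. \<forall>\<^sub>F t in at t\<^sub>0 within {0..}.
        \<forall>\<psi>. test_fun UNIV \<psi> \<longrightarrow> \<bar>du t \<psi> - du t\<^sub>0 \<psi>\<bar> \<le> \<epsilon> * H1_norm_test \<psi>)"

section \<open>Distributions on the open half plane\<close>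

type_synonym distr = "(real \<times> real \<Rightarrow> real) \<Rightarrow> real"

definition half_plane :: "(real \<times> real) set" where
  "half_plane = {0<..} \<times> UNIV"

definition distr_of :: "(real \<Rightarrow> real \<Rightarrow> real) \<Rightarrow> distr" where
  "distr_of u = (\<lambda>\<phi>. LINT p|lborel. u (fst p) (snd p) * \<phi> p)"

definition Dt :: "distr \<Rightarrow> distr" where
  "Dt T = (\<lambda>\<phi>. - T (dir_deriv (1, 0) \<phi>))"

definition DX :: "distr \<Rightarrow> distr" where
  "DX T = (\<lambda>\<phi>. - T (dir_deriv (0, 1) \<phi>))"

text \<open>The distribution \<open>h \<partial>\<^sub>X u\<close> for \<open>u \<in> C([0,\<infinity>); L\<^sup>2)\<close> and a bounded coefficient \<open>h = h(X)\<close> with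
  weak derivative \<open>h' \<in> L\<^sup>2\<close>. As \<open>\<partial>\<^sub>X u\<close> is not a function and \<open>h\<close> is not smooth, the product is
  given by the Leibniz rule \<open>h \<partial>\<^sub>X u = \<partial>\<^sub>X (h u) - h' u\<close>.\<close>

definition mult_DX :: "(real \<Rightarrow> real) \<Rightarrow> (real \<Rightarrow> real) \<Rightarrow> (real \<Rightarrow> real \<Rightarrow> real) \<Rightarrow> distr" where
  "mult_DX h h' u =
     (\<lambda>\<phi>. DX (distr_of (\<lambda>t x. h x * u t x)) \<phi> - distr_of (\<lambda>t x. h' x * u t x) \<phi>)"

definition distr_eq :: "distr \<Rightarrow> distr \<Rightarrow> bool" where
  "distr_eq S T \<longleftrightarrow> (\<forall>\<phi>. test_fun half_plane \<phi> \<longrightarrow> S \<phi> = T \<phi>)"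

section \<open>The two Cauchy problems\<close>

definition first_order_solution ::
  "(real \<Rightarrow> real) \<Rightarrow> (real \<Rightarrow> real) \<Rightarrow> (real \<Rightarrow> real) \<Rightarrow>
   (real \<Rightarrow> real \<Rightarrow> real) \<Rightarrow> (real \<Rightarrow> real \<Rightarrow> real) \<Rightarrow> bool" where
  "first_order_solution h \<zeta>\<^sub>0 V\<^sub>0 \<zeta> V \<longleftrightarrow>
     C_L2 \<zeta> \<and> C_L2 V \<and>
     distr_eq (\<lambda>\<phi>. Dt (distr_of \<zeta>) \<phi> + DX (distr_of (\<lambda>t x. h x * V t x)) \<phi>) (\<lambda>\<phi>. 0) \<and>
     distr_eq (\<lambda>\<phi>. Dt (distr_of V) \<phi> + DX (distr_of \<zeta>) \<phi>) (\<lambda>\<phi>. 0) \<and>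
     (AE x in lborel. \<zeta> 0 x = \<zeta>\<^sub>0 x) \<and> (AE x in lborel. V 0 x = V\<^sub>0 x)"

text \<open>\<open>\<partial>\<^sub>t\<^sup>2 \<zeta> - \<partial>\<^sub>X (h \<partial>\<^sub>X \<zeta>) = \<partial>\<^sub>t\<^sup>2 b\<close> with zero Cauchy data, for
  \<open>\<zeta> \<in> C([0,\<infinity>); L\<^sup>2) \<inter> C\<^sup>1([0,\<infinity>); H\<^sup>-\<^sup>1)\<close>; \<open>h'\<close> is the weak derivative of \<open>h\<close>.\<close>

definition wave_solution ::
  "(real \<Rightarrow> real) \<Rightarrow> (real \<Rightarrow> real) \<Rightarrow> (real \<Rightarrow> real \<Rightarrow> real) \<Rightarrow> (real \<Rightarrow> real \<Rightarrow> real) \<Rightarrow> bool" where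
  "wave_solution h h' b \<zeta> \<longleftrightarrow>
     C_L2 b \<and> C_L2 \<zeta> \<and>
     distr_eq (\<lambda>\<phi>. Dt (Dt (distr_of \<zeta>)) \<phi> - DX (mult_DX h h' \<zeta>) \<phi>) (Dt (Dt (distr_of b))) \<and>
     (AE x in lborel. \<zeta> 0 x = 0) \<and>
     (\<exists>d\<zeta>. time_deriv_Hm1 \<zeta> d\<zeta> \<and> (\<forall>\<psi>. test_fun UNIV \<psi> \<longrightarrow> d\<zeta> 0 \<psi> = 0))"

definition nontrivial :: "(real \<Rightarrow> real \<Rightarrow> real) \<Rightarrow> bool" where
  "nontrivial u \<longleftrightarrow> \<not> (AE p in lborel. p \<in> half_plane \<longrightarrow> u (fst p) (snd p) = 0)"

end

theory Submission
  imports Defs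
begin

text \<open>
  Put \<open>Z = \<integral>\<^sub>0\<^sup>t \<zeta>\<^sub>3\<close> and \<open>W = \<integral>\<^sub>0\<^sup>t V\<^sub>3\<close>. Integrating the system in time turns it into \<open>\<partial>\<^sub>x (f - Z) = V\<^sub>3\<close> and
  \<open>\<partial>\<^sub>x (h\<^sub>0 W) = - \<zeta>\<^sub>3\<close>, so the pair \<open>(f - Z, W)\<close> solves a first-order system for which both
  sides are square integrable functions, and the energy \<open>\<integral> (f - Z)\<^sup>2 + h\<^sub>0 W\<^sup>2\<close> is conserved
  without any regularisation. This bounds \<open>Z\<close> in \<open>L\<^sup>2\<close>. The same identity for time increments of
  the pair bounds \<open>V\<^sub>3 = f' - \<partial>\<^sub>x Z\<close> in \<open>L\<^sup>2\<close>, and a Sobolev inequality bounds \<open>Z\<close> in \<open>L\<^sup>\<infinity>\<close>.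
  The wave equation holds because \<open>\<partial>\<^sub>t\<^sup>2 (t \<zeta>\<^sub>3) = t \<partial>\<^sub>t\<^sup>2 \<zeta>\<^sub>3 + 2 \<partial>\<^sub>t \<zeta>\<^sub>3\<close> and \<open>2 \<partial>\<^sub>t \<zeta>\<^sub>3 = \<partial>\<^sub>t\<^sup>2 b\<^sub>m\<close>.
\<close>

section \<open>Square integrable functions\<close>

text \<open>The natural energy, the integral of \<zeta>^2 + h V^2, cannot be differentiated
  directly: for L^2 data the X-derivatives in the system are only distributions, and multiplication
  by the rough depth does not commute with a mollifier. Passing to time integrals gains one
  derivative, after which all the derivatives in the system are L^2 functions. The datum f' being a
  derivative is what makes the potential f - Z available. As Z and W start at 0, the conserved
  energy is the integral of f^2. Increments in time can be treated in the same way because the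
  system is linear with coefficients independent of t. Over a step d they start with energy of order
  d^2, so division by d leaves a bound for V_3 that does not depend on t. The lower bound of the
  depth makes the energy control W; its upper bound, a Sobolev bound for b_0, controls the initial
  energy. The rough depth reappears in the wave equation: the momentum equation has to be multiplied
  by h_0, and h_0 times a test function is no longer a test function.\<close>

lemma in_L2_measurable [measurable_dest]: "in_L2 u \<Longrightarrow> u \<in> borel_measurable borel"
  by (simp add: in_L2_def)

lemma in_L2_square_integrable: "in_L2 u \<Longrightarrow> integrable lborel (\<lambda>x. (u x)\<^sup>2)"
  by (simp add: in_L2_def)

lemma abs_mult_le_sum_squares: "\<bar>a * b\<bar> \<le> a\<^sup>2 + (b::real)\<^sup>2"
proof -
  have "2 * \<bar>a\<bar> * \<bar>b\<bar> \<le> a\<^sup>2 + b\<^sup>2" using sum_squares_bound[of "\<bar>a\<bar>" "\<bar>b\<bar>"] by simp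
  moreover have "0 \<le> \<bar>a\<bar> * \<bar>b\<bar>" by simp
  ultimately show ?thesis unfolding abs_mult by linarith
qed

lemma in_L2_mult_integrable:
  assumes "in_L2 u" "in_L2 v"
  shows "integrable lborel (\<lambda>x. u x * v x)"
proof (rule Bochner_Integration.integrable_bound)
  show "integrable lborel (\<lambda>x. (u x)\<^sup>2 + (v x)\<^sup>2)"
    using assms by (simp add: in_L2_def)
  show "(\<lambda>x. u x * v x) \<in> borel_measurable lborel"
    using assms by (auto simp: in_L2_def)
  show "AE x in lborel. norm (u x * v x) \<le> norm ((u x)\<^sup>2 + (v x)\<^sup>2)"
    using abs_mult_le_sum_squares by (auto intro!: AE_I2 intro: order_trans)
qed

lemma in_L2_bound:
  assumes "in_L2 v" and [measurable]: "u \<in> borel_measurable borel" and "AE x in lborel. \<bar>u x\<bar> \<le> \<bar>v x\<bar>"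
  shows "in_L2 u"
  unfolding in_L2_def
proof
  show "integrable lborel (\<lambda>x. (u x)\<^sup>2)"
  proof (rule Bochner_Integration.integrable_bound[OF in_L2_square_integrable[OF assms(1)]])
    show "AE x in lborel. norm ((u x)\<^sup>2) \<le> norm ((v x)\<^sup>2)"
      using assms(3) by eventually_elim (simp add: abs_le_square_iff)
  qed measurable
qed simp

lemma in_L2_add:
  assumes "in_L2 u" "in_L2 v" shows "in_L2 (\<lambda>x. u x + v x)"
  unfolding in_L2_def
proof
  have "integrable lborel (\<lambda>x. (u x)\<^sup>2 + (v x)\<^sup>2 + 2 * (u x * v x))"
    using in_L2_mult_integrable[OF assms] assms by (simp add: in_L2_def)
  then show "integrable lborel (\<lambda>x. (u x + v x)\<^sup>2)"
    by (simp add: power2_sum algebra_simps)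
qed (use assms in \<open>auto simp: in_L2_def\<close>)

lemma in_L2_cmult: "in_L2 u \<Longrightarrow> in_L2 (\<lambda>x. c * u x)"
  by (auto simp: in_L2_def power_mult_distrib)

lemma in_L2_minus: "in_L2 u \<Longrightarrow> in_L2 (\<lambda>x. - u x)"
  using in_L2_cmult[of u "-1"] by simp

lemma in_L2_diff:
  assumes "in_L2 u" "in_L2 v" shows "in_L2 (\<lambda>x. u x - v x)"
  using in_L2_add[OF assms(1) in_L2_minus[OF assms(2)]] by simp

lemma in_L2_indicator: "in_L2 (indicator {a..b})"
proof -
  have "integrable lborel (indicator {a..b} :: real \<Rightarrow> real)"
    by (auto simp: integrable_indicator_iff emeasure_lborel_Icc_eq)
  moreover have "(\<lambda>x. (indicator {a..b} x :: real)\<^sup>2) = indicator {a..b}"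
    by (auto simp: indicator_def)
  ultimately show ?thesis
    by (simp add: in_L2_def)
qed

lemma in_L2_abs: "in_L2 u \<Longrightarrow> in_L2 (\<lambda>x. \<bar>u x\<bar>)"
  by (auto simp: in_L2_def)

lemma in_L2_set_integrable:
  assumes "in_L2 u" shows "set_integrable lborel {a..b} u"
  using in_L2_mult_integrable[OF in_L2_indicator[of a b] assms] by (simp add: set_integrable_def)

lemma in_L2_bounded_mult:
  assumes "in_L2 u" and [measurable]: "k \<in> borel_measurable borel" and "AE x in lborel. \<bar>k x\<bar> \<le> M"
  shows "in_L2 (\<lambda>x. k x * u x)"
proof (rule in_L2_bound[OF in_L2_cmult[OF assms(1), of M]])
  show "(\<lambda>x. k x * u x) \<in> borel_measurable borel"
    using in_L2_measurable[OF assms(1)] by measurable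
  show "AE x in lborel. \<bar>k x * u x\<bar> \<le> \<bar>M * u x\<bar>"
    using assms(3) by eventually_elim (auto simp: abs_mult intro!: mult_right_mono)
qed

lemma L2_norm_nonneg [simp]: "0 \<le> L2_norm u"
  by (simp add: L2_norm_def)

lemma L2_norm_sq: "(L2_norm u)\<^sup>2 = (LBINT x. (u x)\<^sup>2)"
  by (simp add: L2_norm_def)

lemma L2_norm_zero [simp]: "L2_norm (\<lambda>x. 0) = 0"
  by (simp add: L2_norm_def)

lemma L2_norm_cmult: "L2_norm (\<lambda>x. c * u x) = \<bar>c\<bar> * L2_norm u"
  by (simp add: L2_norm_def power_mult_distrib real_sqrt_mult)

lemma L2_norm_minus: "L2_norm (\<lambda>x. - u x) = L2_norm u"
  by (simp add: L2_norm_def)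

lemma L2_norm_diff_commute: "L2_norm (\<lambda>x. u x - v x) = L2_norm (\<lambda>x. v x - u x)"
  by (simp add: L2_norm_def power2_commute)

lemma L2_norm_cong_AE:
  assumes "AE x in lborel. u x = v x"
    and [measurable]: "u \<in> borel_measurable borel" "v \<in> borel_measurable borel"
  shows "L2_norm u = L2_norm v"
  unfolding L2_norm_def using assms(1) by (intro arg_cong[where f=sqrt] integral_cong_AE) auto

lemma L2_norm_mono:
  assumes "in_L2 v" and "AE x in lborel. \<bar>u x\<bar> \<le> \<bar>v x\<bar>"
  shows "L2_norm u \<le> L2_norm v"
  unfolding L2_norm_def
proof (intro real_sqrt_le_mono integral_mono_AE')
  show "AE x in lborel. (u x)\<^sup>2 \<le> (v x)\<^sup>2"
    using assms(2) by eventually_elim (simp add: abs_le_square_iff)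
qed (use assms in \<open>auto simp: in_L2_def\<close>)

lemma L2_norm_eq_0_iff:
  assumes "in_L2 u" shows "L2_norm u = 0 \<longleftrightarrow> (AE x in lborel. u x = 0)"
proof -
  have "L2_norm u = 0 \<longleftrightarrow> (LBINT x. (u x)\<^sup>2) = 0"
    by (simp add: L2_norm_def)
  also have "\<dots> \<longleftrightarrow> (AE x in lborel. (u x)\<^sup>2 = 0)"
    using assms by (intro integral_nonneg_eq_0_iff_AE) (auto simp: in_L2_def)
  finally show ?thesis by simp
qed

text \<open>The quadratic s -> ||s u + v||^2 is nonnegative, which bounds its discriminant.\<close>

lemma L2_Cauchy_Schwarz:
  assumes u: "in_L2 u" and v: "in_L2 v"
  shows "\<bar>LBINT x. u x * v x\<bar> \<le> L2_norm u * L2_norm v"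
proof -
  define a b c where "a = (L2_norm u)\<^sup>2" and "b = (LBINT x. u x * v x)" and "c = (L2_norm v)\<^sup>2"
  have q: "0 \<le> s\<^sup>2 * a + 2 * s * b + c" for s
  proof -
    have "0 \<le> (LBINT x. (s * u x + v x)\<^sup>2)" by simp
    also have "\<dots> = (LBINT x. s\<^sup>2 * (u x)\<^sup>2 + 2 * s * (u x * v x) + (v x)\<^sup>2)"
      by (simp add: power2_sum power_mult_distrib algebra_simps)
    also have "\<dots> = s\<^sup>2 * a + 2 * s * b + c"
      using in_L2_mult_integrable[OF u v] in_L2_square_integrable[OF u] in_L2_square_integrable[OF v]
      by (simp add: a_def b_def c_def L2_norm_sq)
    finally show ?thesis .
  qed
  have a0: "0 \<le> a" by (simp add: a_def)
  have "b\<^sup>2 \<le> a * c"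
  proof (cases "a = 0")
    case True
    have "b = 0"
    proof (rule ccontr)
      assume "b \<noteq> 0"
      \<comment> \<open>With a = 0 the quadratic is affine in s, and a nonzero slope would let it
        take the value -1.\<close>
      then have "2 * (- (c + 1) / (2 * b)) * b + c = -1" by (simp add: field_simps)
      then show False using q[of "- (c + 1) / (2 * b)"] True by simp
    qed
    then show ?thesis using True by simp
  next
    case False
    then have "0 < a" using a0 by simp
    \<comment> \<open>This s minimises the quadratic.\<close>
    have "0 \<le> (- b / a)\<^sup>2 * a + 2 * (- b / a) * b + c" by (rule q)
    also have "\<dots> = c - b\<^sup>2 / a" using \<open>0 < a\<close> by (simp add: field_simps power2_eq_square)
    finally show ?thesis using \<open>0 < a\<close> by (simp add: field_simps)
  qed
  then have "b\<^sup>2 \<le> (L2_norm u * L2_norm v)\<^sup>2"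
    by (simp add: a_def c_def power_mult_distrib)
  then show ?thesis
    unfolding b_def using abs_le_square_iff[of b "L2_norm u * L2_norm v"] b_def by (simp add: abs_mult)
qed

lemma L2_norm_add_le:
  assumes u: "in_L2 u" and v: "in_L2 v"
  shows "L2_norm (\<lambda>x. u x + v x) \<le> L2_norm u + L2_norm v"
proof -
  have "(L2_norm (\<lambda>x. u x + v x))\<^sup>2 = (LBINT x. (u x)\<^sup>2 + 2 * (u x * v x) + (v x)\<^sup>2)"
    by (simp add: L2_norm_sq power2_sum algebra_simps)
  also have "\<dots> = (L2_norm u)\<^sup>2 + 2 * (LBINT x. u x * v x) + (L2_norm v)\<^sup>2"
    using in_L2_mult_integrable[OF u v] in_L2_square_integrable[OF u] in_L2_square_integrable[OF v]
    by (simp add: L2_norm_sq)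
  also have "\<dots> \<le> (L2_norm u + L2_norm v)\<^sup>2"
    using L2_Cauchy_Schwarz[OF u v] by (simp add: power2_sum)
  finally show ?thesis by (rule power2_le_imp_le) simp
qed

lemma L2_norm_diff_le:
  assumes u: "in_L2 u" and v: "in_L2 v"
  shows "L2_norm (\<lambda>x. u x - v x) \<le> L2_norm u + L2_norm v"
  using L2_norm_add_le[OF u in_L2_minus[OF v]] by (simp add: L2_norm_minus)

lemma L2_norm_le_add_diff:
  assumes u: "in_L2 u" and v: "in_L2 v"
  shows "L2_norm u \<le> L2_norm v + L2_norm (\<lambda>x. u x - v x)"
  using L2_norm_add_le[OF v in_L2_diff[OF u v]] by simp

lemma L2_norm_bounded_mult_le:
  assumes "in_L2 u" and "0 \<le> M" and "AE x in lborel. \<bar>k x\<bar> \<le> M"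
  shows "L2_norm (\<lambda>x. k x * u x) \<le> M * L2_norm u"
proof -
  have "L2_norm (\<lambda>x. k x * u x) \<le> L2_norm (\<lambda>x. M * u x)"
  proof (rule L2_norm_mono[OF in_L2_cmult[OF assms(1)]])
    show "AE x in lborel. \<bar>k x * u x\<bar> \<le> \<bar>M * u x\<bar>"
      using assms(3) by eventually_elim (auto simp: abs_mult intro!: mult_right_mono)
  qed
  then show ?thesis using assms(2) by (simp add: L2_norm_cmult)
qed

section \<open>Smooth functions\<close>

lemma smooth_differentiable: "smooth \<phi> \<Longrightarrow> \<phi> differentiable at x"
  unfolding smooth_def by (metis foldr.simps(1) id_apply)

lemma smooth_dir_deriv: "smooth \<phi> \<Longrightarrow> smooth (dir_deriv v \<phi>)"
  unfolding smooth_def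
proof (intro allI)
  fix vs x assume a: "\<forall>vs x. foldr dir_deriv vs \<phi> differentiable at x"
  show "foldr dir_deriv vs (dir_deriv v \<phi>) differentiable at x"
    using a[rule_format, of "vs @ [v]" x] by simp
qed

text \<open>Iterated derivatives leave any fixed formula, so smoothness is proved through a whole
  class \<open>F\<close> that contains the function, is stable under directional derivatives and has
  only differentiable members.\<close>

lemma smooth_coinduct:
  assumes "\<phi> \<in> F"
    and "\<And>g x. g \<in> F \<Longrightarrow> g differentiable at x"
    and "\<And>g v. g \<in> F \<Longrightarrow> dir_deriv v g \<in> F"
  shows "smooth \<phi>"
  unfolding smooth_def
proof (intro allI)
  fix vs x
  have "foldr dir_deriv vs \<phi> \<in> F"
    by (induction vs) (use assms in auto)
  then show "foldr dir_deriv vs \<phi> differentiable at x" by (rule assms(2))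
qed

lemma smooth_has_derivative: "smooth \<phi> \<Longrightarrow> (\<phi> has_derivative (\<lambda>v. dir_deriv v \<phi> x)) (at x)"
  unfolding dir_deriv_def using smooth_differentiable frechet_derivative_works by fastforce

lemma dir_derivI: "(\<And>x. (\<phi> has_derivative (\<phi>' x)) (at x)) \<Longrightarrow> dir_deriv v \<phi> = (\<lambda>x. \<phi>' x v)"
  unfolding dir_deriv_def by (rule ext) (metis frechet_derivative_at)

lemma smooth_isCont: "smooth \<phi> \<Longrightarrow> isCont \<phi> x"
  using smooth_differentiable differentiable_imp_continuous_within by blast

lemma smooth_continuous_on: "smooth \<phi> \<Longrightarrow> continuous_on A \<phi>"
  by (simp add: smooth_isCont continuous_at_imp_continuous_on)

lemma smooth_measurable [measurable_dest]: "smooth \<phi> \<Longrightarrow> \<phi> \<in> borel_measurable borel"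
  by (intro borel_measurable_continuous_onI smooth_continuous_on)

lemma smooth_const [simp]: "smooth (\<lambda>x. c)"
proof (rule smooth_coinduct[where F="range (\<lambda>c x. c)"])
  fix g :: "'a \<Rightarrow> real" and v assume "g \<in> range (\<lambda>c x. c)"
  then obtain d where g: "g = (\<lambda>x. d)" by auto
  have "dir_deriv v g = (\<lambda>x. 0)"
    unfolding g by (rule dir_derivI) (rule has_derivative_const)
  then show "dir_deriv v g \<in> range (\<lambda>c x. c)" by auto
qed auto

lemma dir_deriv_bounded_linear:
  assumes "bounded_linear b" shows "dir_deriv v b = (\<lambda>x. b v)"
  by (rule dir_derivI) (use assms in \<open>rule bounded_linear_imp_has_derivative\<close>)

lemma smooth_bounded_linear:
  assumes "bounded_linear b" shows "smooth b"
proof (rule smooth_coinduct[where F="insert b (range (\<lambda>c x. c))"])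
  fix g v assume "g \<in> insert b (range (\<lambda>c x. c))"
  then consider "g = b" | d where "g = (\<lambda>x. d)" by auto
  then show "dir_deriv v g \<in> insert b (range (\<lambda>c x. c))"
  proof cases
    case 1 then show ?thesis using dir_deriv_bounded_linear[OF assms] by auto
  next
    case 2
    have "dir_deriv v g = (\<lambda>x. 0)"
      unfolding 2 by (rule dir_derivI) (rule has_derivative_const)
    then show ?thesis by auto
  qed
qed (use assms bounded_linear_imp_differentiable in auto)

lemma dir_deriv_add:
  assumes "smooth g" "smooth h"
  shows "dir_deriv v (\<lambda>x. g x + h x) = (\<lambda>x. dir_deriv v g x + dir_deriv v h x)"
  by (rule dir_derivI) (intro has_derivative_add smooth_has_derivative assms)

lemma dir_deriv_mult:
  assumes "smooth g" "smooth h"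
  shows "dir_deriv v (\<lambda>x. g x * h x) = (\<lambda>x. g x * dir_deriv v h x + dir_deriv v g x * h x)"
  by (rule dir_derivI) (intro has_derivative_mult smooth_has_derivative assms)

lemma dir_deriv_affine:
  assumes "smooth g" "bounded_linear L"
  shows "dir_deriv v (\<lambda>x. g (L x + c)) = (\<lambda>x. dir_deriv (L v) g (L x + c))"
proof (rule dir_derivI)
  fix x
  have "((\<lambda>x. L x + c) has_derivative L) (at x)"
    using bounded_linear_imp_has_derivative[OF assms(2)] by (auto intro!: derivative_eq_intros)
  from has_derivative_compose[OF this smooth_has_derivative[OF assms(1)]]
  show "((\<lambda>x. g (L x + c)) has_derivative (\<lambda>v. dir_deriv (L v) g (L x + c))) (at x)" .
qed

lemma smooth_add:
  assumes "smooth g" "smooth h" shows "smooth (\<lambda>x. g x + h x)"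
proof (rule smooth_coinduct[where F="{\<lambda>x. g x + h x | g h. smooth g \<and> smooth h}"])
  show "(\<lambda>x. g x + h x) \<in> {\<lambda>x. g x + h x | g h. smooth g \<and> smooth h}"
    using assms by blast
next
  fix k :: "'a \<Rightarrow> real" and x assume "k \<in> {\<lambda>x. g x + h x | g h. smooth g \<and> smooth h}"
  then obtain g h where "k = (\<lambda>x. g x + h x)" "smooth g" "smooth h" by blast
  then show "k differentiable at x" using smooth_differentiable by (auto intro!: differentiable_add)
next
  fix k :: "'a \<Rightarrow> real" and v assume "k \<in> {\<lambda>x. g x + h x | g h. smooth g \<and> smooth h}"
  then show "dir_deriv v k \<in> {\<lambda>x. g x + h x | g h. smooth g \<and> smooth h}"
    using dir_deriv_add smooth_dir_deriv by blast
qed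

text \<open>The product rule turns one product into a sum of two; closing the products under
  addition gives a class stable under directional derivatives.\<close>

inductive_set sums_of_products :: "('a::real_normed_vector \<Rightarrow> real) set" where
  "smooth g \<Longrightarrow> smooth h \<Longrightarrow> (\<lambda>x. g x * h x) \<in> sums_of_products"
| "k \<in> sums_of_products \<Longrightarrow> l \<in> sums_of_products \<Longrightarrow> (\<lambda>x. k x + l x) \<in> sums_of_products"

lemma smooth_mult:
  assumes "smooth g" "smooth h" shows "smooth (\<lambda>x. g x * h x)"
proof (rule smooth_coinduct[where F=sums_of_products])
  show "(\<lambda>x. g x * h x) \<in> sums_of_products"
    using assms by (rule sums_of_products.intros)
  \<comment> \<open>Both facts go through one induction: the derivative of a sum is split with the
    help of the differentiability of its summands.\<close>
  have diff: "(k differentiable at x) \<and> (\<forall>v. dir_deriv v k \<in> sums_of_products)"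
    if "k \<in> sums_of_products" for k :: "'a \<Rightarrow> real" and x
    using that
  proof (induction arbitrary: x)
    case (1 g h)
    then show ?case
      using smooth_differentiable[of g] smooth_differentiable[of h]
      by (auto simp: dir_deriv_mult smooth_dir_deriv intro!: differentiable_mult sums_of_products.intros)
  next
    case (2 k l)
    have "dir_deriv v (\<lambda>x. k x + l x) = (\<lambda>x. dir_deriv v k x + dir_deriv v l x)" for v
      using 2 by (intro dir_derivI) (auto simp: dir_deriv_def frechet_derivative_works[symmetric] intro!: has_derivative_add)
    then show ?case using 2 by (auto intro!: differentiable_add sums_of_products.intros)
  qed
  then show "k differentiable at x" if "k \<in> sums_of_products" for k :: "'a \<Rightarrow> real" and x using that by auto
  show "dir_deriv v k \<in> sums_of_products" if "k \<in> sums_of_products" for k :: "'a \<Rightarrow> real" and v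
    using diff that by auto
qed

lemma smooth_cmult: "smooth g \<Longrightarrow> smooth (\<lambda>x. c * g x)"
  using smooth_mult[OF smooth_const[of c]] .

lemma smooth_diff: "smooth g \<Longrightarrow> smooth h \<Longrightarrow> smooth (\<lambda>x. g x - h x)"
  using smooth_add[of g "\<lambda>x. - 1 * h x"] smooth_cmult[of h "-1"] by simp

lemma smooth_affine:
  assumes "smooth g" "bounded_linear L" shows "smooth (\<lambda>x. g (L x + c))"
proof (rule smooth_coinduct[where F="{\<lambda>x. g (L x + c) | g. smooth g}"])
  show "(\<lambda>x. g (L x + c)) \<in> {\<lambda>x. g (L x + c) | g. smooth g}" using assms(1) by auto
next
  fix k and x assume "k \<in> {\<lambda>x. g (L x + c) | g. smooth g}"
  then obtain g where g: "k = (\<lambda>x. g (L x + c))" "smooth g" by auto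
  have "(\<lambda>x. L x + c) differentiable at x"
    using bounded_linear_imp_differentiable[OF assms(2)] by (auto intro!: derivative_intros)
  then show "k differentiable at x"
    unfolding g using differentiable_chain_at[of "\<lambda>x. L x + c" x g] smooth_differentiable[OF g(2)]
    by (simp add: o_def)
next
  fix k and v assume "k \<in> {\<lambda>x. g (L x + c) | g. smooth g}"
  then show "dir_deriv v k \<in> {\<lambda>x. g (L x + c) | g. smooth g}"
    using dir_deriv_affine[OF _ assms(2)] smooth_dir_deriv by blast
qed

lemma smooth_line_derivative:
  assumes "smooth \<phi>"
  shows "((\<lambda>s. \<phi> (x + s *\<^sub>R v)) has_real_derivative dir_deriv v \<phi> (x + s *\<^sub>R v)) (at s)"
proof -
  have "((\<lambda>s. x + s *\<^sub>R v) has_derivative (\<lambda>h. h *\<^sub>R v)) (at s)"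
    by (auto intro!: derivative_eq_intros)
  from has_derivative_compose[OF this smooth_has_derivative[OF assms]]
  have "((\<lambda>s. \<phi> (x + s *\<^sub>R v)) has_derivative (\<lambda>h. dir_deriv (h *\<^sub>R v) \<phi> (x + s *\<^sub>R v))) (at s)" .
  moreover have "dir_deriv (h *\<^sub>R v) \<phi> y = h * dir_deriv v \<phi> y" for h y
    using linear_cmul[OF bounded_linear.linear[OF has_derivative_bounded_linear[OF smooth_has_derivative[OF assms, of y]]], of h v] by simp
  ultimately show ?thesis
    by (simp add: has_field_derivative_def mult_commute_abs)
qed

text \<open>Two applications of the mean value theorem: along \<open>v\<close>, to the difference in
  direction \<open>w\<close>, and then along \<open>w\<close>. The second difference is symmetric in
  \<open>v\<close> and \<open>w\<close>, while the right side records an order of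
  differentiation.\<close>

lemma second_difference:
  assumes "smooth \<phi>" "0 < h"
  obtains p where "dist p x \<le> h * (norm v + norm w)"
    and "\<phi> (x + h *\<^sub>R v + h *\<^sub>R w) - \<phi> (x + h *\<^sub>R v) - \<phi> (x + h *\<^sub>R w) + \<phi> x
      = h * h * dir_deriv w (dir_deriv v \<phi>) p"
proof -
  define k where "k = (\<lambda>s. \<phi> (x + h *\<^sub>R w + s *\<^sub>R v) - \<phi> (x + s *\<^sub>R v))"
  have "DERIV k s :> dir_deriv v \<phi> (x + h *\<^sub>R w + s *\<^sub>R v) - dir_deriv v \<phi> (x + s *\<^sub>R v)" for s
    unfolding k_def by (intro DERIV_diff smooth_line_derivative assms)
  from MVT2[OF assms(2) this] obtain \<xi> where \<xi>: "0 < \<xi>" "\<xi> < h"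
    "k h - k 0 = h * (dir_deriv v \<phi> (x + h *\<^sub>R w + \<xi> *\<^sub>R v) - dir_deriv v \<phi> (x + \<xi> *\<^sub>R v))"
    by auto
  have "DERIV (\<lambda>s. dir_deriv v \<phi> (x + \<xi> *\<^sub>R v + s *\<^sub>R w)) s :> dir_deriv w (dir_deriv v \<phi>) (x + \<xi> *\<^sub>R v + s *\<^sub>R w)" for s
    by (intro smooth_line_derivative smooth_dir_deriv assms)
  from MVT2[OF assms(2) this] obtain \<eta> where \<eta>: "0 < \<eta>" "\<eta> < h"
    "dir_deriv v \<phi> (x + \<xi> *\<^sub>R v + h *\<^sub>R w) - dir_deriv v \<phi> (x + \<xi> *\<^sub>R v) =
      h * dir_deriv w (dir_deriv v \<phi>) (x + \<xi> *\<^sub>R v + \<eta> *\<^sub>R w)" by auto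
  have "k h - k 0 = h * h * dir_deriv w (dir_deriv v \<phi>) (x + \<xi> *\<^sub>R v + \<eta> *\<^sub>R w)"
    using \<xi>(3) \<eta>(3) by (simp add: algebra_simps)
  moreover have "norm (\<xi> *\<^sub>R v + \<eta> *\<^sub>R w) \<le> \<xi> * norm v + \<eta> * norm w"
    using norm_triangle_ineq[of "\<xi> *\<^sub>R v" "\<eta> *\<^sub>R w"] \<xi> \<eta> by simp
  moreover have "\<xi> * norm v + \<eta> * norm w \<le> h * norm v + h * norm w"
    using \<xi> \<eta> by (intro add_mono mult_right_mono) auto
  ultimately show ?thesis
    by (intro that[of "x + \<xi> *\<^sub>R v + \<eta> *\<^sub>R w"]) (simp_all add: k_def dist_norm algebra_simps)
qed

text \<open>Both orders represent the same second difference, at points whose distance from x is at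
  most a multiple of the step; continuity of the second derivatives lets the step tend to 0.\<close>

lemma dir_deriv_commute:
  assumes "smooth \<phi>"
  shows "dir_deriv v (dir_deriv w \<phi>) = dir_deriv w (dir_deriv v \<phi>)" (is "?A = ?B")
proof
  fix x
  define c where "c = norm v + norm w"
  define e where "e = (\<lambda>n. inverse (real (Suc n)))"
  have "\<exists>p q. dist p x \<le> e n * c \<and> dist q x \<le> e n * c \<and> ?A p = ?B q" for n
  proof -
    have e: "0 < e n" by (simp add: e_def)
    obtain p where p: "dist p x \<le> e n * (norm w + norm v)"
      "\<phi> (x + e n *\<^sub>R w + e n *\<^sub>R v) - \<phi> (x + e n *\<^sub>R w) - \<phi> (x + e n *\<^sub>R v) + \<phi> x = e n * e n * ?A p"
      by (rule second_difference[OF assms e]) (rule that)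
    obtain q where q: "dist q x \<le> e n * (norm v + norm w)"
      "\<phi> (x + e n *\<^sub>R v + e n *\<^sub>R w) - \<phi> (x + e n *\<^sub>R v) - \<phi> (x + e n *\<^sub>R w) + \<phi> x = e n * e n * ?B q"
      by (rule second_difference[OF assms e]) (rule that)
    have "x + e n *\<^sub>R w + e n *\<^sub>R v = x + e n *\<^sub>R v + e n *\<^sub>R w" by (simp add: algebra_simps)
    then have "e n * e n * ?A p = e n * e n * ?B q" using p(2) q(2) by (simp only:)
    then show ?thesis using p(1) q(1) e by (auto simp: c_def add.commute)
  qed
  then obtain p q where pq: "\<And>n. dist (p n) x \<le> e n * c" "\<And>n. dist (q n) x \<le> e n * c" "\<And>n. ?A (p n) = ?B (q n)"
    by metis
  have "(\<lambda>n. e n * c) \<longlonglongrightarrow> 0"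
    unfolding e_def by (intro tendsto_mult_left_zero LIMSEQ_inverse_real_of_nat)
  then have lim: "r \<longlonglongrightarrow> x" if "\<And>n. dist (r n) x \<le> e n * c" for r
    by (rule metric_tendsto_imp_tendsto)
       (intro always_eventually allI order_trans[OF that], simp add: dist_real_def)
  have c: "isCont ?A x" "isCont ?B x" by (intro smooth_isCont smooth_dir_deriv assms)+
  have "(\<lambda>n. ?A (p n)) \<longlonglongrightarrow> ?A x" by (rule isCont_tendsto_compose[OF c(1) lim[OF pq(1)]])
  moreover have "(\<lambda>n. ?B (q n)) \<longlonglongrightarrow> ?B x" by (rule isCont_tendsto_compose[OF c(2) lim[OF pq(2)]])
  ultimately show "?A x = ?B x" unfolding pq(3) by (rule LIMSEQ_unique)
qed

lemma smooth_DERIV: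
  assumes "smooth \<phi>" shows "(\<phi> has_real_derivative deriv \<phi> x) (at x)"
proof -
  have "(\<phi> has_real_derivative dir_deriv 1 \<phi> x) (at x)"
    using smooth_line_derivative[OF assms, of 0 1 x] by simp
  then show ?thesis using DERIV_imp_deriv by fastforce
qed

lemma deriv_eq_dir_deriv:
  assumes "smooth \<phi>" shows "deriv \<phi> = dir_deriv 1 \<phi>"
proof
  fix x show "deriv \<phi> x = dir_deriv 1 \<phi> x"
    using smooth_line_derivative[OF assms, of 0 1 x] by (auto intro: DERIV_imp_deriv)
qed

lemma smooth_deriv: "smooth \<phi> \<Longrightarrow> smooth (deriv \<phi>)"
  by (simp add: deriv_eq_dir_deriv smooth_dir_deriv)

text \<open>The stable class is \<open>\<phi>\<close> together with all smooth functions: one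
  derivative of \<open>\<phi>\<close> already lands among them.\<close>

lemma smooth_antiderivative:
  assumes "\<And>x. (\<phi> has_real_derivative \<psi> x) (at x)" and "smooth \<psi>"
  shows "smooth \<phi>"
proof (rule smooth_coinduct[where F="insert \<phi> {g. smooth g}"])
  fix g x assume "g \<in> insert \<phi> {g. smooth g}"
  then show "g differentiable at x"
    using assms(1) smooth_differentiable[of g x] by (auto simp: real_differentiable_def)
next
  fix g v assume g: "g \<in> insert \<phi> {g. smooth g}"
  have "dir_deriv v \<phi> = (\<lambda>x. \<psi> x * v)"
    using assms(1) by (intro dir_derivI) (simp add: has_field_derivative_def)
  moreover have "smooth (\<lambda>x. \<psi> x * v)" using smooth_cmult[OF assms(2), of v] by (simp add: mult.commute)
  ultimately show "dir_deriv v g \<in> insert \<phi> {g. smooth g}"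
    using g smooth_dir_deriv by auto
qed simp

section \<open>Test functions\<close>

text \<open>The derivatives of \<open>exp (- 1 / x)\<close> on \<open>x > 0\<close> are combinations of the functions
  \<open>x\<^sup>-\<^sup>k exp (- 1 / x)\<close>, and each of these extends differentiably by zero.\<close>

definition flat :: "nat \<Rightarrow> real \<Rightarrow> real" where
  "flat k x = (if 0 < x then (1 / x) ^ k * exp (- (1 / x)) else 0)"

text \<open>With y = 1 / x this is the decay of y^k exp (- y) at infinity; to the left of 0 the
  function vanishes.\<close>

lemma flat_tendsto_0: "(flat k \<longlongrightarrow> 0) (at 0)"
proof -
  have "((\<lambda>y. y ^ k / exp y) \<longlongrightarrow> (0::real)) at_top" by (rule tendsto_power_div_exp_0)
  moreover have "filterlim (\<lambda>x::real. 1 / x) at_top (at_right 0)"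
    using filterlim_inverse_at_top_right by (simp add: inverse_eq_divide)
  ultimately have "((\<lambda>x. (1 / x) ^ k / exp (1 / x)) \<longlongrightarrow> (0::real)) (at_right 0)"
    by (rule filterlim_compose)
  then have "(flat k \<longlongrightarrow> 0) (at_right 0)"
    by (rule Lim_transform_eventually)
       (auto simp: eventually_at_filter flat_def exp_minus divide_inverse)
  moreover have "(flat k \<longlongrightarrow> 0) (at_left 0)"
    by (rule tendsto_eventually) (auto simp: eventually_at_filter flat_def)
  ultimately show ?thesis using filterlim_split_at by blast
qed

lemma flat_DERIV: "(flat k has_real_derivative flat (k + 2) x - real k * flat (k + 1) x) (at x)"
proof -
  consider "x < 0" | "x = 0" | "0 < x" by linarith
  then show ?thesis
  proof cases
    case 1
    have "((\<lambda>x. 0) has_real_derivative 0) (at x)" by simp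
    then have "(flat k has_real_derivative 0) (at x)"
      by (rule has_field_derivative_transform_within_open[where S="{..<0}"]) (use 1 in \<open>auto simp: flat_def\<close>)
    then show ?thesis using 1 by (simp add: flat_def)
  next
    case 2
    \<comment> \<open>At 0 the difference quotient is again a member of the family: division by h
      raises the power of 1 / h by one.\<close>
    have "(\<lambda>h. (flat k (0 + h) - flat k 0) / h) = flat (k + 1)"
      by (auto simp: flat_def field_simps)
    then have "(flat k has_real_derivative 0) (at 0)"
      using flat_tendsto_0[of "k + 1"] unfolding DERIV_def by simp
    then show ?thesis using 2 by (simp add: flat_def)
  next
    case 3
    define y where "y = 1 / x"
    have "((\<lambda>y. y ^ k * exp (- y)) has_real_derivative real k * y ^ (k - 1) * exp (- y) - y ^ k * exp (- y)) (at y)"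
      by (auto intro!: derivative_eq_intros simp: algebra_simps)
    moreover have "((\<lambda>x. 1 / x) has_real_derivative - (y\<^sup>2)) (at x)"
      using 3 by (auto intro!: derivative_eq_intros simp: y_def power2_eq_square)
    ultimately have "((\<lambda>x. (1 / x) ^ k * exp (- (1 / x))) has_real_derivative
        (real k * y ^ (k - 1) * exp (- y) - y ^ k * exp (- y)) * - (y\<^sup>2)) (at x)"
      unfolding y_def by (rule DERIV_chain2)
    moreover have "(real k * y ^ (k - 1) * exp (- y) - y ^ k * exp (- y)) * - (y\<^sup>2) = flat (k + 2) x - real k * flat (k + 1) x"
      using 3 by (cases k) (auto simp: flat_def y_def[symmetric] power2_eq_square algebra_simps)
    ultimately have "((\<lambda>x. (1 / x) ^ k * exp (- (1 / x))) has_real_derivative flat (k + 2) x - real k * flat (k + 1) x) (at x)"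
      by simp
    then show ?thesis
      by (rule has_field_derivative_transform_within_open[where S="{0<..}"]) (use 3 in \<open>auto simp: flat_def\<close>)
  qed
qed

text \<open>Differentiating one member of the family gives a combination of two others, so two-term
  linear combinations suffice for stability.\<close>

inductive_set flat_combs :: "(real \<Rightarrow> real) set" where
  "flat k \<in> flat_combs"
| "g \<in> flat_combs \<Longrightarrow> h \<in> flat_combs \<Longrightarrow> (\<lambda>x. a * g x + b * h x) \<in> flat_combs"

lemma smooth_flat: "smooth (flat k)"
proof (rule smooth_coinduct[where F=flat_combs])
  have *: "\<exists>g'\<in>flat_combs. \<forall>x. (g has_real_derivative g' x) (at x)" if "g \<in> flat_combs" for g
    using that
  proof induction
    case (1 k)
    have "(\<lambda>x. 1 * flat (k + 2) x + (- real k) * flat (k + 1) x) \<in> flat_combs"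
      by (intro flat_combs.intros)
    moreover have "(flat k has_real_derivative 1 * flat (k + 2) x + (- real k) * flat (k + 1) x) (at x)" for x
      using flat_DERIV[of k x] by simp
    ultimately show ?case by (intro bexI allI)
  next
    case (2 g h a b)
    then obtain g' h' where "g' \<in> flat_combs" "h' \<in> flat_combs"
      and d: "\<And>x. (g has_real_derivative g' x) (at x)" "\<And>x. (h has_real_derivative h' x) (at x)" by auto
    then have "(\<lambda>x. a * g' x + b * h' x) \<in> flat_combs" by (intro flat_combs.intros)
    moreover have "((\<lambda>x. a * g x + b * h x) has_real_derivative a * g' x + b * h' x) (at x)" for x
      by (intro DERIV_add DERIV_cmult d)
    ultimately show ?case by (intro bexI allI)
  qed
  show "flat k \<in> flat_combs" by (rule flat_combs.intros)
  show "g differentiable at x" if "g \<in> flat_combs" for g x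
    using *[OF that] real_differentiable_def by auto
  show "dir_deriv v g \<in> flat_combs" if "g \<in> flat_combs" for g v
  proof -
    from *[OF that] obtain g' where g': "g' \<in> flat_combs" "\<And>x. (g has_real_derivative g' x) (at x)" by auto
    have "dir_deriv v g = (\<lambda>x. g' x * v)"
      using g'(2) by (intro dir_derivI) (simp add: has_field_derivative_def)
    \<comment> \<open>Scaling by \<open>v\<close> is put into the two-term form that the class
      offers, with second coefficient 0.\<close>
    also have "\<dots> = (\<lambda>x. v * g' x + 0 * g' x)" by auto
    finally show ?thesis using g'(1) by (metis flat_combs.intros(2))
  qed
qed

section \<open>Supports, bounds and primitives of test functions\<close>

lemma test_funI:
  assumes "smooth \<phi>" "\<And>x. \<phi> x \<noteq> 0 \<Longrightarrow> x \<in> K" "compact K" "K \<subseteq> \<Omega>"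
  shows "test_fun \<Omega> \<phi>"
proof -
  have sub: "closure {x. \<phi> x \<noteq> 0} \<subseteq> K"
    using assms by (intro closure_minimal) (auto intro: compact_imp_closed)
  have "compact (K \<inter> closure {x. \<phi> x \<noteq> 0})"
    using assms(3) by (intro compact_Int_closed closed_closure)
  then have "compact (closure {x. \<phi> x \<noteq> 0})"
    using sub by (simp only: inf.absorb2)
  then show ?thesis
    using assms(1,4) sub by (simp add: test_fun_def)
qed

lemma test_fun_smooth: "test_fun \<Omega> \<phi> \<Longrightarrow> smooth \<phi>"
  by (simp add: test_fun_def)

lemma test_fun_UNIV: "test_fun \<Omega> \<phi> \<Longrightarrow> test_fun UNIV \<phi>"
  by (simp add: test_fun_def)

lemma test_fun_support:
  assumes "test_fun \<Omega> \<phi>"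
  obtains K where "compact K" "K \<subseteq> \<Omega>" "\<And>x. \<phi> x \<noteq> 0 \<Longrightarrow> x \<in> K"
  using assms closure_subset[of "{x. \<phi> x \<noteq> 0}"] unfolding test_fun_def by blast

text \<open>The support is closed, so off it the function vanishes in a whole neighbourhood and its
  derivative vanishes too.\<close>

lemma test_fun_dir_deriv:
  assumes "test_fun \<Omega> \<phi>" shows "test_fun \<Omega> (dir_deriv v \<phi>)"
proof (rule test_funI[where K="closure {x. \<phi> x \<noteq> 0}"])
  fix x assume x: "dir_deriv v \<phi> x \<noteq> 0"
  show "x \<in> closure {x. \<phi> x \<noteq> 0}"
  proof (rule ccontr)
    assume n: "x \<notin> closure {x. \<phi> x \<noteq> 0}"
    have "((\<lambda>x. 0) has_derivative (\<lambda>v. 0)) (at x)" by simp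
    then have "(\<phi> has_derivative (\<lambda>v. 0)) (at x)"
      by (rule has_derivative_transform_within_open[where s="- closure {x. \<phi> x \<noteq> 0}"])
         (use n closure_subset[of "{x. \<phi> x \<noteq> 0}"] in auto)
    then have "frechet_derivative \<phi> (at x) = (\<lambda>v. 0)" by (metis frechet_derivative_at)
    then show False using x by (simp add: dir_deriv_def)
  qed
qed (use assms in \<open>auto simp: test_fun_def smooth_dir_deriv\<close>)

lemma test_fun_deriv: "test_fun \<Omega> \<phi> \<Longrightarrow> test_fun \<Omega> (deriv \<phi>)"
  by (simp add: deriv_eq_dir_deriv test_fun_smooth test_fun_dir_deriv)

lemma test_fun_mult_left:
  assumes "smooth g" "test_fun \<Omega> \<phi>" shows "test_fun \<Omega> (\<lambda>x. g x * \<phi> x)"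
proof -
  obtain K where K: "compact K" "K \<subseteq> \<Omega>" "\<And>x. \<phi> x \<noteq> 0 \<Longrightarrow> x \<in> K" by (rule test_fun_support[OF assms(2)]) (rule that)
  show ?thesis
    by (rule test_funI[OF smooth_mult[OF assms(1) test_fun_smooth[OF assms(2)]] _ K(1,2)]) (use K(3) in auto)
qed

lemma test_fun_cmult: "test_fun \<Omega> \<phi> \<Longrightarrow> test_fun \<Omega> (\<lambda>x. c * \<phi> x)"
  by (rule test_fun_mult_left) simp

lemma test_fun_diff:
  assumes "test_fun \<Omega> \<phi>" "test_fun \<Omega> \<psi>" shows "test_fun \<Omega> (\<lambda>x. \<phi> x - \<psi> x)"
proof -
  obtain K where K: "compact K" "K \<subseteq> \<Omega>" "\<And>x. \<phi> x \<noteq> 0 \<Longrightarrow> x \<in> K"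
    by (rule test_fun_support[OF assms(1)]) (rule that)
  obtain L where L: "compact L" "L \<subseteq> \<Omega>" "\<And>x. \<psi> x \<noteq> 0 \<Longrightarrow> x \<in> L"
    by (rule test_fun_support[OF assms(2)]) (rule that)
  have "\<phi> x - \<psi> x \<noteq> 0 \<Longrightarrow> x \<in> K \<union> L" for x using K(3)[of x] L(3)[of x] by (cases "\<phi> x = 0") auto
  then show ?thesis using K L
    by (intro test_funI[where K="K \<union> L"] smooth_diff test_fun_smooth[OF assms(1)] test_fun_smooth[OF assms(2)]) auto
qed

lemma test_fun_bounded:
  assumes "test_fun \<Omega> \<phi>"
  obtains M where "0 \<le> M" "\<And>x. \<bar>\<phi> x\<bar> \<le> M"
proof -
  obtain K where K: "compact K" "K \<subseteq> \<Omega>" "\<And>x. \<phi> x \<noteq> 0 \<Longrightarrow> x \<in> K" by (rule test_fun_support[OF assms]) (rule that)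
  have "compact (\<phi> ` K)"
    using K(1) by (intro compact_continuous_image smooth_continuous_on test_fun_smooth[OF assms])
  then obtain M where M: "\<And>x. x \<in> K \<Longrightarrow> \<bar>\<phi> x\<bar> \<le> M"
    using compact_imp_bounded[of "\<phi> ` K"] by (auto simp: bounded_iff)
  have "\<bar>\<phi> x\<bar> \<le> max M 0" for x using M[of x] K(3)[of x] by (cases "\<phi> x = 0") auto
  then show ?thesis using that[of "max M 0"] by simp
qed

text \<open>The convex hull of the compact support stays in \<open>\<Omega>\<close> because
  \<open>\<Omega>\<close> is an interval; an empty support is given a one-point interval.\<close>

lemma test_fun_real_support:
  fixes \<phi> :: "real \<Rightarrow> real"
  assumes "test_fun \<Omega> \<phi>" and \<Omega>: "is_interval \<Omega>" "\<Omega> \<noteq> {}"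
  obtains a b where "a \<le> b" "{a..b} \<subseteq> \<Omega>" "\<And>x. \<phi> x \<noteq> 0 \<Longrightarrow> x \<in> {a..b}"
proof -
  obtain K where K: "compact K" "K \<subseteq> \<Omega>" "\<And>x. \<phi> x \<noteq> 0 \<Longrightarrow> x \<in> K" by (rule test_fun_support[OF assms(1)]) (rule that)
  show ?thesis
  proof (cases "K = {}")
    case True
    obtain c where "c \<in> \<Omega>" using \<Omega> by auto
    then show ?thesis using True K(3) that[of c c] by auto
  next
    case False
    obtain a where a: "a \<in> K" "\<And>x. x \<in> K \<Longrightarrow> a \<le> x" using compact_attains_inf[OF K(1) False] by auto
    obtain b where b: "b \<in> K" "\<And>x. x \<in> K \<Longrightarrow> x \<le> b" using compact_attains_sup[OF K(1) False] by auto
    have "{a..b} \<subseteq> \<Omega>" using a(1) b(1) K(2) mem_is_interval_1_I[OF \<Omega>(1)] by (meson atLeastAtMost_iff subset_iff)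
    then show ?thesis using that[of a b] a b K(3) by auto
  qed
qed

lemma test_fun_integrable: "test_fun \<Omega> \<phi> \<Longrightarrow> integrable lborel (\<phi> :: 'a::euclidean_space \<Rightarrow> real)"
proof -
  assume a: "test_fun \<Omega> \<phi>"
  obtain K where K: "compact K" "K \<subseteq> \<Omega>" "\<And>x. \<phi> x \<noteq> 0 \<Longrightarrow> x \<in> K" by (rule test_fun_support[OF a]) (rule that)
  have "integrable lborel (\<lambda>x. indicator K x *\<^sub>R \<phi> x)"
    using borel_integrable_compact[OF K(1) smooth_continuous_on[OF test_fun_smooth[OF a]]]
    by (simp add: indicator_def if_distrib cong: if_cong)
  moreover have "(\<lambda>x. indicator K x *\<^sub>R \<phi> x) = \<phi>" using K(3) by (force simp: indicator_def)
  ultimately show ?thesis by simp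
qed

lemma test_fun_measurable [measurable_dest]: "test_fun \<Omega> \<phi> \<Longrightarrow> \<phi> \<in> borel_measurable borel"
  by (simp add: smooth_measurable test_fun_smooth)

lemma test_fun_in_L2: assumes "test_fun \<Omega> \<phi>" shows "in_L2 \<phi>"
  using test_fun_integrable[OF test_fun_mult_left[OF test_fun_smooth[OF assms] assms]]
    test_fun_measurable[OF assms]
  by (simp add: in_L2_def power2_eq_square)

text \<open>A primitive is constant on either side of the support. The two constants agree because
  the integral vanishes, and subtracting their common value gives compact support.\<close>

lemma test_fun_antiderivative:
  fixes \<psi> :: "real \<Rightarrow> real"
  assumes \<psi>: "test_fun \<Omega> \<psi>" and \<Omega>: "is_interval \<Omega>" "\<Omega> \<noteq> {}" and "(LBINT x. \<psi> x) = 0"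
  obtains \<eta> where "test_fun \<Omega> \<eta>" "deriv \<eta> = \<psi>"
proof -
  obtain a b where ab: "a \<le> b" "{a..b} \<subseteq> \<Omega>" "\<And>x. \<psi> x \<noteq> 0 \<Longrightarrow> x \<in> {a..b}"
    using test_fun_real_support[OF \<psi> \<Omega>] by blast
  obtain F where F: "\<And>x. (F has_real_derivative \<psi> x) (at x)"
    using einterval_antiderivative[of "-\<infinity>" "\<infinity>" \<psi>] smooth_isCont[OF test_fun_smooth[OF \<psi>]]
    by (auto simp: has_real_derivative_iff_has_vector_derivative)
  have "(LBINT x. \<psi> x * indicator {a..b} x) = F b - F a"
    using ab(1) F smooth_isCont[OF test_fun_smooth[OF \<psi>]] by (intro integral_FTC_Icc_real) auto
  moreover have "(\<lambda>x. \<psi> x * indicator {a..b} x) = \<psi>" using ab(3) by (force simp: indicator_def)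
  ultimately have Fab: "F b = F a" using assms(4) by simp
  have cont: "continuous_on A F" for A
    using F by (auto intro: DERIV_isCont continuous_at_imp_continuous_on)
  have zero: "(F has_real_derivative 0) (at y)" if "y \<notin> {a..b}" for y
    using F[of y] ab(3)[of y] that by (cases "\<psi> y = 0") auto
  have "F x = F a" if "x \<notin> {a..b}" for x
  proof (cases "x < a")
    case True
    have "F x = F a"
      by (rule DERIV_isconst_end[symmetric, of x a F, OF True]) (auto intro!: cont zero)
    then show ?thesis .
  next
    case False
    then have "b < x" using that by simp
    have "F x = F b"
      by (rule DERIV_isconst_end[of b x F, OF \<open>b < x\<close>]) (auto intro!: cont zero)
    then show ?thesis using Fab by simp
  qed
  then have supp: "F x - F a \<noteq> 0 \<Longrightarrow> x \<in> {a..b}" for x by auto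
  have d: "((\<lambda>x. F x - F a) has_real_derivative \<psi> x) (at x)" for x
    using DERIV_diff[OF F DERIV_const] by simp
  have "test_fun \<Omega> (\<lambda>x. F x - F a)"
    by (rule test_funI[OF smooth_antiderivative[OF d test_fun_smooth[OF \<psi>]] supp compact_Icc ab(2)])
  moreover have "deriv (\<lambda>x. F x - F a) = \<psi>" using d DERIV_imp_deriv by blast
  ultimately show ?thesis by (rule that)
qed

text \<open>Smooth cut-offs that replace sharp indicator functions of intervals:
  \<open>flat 0\<close> is exp (- 1 / y) for y > 0 and tends to 1 as y grows, so they converge to 1
  inside the interval.\<close>

definition plateau :: "real \<Rightarrow> real \<Rightarrow> nat \<Rightarrow> real \<Rightarrow> real" where
  "plateau a b n x = flat 0 (real (Suc n) * (x - a)) * flat 0 (real (Suc n) * (b - x))"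

lemma flat_0_bounds: "0 \<le> flat 0 x" "flat 0 x \<le> 1"
  by (auto simp: flat_def)

lemma plateau_bounds: "0 \<le> plateau a b n x" "plateau a b n x \<le> indicator {a..b} x"
  using flat_0_bounds
  by (auto simp: plateau_def indicator_def mult_le_one) (auto simp: flat_def zero_less_mult_iff)

lemma test_fun_plateau:
  assumes "{a..b} \<subseteq> \<Omega>" shows "test_fun \<Omega> (plateau a b n)"
proof (rule test_funI[OF _ _ compact_Icc assms])
  have "smooth (\<lambda>x. flat 0 (real (Suc n) * x + (- real (Suc n) * a)))"
    and "smooth (\<lambda>x. flat 0 (- real (Suc n) * x + real (Suc n) * b))"
    by (intro smooth_affine smooth_flat bounded_linear_mult_right)+
  from smooth_mult[OF this]
  show "smooth (plateau a b n)" by (simp add: plateau_def[abs_def] algebra_simps)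
  fix x assume "plateau a b n x \<noteq> 0"
  then show "x \<in> {a..b}" using plateau_bounds[where a=a and b=b and n=n and x=x] by (cases "x \<in> {a..b}") auto
qed

lemma flat_0_scale_tendsto: assumes "0 < x" shows "(\<lambda>n. flat 0 (real (Suc n) * x)) \<longlonglongrightarrow> 1"
proof -
  have "(\<lambda>n. (1 / x) * inverse (real (Suc n))) \<longlonglongrightarrow> (1 / x) * 0"
    by (intro tendsto_mult tendsto_const LIMSEQ_inverse_real_of_nat)
  then have "(\<lambda>n. exp (- ((1 / x) * inverse (real (Suc n))))) \<longlonglongrightarrow> exp (- ((1 / x) * 0))"
    by (intro tendsto_exp tendsto_minus)
  moreover have "flat 0 (real (Suc n) * x) = exp (- ((1 / x) * inverse (real (Suc n))))" for n
  proof -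
    have "0 < real (Suc n) * x" using assms by (intro mult_pos_pos) auto
    then show ?thesis by (simp add: flat_def divide_inverse mult.commute)
  qed
  ultimately show ?thesis by simp
qed

lemma plateau_tendsto: "(\<lambda>n. plateau a b n x) \<longlonglongrightarrow> indicator {a<..<b} x"
proof (cases "x \<in> {a<..<b}")
  case True
  then have "(\<lambda>n. plateau a b n x) \<longlonglongrightarrow> 1 * 1"
    unfolding plateau_def by (intro tendsto_mult flat_0_scale_tendsto) auto
  then show ?thesis using True by simp
next
  case False
  then have "plateau a b n x = 0" for n by (auto simp: plateau_def flat_def zero_less_mult_iff)
  then show ?thesis using False by simp
qed

section \<open>Test functions on the half plane\<close>

lemma test_fun_section_x:
  fixes \<phi> :: "real \<times> real \<Rightarrow> real"
  assumes "test_fun \<Omega> \<phi>"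
  shows "test_fun UNIV (\<lambda>x. \<phi> (t, x))" "deriv (\<lambda>x. \<phi> (t, x)) = (\<lambda>x. dir_deriv (0, 1) \<phi> (t, x))"
proof -
  obtain K where K: "compact K" "K \<subseteq> \<Omega>" "\<And>x. \<phi> x \<noteq> 0 \<Longrightarrow> x \<in> K" by (rule test_fun_support[OF assms]) (rule that)
  have L: "bounded_linear (\<lambda>x::real. (0::real, x))"
    by (intro bounded_linear_Pair bounded_linear_zero bounded_linear_ident)
  have s: "smooth (\<lambda>x. \<phi> (t, x))"
    using smooth_affine[OF test_fun_smooth[OF assms] L, of "(t, 0)"] by simp
  show "test_fun UNIV (\<lambda>x. \<phi> (t, x))"
    by (rule test_funI[where K="snd ` K"])
       (use K s in \<open>auto intro!: compact_continuous_image continuous_intros image_eqI[where f=snd and x="(t, x)" for x]\<close>)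
  show "deriv (\<lambda>x. \<phi> (t, x)) = (\<lambda>x. dir_deriv (0, 1) \<phi> (t, x))"
    using dir_deriv_affine[OF test_fun_smooth[OF assms] L, of 1 "(t, 0)"] s
    by (simp add: deriv_eq_dir_deriv)
qed

lemma test_fun_half_plane_section_t:
  assumes "test_fun half_plane \<phi>"
  shows "test_fun {0<..} (\<lambda>t. \<phi> (t, x))" "deriv (\<lambda>t. \<phi> (t, x)) = (\<lambda>t. dir_deriv (1, 0) \<phi> (t, x))"
proof -
  obtain K where K: "compact K" "K \<subseteq> half_plane" "\<And>x. \<phi> x \<noteq> 0 \<Longrightarrow> x \<in> K" by (rule test_fun_support[OF assms]) (rule that)
  have L: "bounded_linear (\<lambda>x::real. (x, 0::real))"
    by (intro bounded_linear_Pair bounded_linear_zero bounded_linear_ident)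
  have s: "smooth (\<lambda>t. \<phi> (t, x))"
    using smooth_affine[OF test_fun_smooth[OF assms] L, of "(0, x)"] by simp
  show "test_fun {0<..} (\<lambda>t. \<phi> (t, x))"
    by (rule test_funI[where K="fst ` K"])
       (use K s in \<open>auto intro!: compact_continuous_image continuous_intros image_eqI[where f=fst and x="(t, x)" for t] simp: half_plane_def\<close>)
  show "deriv (\<lambda>t. \<phi> (t, x)) = (\<lambda>t. dir_deriv (1, 0) \<phi> (t, x))"
    using dir_deriv_affine[OF test_fun_smooth[OF assms] L, of 1 "(0, x)"] s
    by (simp add: deriv_eq_dir_deriv)
qed

lemma test_fun_half_plane_support:
  assumes "test_fun half_plane \<phi>"
  obtains T R where "0 < T" "0 < R" "\<And>t x. \<phi> (t, x) \<noteq> 0 \<Longrightarrow> t \<in> {0<..T} \<and> x \<in> {-R..R}"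
proof -
  obtain K where K: "compact K" "K \<subseteq> half_plane" "\<And>x. \<phi> x \<noteq> 0 \<Longrightarrow> x \<in> K" by (rule test_fun_support[OF assms]) (rule that)
  obtain B where B: "0 < B" "\<And>p. p \<in> K \<Longrightarrow> norm p \<le> B" using compact_imp_bounded[OF K(1)] bounded_pos by metis
  have "t \<in> {0<..B} \<and> x \<in> {-B..B}" if "\<phi> (t, x) \<noteq> 0" for t x
  proof -
    have "(t, x) \<in> K" using K(3) that by simp
    then have "norm t \<le> B" "norm x \<le> B" "0 < t"
      using B(2)[of "(t, x)"] norm_fst_le[of t x] norm_snd_le[of x t] K(2) by (auto simp: half_plane_def)
    then show ?thesis by auto
  qed
  then show ?thesis using that[of B B] B by blast
qed

text \<open>Tensor products with a fixed \<open>\<psi>\<close> reduce a distributional equation on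
  the half plane to a weak equation in time for the pairing with \<open>\<psi>\<close>.\<close>

lemma test_fun_tensor:
  assumes \<theta>: "test_fun {0<..} \<theta>" and \<psi>: "test_fun UNIV \<psi>"
  shows "test_fun half_plane (\<lambda>p. \<theta> (fst p) * \<psi> (snd p))" (is ?T)
    and "dir_deriv (1, 0) (\<lambda>p. \<theta> (fst p) * \<psi> (snd p)) = (\<lambda>p. deriv \<theta> (fst p) * \<psi> (snd p))"
    and "dir_deriv (0, 1) (\<lambda>p. \<theta> (fst p) * \<psi> (snd p)) = (\<lambda>p. \<theta> (fst p) * deriv \<psi> (snd p))"
proof -
  note s = test_fun_smooth[OF \<theta>] test_fun_smooth[OF \<psi>]
  have s1: "smooth (\<lambda>p::real\<times>real. \<theta> (fst p))" and s2: "smooth (\<lambda>p::real\<times>real. \<psi> (snd p))"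
    using smooth_affine[OF s(1) bounded_linear_fst, of 0] smooth_affine[OF s(2) bounded_linear_snd, of 0]
    by auto
  obtain K where K: "compact K" "K \<subseteq> {0<..}" "\<And>x. \<theta> x \<noteq> 0 \<Longrightarrow> x \<in> K" by (rule test_fun_support[OF \<theta>]) (rule that)
  obtain L where L: "compact L" "L \<subseteq> UNIV" "\<And>x. \<psi> x \<noteq> 0 \<Longrightarrow> x \<in> L" by (rule test_fun_support[OF \<psi>]) (rule that)
  show ?T
    by (rule test_funI[where K="K \<times> L"])
       (use K L in \<open>auto intro!: smooth_mult s1 s2 compact_Times simp: half_plane_def\<close>)
  have d1: "dir_deriv v (\<lambda>p::real\<times>real. \<theta> (fst p)) = (\<lambda>p. dir_deriv (fst v) \<theta> (fst p))" for v
    using dir_deriv_affine[OF s(1) bounded_linear_fst, of v 0] by simp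
  have d2: "dir_deriv v (\<lambda>p::real\<times>real. \<psi> (snd p)) = (\<lambda>p. dir_deriv (snd v) \<psi> (snd p))" for v
    using dir_deriv_affine[OF s(2) bounded_linear_snd, of v 0] by simp
  \<comment> \<open>Each factor is constant in the other variable, and a derivative in direction 0
    vanishes by linearity.\<close>
  have 0: "dir_deriv 0 \<theta> = (\<lambda>x. 0)" "dir_deriv 0 \<psi> = (\<lambda>x. 0)"
    using has_derivative_bounded_linear[OF smooth_has_derivative] s
    by (auto simp: fun_eq_iff intro!: linear_0[OF bounded_linear.linear])
  show "dir_deriv (1, 0) (\<lambda>p. \<theta> (fst p) * \<psi> (snd p)) = (\<lambda>p. deriv \<theta> (fst p) * \<psi> (snd p))"
    and "dir_deriv (0, 1) (\<lambda>p. \<theta> (fst p) * \<psi> (snd p)) = (\<lambda>p. \<theta> (fst p) * deriv \<psi> (snd p))"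
    using s by (simp_all add: dir_deriv_mult[OF s1 s2] d1 d2 0 deriv_eq_dir_deriv)
qed

text \<open>The factor t of \<zeta>_1 is moved onto the test function; the extra term in its time
  derivative is what produces the source of the wave equation.\<close>

lemma test_fun_time_mult:
  assumes "test_fun half_plane \<phi>"
  shows "test_fun half_plane (\<lambda>p. fst p * \<phi> p)"
    and "dir_deriv (1, 0) (\<lambda>p. fst p * \<phi> p) = (\<lambda>p. \<phi> p + fst p * dir_deriv (1, 0) \<phi> p)"
    and "dir_deriv (0, 1) (\<lambda>p. fst p * \<phi> p) = (\<lambda>p. fst p * dir_deriv (0, 1) \<phi> p)"
proof -
  have s: "smooth (fst :: real \<times> real \<Rightarrow> real)" by (intro smooth_bounded_linear bounded_linear_fst)
  show "test_fun half_plane (\<lambda>p. fst p * \<phi> p)" using test_fun_mult_left[OF s assms] .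
  show "dir_deriv (1, 0) (\<lambda>p. fst p * \<phi> p) = (\<lambda>p. \<phi> p + fst p * dir_deriv (1, 0) \<phi> p)"
    and "dir_deriv (0, 1) (\<lambda>p. fst p * \<phi> p) = (\<lambda>p. fst p * dir_deriv (0, 1) \<phi> p)"
    by (simp_all add: dir_deriv_mult[OF s test_fun_smooth[OF assms]] dir_deriv_bounded_linear[OF bounded_linear_fst] add.commute)
qed

section \<open>Primitives and integration by parts\<close>

text \<open>Local absolute continuity of \<open>U\<close> with density \<open>v\<close>, stated
  through integrals so that no pointwise derivative of \<open>U\<close> enters.\<close>

definition primitive_on :: "real set \<Rightarrow> (real \<Rightarrow> real) \<Rightarrow> (real \<Rightarrow> real) \<Rightarrow> bool" where
  "primitive_on \<Omega> U v \<longleftrightarrow> (\<forall>a b. a \<le> b \<longrightarrow> {a..b} \<subseteq> \<Omega> \<longrightarrow>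
     set_integrable lborel {a..b} v \<and> U b - U a = (LBINT x:{a..b}. v x))"

lemma primitive_on_subset: "primitive_on \<Omega> U v \<Longrightarrow> \<Omega>' \<subseteq> \<Omega> \<Longrightarrow> primitive_on \<Omega>' U v"
  unfolding primitive_on_def by blast

lemma primitive_on_integrable: "primitive_on \<Omega> U v \<Longrightarrow> {a..b} \<subseteq> \<Omega> \<Longrightarrow> set_integrable lborel {a..b} v"
  unfolding primitive_on_def by (cases "a \<le> b") auto

lemma primitive_on_diff: "primitive_on \<Omega> U v \<Longrightarrow> a \<le> b \<Longrightarrow> {a..b} \<subseteq> \<Omega> \<Longrightarrow> U b - U a = (LBINT x:{a..b}. v x)"
  unfolding primitive_on_def by auto

lemma primitive_on_continuous:
  assumes "primitive_on {a..b} U v" shows "continuous_on {a..b} U"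
proof (cases "a \<le> b")
  case True
  have i: "set_integrable lborel {a..x} v" if "x \<in> {a..b}" for x
    using primitive_on_integrable[OF assms, of a x] that by auto
  have "v integrable_on {a..b}" using i[of b] True by (intro set_borel_integral_eq_integral) auto
  then have "continuous_on {a..b} (\<lambda>x. U a + integral {a..x} v)"
    by (intro continuous_intros indefinite_integral_continuous_1)
  moreover have "U x = U a + integral {a..x} v" if "x \<in> {a..b}" for x
    using primitive_on_diff[OF assms, of a x] that set_borel_integral_eq_integral(2)[OF i[OF that]] by auto
  ultimately show ?thesis by (metis (no_types, lifting) continuous_on_cong)
qed simp

lemma primitive_on_deriv:
  assumes "smooth \<phi>" shows "primitive_on \<Omega> \<phi> (deriv \<phi>)"
  unfolding primitive_on_def
proof (intro allI impI conjI)
  fix a b :: real assume ab: "a \<le> b"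
  have c: "isCont (deriv \<phi>) x" for x using assms by (intro smooth_isCont smooth_deriv)
  show "set_integrable lborel {a..b} (deriv \<phi>)"
    using c by (intro borel_integrable_atLeastAtMost') (auto intro: continuous_at_imp_continuous_on)
  have "(LBINT x. deriv \<phi> x * indicator {a..b} x) = \<phi> b - \<phi> a"
    using ab c smooth_DERIV[OF assms] by (intro integral_FTC_Icc_real) auto
  then show "\<phi> b - \<phi> a = (LBINT x:{a..b}. deriv \<phi> x)"
    by (simp add: set_lebesgue_integral_def mult.commute)
qed

lemma set_integrable_mult_continuous:
  fixes v Q :: "real \<Rightarrow> real"
  assumes v: "set_integrable lborel {a..b} v" and Q: "continuous_on {a..b} Q"
  shows "set_integrable lborel {a..b} (\<lambda>x. v x * Q x)"
proof -
  have "compact (Q ` {a..b})" using Q by (intro compact_continuous_image) auto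
  then obtain M where "\<forall>y\<in>Q ` {a..b}. norm y \<le> M"
    using compact_imp_bounded bounded_iff by blast
  then have M: "\<bar>Q x\<bar> \<le> M" if "x \<in> {a..b}" for x
    using that by simp
  have m: "(\<lambda>x. indicator {a..b} x *\<^sub>R Q x) \<in> borel_measurable borel"
    using Q by (intro borel_measurable_continuous_on_indicator) auto
  have m': "(\<lambda>x. indicator {a..b} x *\<^sub>R v x) \<in> borel_measurable borel"
    using v unfolding set_integrable_def by (auto dest: borel_measurable_integrable)
  have "integrable lborel (\<lambda>x. (indicator {a..b} x *\<^sub>R v x) * (indicator {a..b} x *\<^sub>R Q x))"
  proof (rule Bochner_Integration.integrable_bound)
    show "integrable lborel (\<lambda>x. M * (indicator {a..b} x *\<^sub>R v x))"
      using v unfolding set_integrable_def by simp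
    show "(\<lambda>x. (indicator {a..b} x *\<^sub>R v x) * (indicator {a..b} x *\<^sub>R Q x)) \<in> borel_measurable lborel"
      using m m' by simp
    show "AE x in lborel. norm ((indicator {a..b} x *\<^sub>R v x) * (indicator {a..b} x *\<^sub>R Q x)) \<le> norm (M * (indicator {a..b} x *\<^sub>R v x))"
    proof (rule AE_I2)
      fix x
      show "norm ((indicator {a..b} x *\<^sub>R v x) * (indicator {a..b} x *\<^sub>R Q x)) \<le> norm (M * (indicator {a..b} x *\<^sub>R v x))"
        using M[of x] by (cases "x \<in> {a..b}") (auto simp: abs_mult mult.commute[of "\<bar>v x\<bar>"] intro!: mult_right_mono)
    qed
  qed
  moreover have "(indicator {a..b} x *\<^sub>R v x) * (indicator {a..b} x *\<^sub>R Q x) = indicator {a..b} x *\<^sub>R (v x * Q x)" for x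
    by (simp add: indicator_def)
  ultimately show ?thesis unfolding set_integrable_def by (simp only:)
qed

text \<open>Fubini on \<open>[a, b]\<^sup>2\<close>: up to boundary terms, the two integrals on the left are those of
  \<open>p(x) q(y)\<close> over the triangles \<open>y \<le> x\<close> and \<open>x < y\<close>.\<close>

lemma primitive_on_by_parts:
  assumes ab: "a \<le> b" and P: "primitive_on {a..b} P p" and Q: "primitive_on {a..b} Q q"
  shows "(LBINT x:{a..b}. p x * Q x) + (LBINT x:{a..b}. P x * q x) = P b * Q b - P a * Q a"
proof -
  define p1 where "p1 = (\<lambda>x. indicator {a..b} x * p x)"
  define q1 where "q1 = (\<lambda>x. indicator {a..b} x * q x)"
  have p1: "integrable lborel p1" and q1: "integrable lborel q1"
    using primitive_on_integrable[OF P, of a b] primitive_on_integrable[OF Q, of a b]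
    by (simp_all add: p1_def q1_def set_integrable_def)
  note [measurable] = borel_measurable_integrable[OF p1] borel_measurable_integrable[OF q1]
  have ip: "set_integrable lborel {a..b} p" "set_integrable lborel {a..b} q"
    using primitive_on_integrable[OF P] primitive_on_integrable[OF Q] by auto
  have ipQ: "set_integrable lborel {a..b} (\<lambda>x. p x * Q x)" "set_integrable lborel {a..b} (\<lambda>x. q x * P x)"
    using ip primitive_on_continuous[OF P] primitive_on_continuous[OF Q] by (auto intro: set_integrable_mult_continuous)
  define F where "F = (\<lambda>z. p1 (fst z) * q1 (snd z))"
  have F: "integrable (lborel \<Otimes>\<^sub>M lborel) F"
  proof (rule lborel_pair.Fubini_integrable)
    show "F \<in> borel_measurable (lborel \<Otimes>\<^sub>M lborel)" unfolding F_def by measurable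
    show "integrable lborel (\<lambda>x. LBINT y. norm (F (x, y)))"
      using p1 q1 by (simp add: F_def abs_mult)
    show "AE x in lborel. integrable lborel (\<lambda>y. F (x, y))"
      using q1 by (simp add: F_def)
  qed
  define T where "T = {z::real\<times>real. snd z \<le> fst z}"
  have T: "T \<in> sets (lborel \<Otimes>\<^sub>M lborel)" "- T \<in> sets (lborel \<Otimes>\<^sub>M lborel)"
    unfolding T_def lborel_prod sets_lborel
    by (intro borel_closed borel_comp closed_Collect_le continuous_intros)+
  have F1: "integrable (lborel \<Otimes>\<^sub>M lborel) (\<lambda>(x, y). indicator T (x, y) * F (x, y))"
    and F2: "integrable (lborel \<Otimes>\<^sub>M lborel) (\<lambda>(x, y). indicator (- T) (x, y) * F (x, y))"
    using integrable_mult_indicator[OF T(1) F] integrable_mult_indicator[OF T(2) F] by (simp_all add: case_prod_beta')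
  have "F p = indicator T p * F p + indicator (- T) p * F p" for p
    by (simp add: indicator_def)
  then have "integral\<^sup>L (lborel \<Otimes>\<^sub>M lborel) F =
    integral\<^sup>L (lborel \<Otimes>\<^sub>M lborel) (\<lambda>p. indicator T p * F p) + integral\<^sup>L (lborel \<Otimes>\<^sub>M lborel) (\<lambda>p. indicator (- T) p * F p)"
    using Bochner_Integration.integral_add[OF F1 F2] by (simp add: case_prod_beta')
  then have "(LBINT x. LBINT y. F (x, y)) = (LBINT x. LBINT y. indicator T (x, y) * F (x, y)) + (LBINT y. LBINT x. indicator (- T) (x, y) * F (x, y))"
    using lborel_pair.integral_fst'[OF F] lborel_pair.integral_fst[OF F1] lborel_pair.integral_snd[OF F2] by (simp add: case_prod_beta')
  also have "(LBINT x. LBINT y. indicator T (x, y) * F (x, y)) = (LBINT x:{a..b}. p x * (Q x - Q a))"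
    unfolding set_lebesgue_integral_def
  proof (intro Bochner_Integration.integral_cong refl)
    fix x
    have "(LBINT y. indicator T (x, y) * F (x, y)) = (LBINT y. p1 x * (indicator {a..x} y *\<^sub>R q y))"
      by (intro Bochner_Integration.integral_cong refl)
         (auto simp: T_def F_def q1_def p1_def indicator_def)
    also have "\<dots> = p1 x * (LBINT y:{a..x}. q y)"
      unfolding set_lebesgue_integral_def by simp
    also have "\<dots> = indicator {a..b} x *\<^sub>R (p x * (Q x - Q a))"
      using primitive_on_diff[OF Q, of a x] by (cases "x \<in> {a..b}") (auto simp: p1_def)
    finally show "(LBINT y. indicator T (x, y) * F (x, y)) = indicator {a..b} x *\<^sub>R (p x * (Q x - Q a))" .
  qed
  also have "(LBINT y. LBINT x. indicator (- T) (x, y) * F (x, y)) = (LBINT y:{a..b}. q y * (P y - P a))"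
    unfolding set_lebesgue_integral_def
  proof (intro Bochner_Integration.integral_cong refl)
    fix y
    have "(LBINT x. indicator (- T) (x, y) * F (x, y)) = (LBINT x. q1 y * (indicator {a..<y} x *\<^sub>R p x))"
      by (intro Bochner_Integration.integral_cong refl)
         (auto simp: T_def F_def q1_def p1_def indicator_def)
    also have "\<dots> = q1 y * (LBINT x:{a..<y}. p x)"
      unfolding set_lebesgue_integral_def by simp
    also have "\<dots> = indicator {a..b} y *\<^sub>R (q y * (P y - P a))"
    proof (cases "y \<in> {a..b}")
      case True
      have ip: "set_integrable lborel {a..y} p" using True by (intro primitive_on_integrable[OF P]) auto
      have ip2: "set_integrable lborel {a..<y} p" by (rule set_integrable_subset[OF ip]) auto
      \<comment> \<open>The second triangle leaves out the diagonal; in each section this is one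
        point.\<close>
      have "(LBINT x:{a..<y}. p x) = (LBINT x:{a..y}. p x)"
      proof (rule set_integral_cong_set)
        show "set_borel_measurable lborel {a..<y} p" "set_borel_measurable lborel {a..y} p"
          using ip2 ip unfolding set_integrable_def set_borel_measurable_def
          by (auto dest!: borel_measurable_integrable)
        show "AE x in lborel. (x \<in> {a..y}) = (x \<in> {a..<y})"
          using AE_lborel_singleton[of y] by eventually_elim auto
      qed
      then show ?thesis using primitive_on_diff[OF P, of a y] True by (auto simp: q1_def)
    qed (simp add: q1_def)
    finally show "(LBINT x. indicator (- T) (x, y) * F (x, y)) = indicator {a..b} y *\<^sub>R (q y * (P y - P a))" .
  qed
  also have "(LBINT x:{a..b}. p x * (Q x - Q a)) = (LBINT x:{a..b}. p x * Q x) - (P b - P a) * Q a"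
    using ip ipQ primitive_on_diff[OF P ab] by (simp add: right_diff_distrib)
  also have "(LBINT x:{a..b}. q x * (P x - P a)) = (LBINT x:{a..b}. q x * P x) - (Q b - Q a) * P a"
    using ip ipQ primitive_on_diff[OF Q ab] by (simp add: right_diff_distrib)
  also have "(LBINT x. LBINT y. F (x, y)) = (P b - P a) * (Q b - Q a)"
    using primitive_on_diff[OF P ab] primitive_on_diff[OF Q ab]
    by (simp add: F_def p1_def q1_def set_lebesgue_integral_def)
  finally show ?thesis by (simp add: algebra_simps)
qed

lemma integral_eq_set_integral_support:
  fixes \<phi> w :: "real \<Rightarrow> real"
  assumes "\<And>x. \<phi> x \<noteq> 0 \<Longrightarrow> x \<in> {a..b}"
  shows "(LBINT x. w x * \<phi> x) = (LBINT x:{a..b}. w x * \<phi> x)"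
proof -
  have "w x * \<phi> x = indicator {a..b} x *\<^sub>R (w x * \<phi> x)" for x
    using assms[of x] by (cases "\<phi> x = 0") auto
  then show ?thesis unfolding set_lebesgue_integral_def by (intro Bochner_Integration.integral_cong refl)
qed

lemma primitive_on_test_fun:
  assumes U: "primitive_on \<Omega> U v" and \<Omega>: "is_interval \<Omega>" "\<Omega> \<noteq> {}" and \<phi>: "test_fun \<Omega> \<phi>"
  shows "(LBINT x. U x * deriv \<phi> x) = - (LBINT x. v x * \<phi> x)"
proof -
  obtain a b where ab: "a \<le> b" "{a..b} \<subseteq> \<Omega>" and "\<And>x. \<phi> x * \<phi> x + deriv \<phi> x * deriv \<phi> x \<noteq> 0 \<Longrightarrow> x \<in> {a..b}"
  proof (rule test_fun_real_support[OF _ \<Omega>])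
    \<comment> \<open>A sum of squares vanishes only where both terms do, so one interval serves
      \<open>\<phi>\<close> and its derivative.\<close>
    have "test_fun \<Omega> (\<lambda>x. \<phi> x * \<phi> x - (- 1 * deriv \<phi> x) * deriv \<phi> x)"
      by (intro test_fun_diff test_fun_mult_left smooth_cmult test_fun_smooth[OF \<phi>] smooth_deriv \<phi> test_fun_deriv)
    then show "test_fun \<Omega> (\<lambda>x. \<phi> x * \<phi> x + deriv \<phi> x * deriv \<phi> x)" by simp
  qed (rule that)
  then have supp: "\<phi> x \<noteq> 0 \<Longrightarrow> x \<in> {a..b}" "deriv \<phi> x \<noteq> 0 \<Longrightarrow> x \<in> {a..b}" for x
    by (metis add_nonneg_eq_0_iff mult_eq_0_iff zero_le_square)+
  have d: "(\<phi> has_real_derivative deriv \<phi> x) (at x)" for x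
    by (rule smooth_DERIV[OF test_fun_smooth[OF \<phi>]])
  have dd: "continuous_on {a..b} (deriv \<phi>)" "continuous_on {a..b} \<phi>"
    using \<phi> by (auto intro: smooth_continuous_on smooth_deriv test_fun_smooth)
  have Ui: "primitive_on {a..b} U v" by (rule primitive_on_subset[OF U ab(2)])
  \<comment> \<open>The end points are limits of points outside the interval, so
    \<open>\<phi>\<close> vanishes there by continuity and no boundary terms remain.\<close>
  have "\<phi> x = 0" if "x \<in> closure (- {a..b})" for x
    using supp(1) by (intro continuous_constant_on_closure[OF smooth_continuous_on[OF test_fun_smooth[OF \<phi>]] _ that]) blast
  then have z: "\<phi> b * U b = \<phi> a * U a" by (simp add: closure_complement interior_atLeastAtMost_real)
  have "(LBINT x:{a..b}. deriv \<phi> x * U x) + (LBINT x:{a..b}. \<phi> x * v x) = 0"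
    using primitive_on_by_parts[OF ab(1) primitive_on_deriv[OF test_fun_smooth[OF \<phi>]] Ui] z by simp
  then show ?thesis
    using integral_eq_set_integral_support[of "deriv \<phi>" a b U] integral_eq_set_integral_support[of \<phi> a b v] supp
    by (simp add: mult.commute)
qed

section \<open>The lemma of du Bois-Reymond\<close>

text \<open>Dominated convergence; the limit of the cut-offs misses only the two end points.\<close>

lemma plateau_integral_tendsto:
  assumes g: "set_integrable lborel {a..b} g"
  shows "(\<lambda>n. LBINT x. g x * plateau a b n x) \<longlonglongrightarrow> (LBINT x:{a..b}. g x)"
proof -
  define g1 where "g1 = (\<lambda>x. indicator {a..b} x * g x)"
  have g1: "integrable lborel g1" using g by (simp add: g1_def set_integrable_def)
  note [measurable] = borel_measurable_integrable[OF g1]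
  have m[measurable]: "plateau a b n \<in> borel_measurable borel" for n
    using test_fun_measurable[OF test_fun_plateau[of a b UNIV n]] by simp
  have eq: "g x * plateau a b n x = g1 x * plateau a b n x" for n x
    using plateau_bounds[of a b n x] by (cases "x \<in> {a..b}") (auto simp: g1_def)
  have le: "plateau a b n x \<le> 1" for n x
    using plateau_bounds(2)[of a b n x] by (rule order_trans) (simp add: indicator_def)
  have "(\<lambda>n. LBINT x. g1 x * plateau a b n x) \<longlonglongrightarrow> (LBINT x. g1 x)"
  proof (rule integral_dominated_convergence[where w="\<lambda>x. \<bar>g1 x\<bar>"])
    show "AE x in lborel. (\<lambda>n. g1 x * plateau a b n x) \<longlonglongrightarrow> g1 x"
      using AE_lborel_singleton[of a] AE_lborel_singleton[of b]
    proof eventually_elim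
      fix x assume "x \<noteq> a" "x \<noteq> b"
      then have "g1 x * indicator {a<..<b} x = g1 x" by (auto simp: g1_def indicator_def)
      then show "(\<lambda>n. g1 x * plateau a b n x) \<longlonglongrightarrow> g1 x"
        using tendsto_mult[OF tendsto_const[of "g1 x"] plateau_tendsto[of a b x]] by (simp only:)
    qed
    show "AE x in lborel. norm (g1 x * plateau a b n x) \<le> \<bar>g1 x\<bar>" for n
      using plateau_bounds(1)[of a b n] le[of n]
      by (auto simp: abs_mult intro!: mult_left_le)
  qed (use g1 in auto)
  then show ?thesis by (simp add: eq g1_def set_lebesgue_integral_def)
qed

text \<open>The difference u - U annihilates derivatives of test functions, that is, test functions
  with integral 0. Any test function becomes one after subtraction of a multiple of a fixed one with
  integral 1, so u - U - c annihilates all of them. The conclusion stays at the level of integrals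
  over intervals: it is later read off almost everywhere for functions of X, and everywhere for
  continuous functions of time.\<close>

lemma du_Bois_Reymond:
  assumes \<Omega>: "open \<Omega>" "is_interval \<Omega>" "\<Omega> \<noteq> {}"
    and U: "primitive_on \<Omega> U v"
    and u: "\<And>a b. {a..b} \<subseteq> \<Omega> \<Longrightarrow> set_integrable lborel {a..b} u"
    and weak: "\<And>\<phi>. test_fun \<Omega> \<phi> \<Longrightarrow> (LBINT x. u x * deriv \<phi> x) = - (LBINT x. v x * \<phi> x)"
  obtains c where "\<And>a b. {a..b} \<subseteq> \<Omega> \<Longrightarrow> set_integrable lborel {a..b} (\<lambda>x. u x - U x - c)"
    and "\<And>a b. {a..b} \<subseteq> \<Omega> \<Longrightarrow> (LBINT x:{a..b}. u x - U x - c) = 0"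
proof -
  define g where "g = (\<lambda>x. u x - U x)"
  have ci: "set_integrable lborel {a..b} (\<lambda>x. c)" for a b c :: real
    by (intro borel_integrable_atLeastAtMost') auto
  have Ui: "set_integrable lborel {a..b} U" if "{a..b} \<subseteq> \<Omega>" for a b
    using primitive_on_continuous[OF primitive_on_subset[OF U that]] by (rule borel_integrable_atLeastAtMost')
  have gi: "set_integrable lborel {a..b} g" if "{a..b} \<subseteq> \<Omega>" for a b
    unfolding g_def using u[OF that] Ui[OF that] by (rule set_integral_diff)
  have ti: "integrable lborel (\<lambda>x. w x * \<phi> x)" if \<phi>: "test_fun \<Omega> \<phi>"
    and w: "\<And>a b. {a..b} \<subseteq> \<Omega> \<Longrightarrow> set_integrable lborel {a..b} w" for \<phi> w
  proof -
    obtain a b where ab: "a \<le> b" "{a..b} \<subseteq> \<Omega>" "\<And>x. \<phi> x \<noteq> 0 \<Longrightarrow> x \<in> {a..b}"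
      by (rule test_fun_real_support[OF \<phi> \<Omega>(2,3)]) (rule that)
    have "set_integrable lborel {a..b} (\<lambda>x. w x * \<phi> x)"
      using w[OF ab(2)] by (rule set_integrable_mult_continuous) (intro smooth_continuous_on test_fun_smooth[OF \<phi>])
    moreover have "w x * \<phi> x = indicator {a..b} x * (w x * \<phi> x)" for x
      using ab(3)[of x] by (cases "\<phi> x = 0") auto
    ultimately show ?thesis unfolding set_integrable_def by auto
  qed
  have g0: "(LBINT x. g x * deriv \<phi> x) = 0" if \<phi>: "test_fun \<Omega> \<phi>" for \<phi>
    using weak[OF \<phi>] primitive_on_test_fun[OF U \<Omega>(2,3) \<phi>] ti[OF test_fun_deriv[OF \<phi>] u] ti[OF test_fun_deriv[OF \<phi>] Ui]
    by (simp add: g_def left_diff_distrib)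
  obtain a0 b0 where ab0: "a0 < b0" "{a0..b0} \<subseteq> \<Omega>"
  proof -
    obtain x where "x \<in> \<Omega>" using \<Omega>(3) by auto
    then obtain e where e: "0 < e" "cball x e \<subseteq> \<Omega>" using \<Omega>(1) open_contains_cball by blast
    then have "{x - e..x + e} \<subseteq> \<Omega>" by (simp add: cball_eq_atLeastAtMost)
    then show ?thesis using e by (intro that[of "x - e" "x + e"]) auto
  qed
  \<comment> \<open>The integrals converge to \<open>b0 - a0\<close>, which is positive, so some
    cut-off can be normalised.\<close>
  have "\<exists>n. (LBINT x. plateau a0 b0 n x) \<noteq> 0"
  proof (rule ccontr)
    assume "\<not> ?thesis"
    then have "(\<lambda>n. LBINT x. 1 * plateau a0 b0 n x) \<longlonglongrightarrow> 0" by simp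
    moreover have "(\<lambda>n. LBINT x. 1 * plateau a0 b0 n x) \<longlonglongrightarrow> (LBINT x:{a0..b0}. 1)"
      using ci by (rule plateau_integral_tendsto)
    ultimately have "(LBINT x:{a0..b0}. 1) = (0::real)" using LIMSEQ_unique by blast
    then show False using ab0 by (simp add: set_lebesgue_integral_def)
  qed
  then obtain n0 where n0: "(LBINT x. plateau a0 b0 n0 x) \<noteq> 0" by auto
  define \<psi> where "\<psi> = (\<lambda>x. inverse (LBINT x. plateau a0 b0 n0 x) * plateau a0 b0 n0 x)"
  have \<psi>: "test_fun \<Omega> \<psi>" unfolding \<psi>_def by (intro test_fun_cmult test_fun_plateau ab0)
  have \<psi>1: "(LBINT x. \<psi> x) = 1" using n0 by (simp add: \<psi>_def)
  \<comment> \<open>Testing with \<open>\<psi>\<close> itself forces this value of the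
    constant.\<close>
  define c where "c = (LBINT x. g x * \<psi> x)"
  have gc: "(LBINT x. (g x - c) * \<phi> x) = 0" if \<phi>: "test_fun \<Omega> \<phi>" for \<phi>
  proof -
    define I where "I = (LBINT x. \<phi> x)"
    have t: "test_fun \<Omega> (\<lambda>x. \<phi> x - I * \<psi> x)" by (intro test_fun_diff test_fun_cmult \<phi> \<psi>)
    have "(LBINT x. \<phi> x - I * \<psi> x) = 0"
      using test_fun_integrable[OF \<phi>] test_fun_integrable[OF \<psi>] \<psi>1 by (simp add: I_def)
    then obtain \<eta> where "test_fun \<Omega> \<eta>" "deriv \<eta> = (\<lambda>x. \<phi> x - I * \<psi> x)"
      by (rule test_fun_antiderivative[OF t \<Omega>(2,3)])
    then have "(LBINT x. g x * (\<phi> x - I * \<psi> x)) = 0" using g0[of \<eta>] by simp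
    moreover have "(LBINT x. g x * (\<phi> x - I * \<psi> x)) = (LBINT x. g x * \<phi> x - I * (g x * \<psi> x))"
      by (simp add: algebra_simps)
    ultimately have "(LBINT x. g x * \<phi> x) = I * c"
      using ti[OF \<phi> gi] ti[OF \<psi> gi] by (simp add: c_def)
    then show ?thesis using ti[OF \<phi> gi] test_fun_integrable[OF \<phi>] by (simp add: left_diff_distrib I_def)
  qed
  have i: "set_integrable lborel {a..b} (\<lambda>x. u x - U x - c)" if "{a..b} \<subseteq> \<Omega>" for a b
    using set_integral_diff(1)[OF gi[OF that] ci] by (simp add: g_def)
  have "(LBINT x:{a..b}. u x - U x - c) = 0" if "{a..b} \<subseteq> \<Omega>" for a b
  proof -
    have "(\<lambda>n. LBINT x. (u x - U x - c) * plateau a b n x) \<longlonglongrightarrow> (LBINT x:{a..b}. u x - U x - c)"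
      by (rule plateau_integral_tendsto[OF i[OF that]])
    moreover have "(LBINT x. (u x - U x - c) * plateau a b n x) = 0" for n
      using gc[OF test_fun_plateau[OF that]] by (simp add: g_def)
    ultimately show ?thesis by (simp add: LIMSEQ_const_iff)
  qed
  then show ?thesis using i by (intro that[of c])
qed

text \<open>Truncated to [-N, N], the positive and negative parts of g are densities of finite
  measures that agree on all half-lines. The measures are therefore equal, hence so are the
  densities, and g vanishes.\<close>

lemma AE_zero_if_integrals_zero:
  fixes g :: "real \<Rightarrow> real"
  assumes gi: "\<And>a b. set_integrable lborel {a..b} g" and g0: "\<And>a b. (LBINT x:{a..b}. g x) = 0"
  shows "AE x in lborel. g x = 0"
proof -
  let ?d = "\<lambda>s. density lborel (\<lambda>x. ennreal (max 0 (s x)))"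
  have "AE x in lborel. indicator {-real N..real N} x * g x = 0" for N
  proof -
    define k where "k = (\<lambda>x. indicator {-real N..real N} x * g x)"
    have k: "integrable lborel k" using gi[of "-real N" "real N"] by (simp add: k_def set_integrable_def)
    note [measurable] = borel_measurable_integrable[OF k]
    have kp: "integrable lborel (\<lambda>x. max 0 (k x))" "integrable lborel (\<lambda>x. max 0 (- k x))"
      using k by auto
    have ki: "integrable lborel (\<lambda>x. indicator A x * max 0 (k x))" "integrable lborel (\<lambda>x. indicator A x * max 0 (- k x))"
      if "A \<in> sets borel" for A
      using integrable_mult_indicator[OF _ kp(1), of A] integrable_mult_indicator[OF _ kp(2), of A] that by auto
    have em: "emeasure (?d s) {a<..} = ennreal (LBINT x. indicator {a<..} x * max 0 (s x))"
      if s: "s \<in> borel_measurable borel" "integrable lborel (\<lambda>x. indicator {a<..} x * max 0 (s x))" for s :: "real \<Rightarrow> real" and a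
    proof -
      note [measurable] = s(1)
      have "emeasure (?d s) {a<..} = (\<integral>\<^sup>+x. ennreal (max 0 (s x)) * indicator {a<..} x \<partial>lborel)"
        by (subst emeasure_density) auto
      also have "\<dots> = (\<integral>\<^sup>+x. ennreal (indicator {a<..} x * max 0 (s x)) \<partial>lborel)"
        by (intro nn_integral_cong) (auto simp: indicator_def)
      also have "\<dots> = ennreal (LBINT x. indicator {a<..} x * max 0 (s x))"
        using s(2) by (intro nn_integral_eq_integral) auto
      finally show ?thesis .
    qed
    have "?d k = ?d (\<lambda>x. - k x)"
    proof (rule measure_eqI_lessThan)
      fix a :: real
      show "emeasure (?d k) {a<..} < \<infinity>"
        using em[of k a] ki(1)[of "{a<..}"] by simp
      \<comment> \<open>A half-line meets [-N, N] in a closed interval, up to the point a.\<close>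
      have "(LBINT x. indicator {a<..} x * k x) = (LBINT x:{max a (-real N)..real N}. g x)"
        unfolding set_lebesgue_integral_def
      proof (rule integral_cong_AE)
        show "(\<lambda>x. indicator {max a (-real N)..real N} x *\<^sub>R g x) \<in> borel_measurable lborel"
          using gi unfolding set_integrable_def by (rule borel_measurable_integrable)
        show "AE x in lborel. indicator {a<..} x * k x = indicator {max a (-real N)..real N} x *\<^sub>R g x"
          using AE_lborel_singleton[of a] by eventually_elim (auto simp: k_def indicator_def)
      qed measurable
      then have "(LBINT x. indicator {a<..} x * k x) = 0" using g0 by simp
      moreover have "(\<lambda>x. indicator {a<..} x * k x) = (\<lambda>x. indicator {a<..} x * max 0 (k x) - indicator {a<..} x * max 0 (- k x))"
        by (auto simp: fun_eq_iff indicator_def max_def)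
      ultimately have "(LBINT x. indicator {a<..} x * max 0 (k x)) = (LBINT x. indicator {a<..} x * max 0 (- k x))"
        using ki[of "{a<..}"] by simp
      then show "emeasure (?d k) {a<..} = emeasure (?d (\<lambda>x. - k x)) {a<..}"
        using em[of k a] em[of "\<lambda>x. - k x" a] ki[of "{a<..}"] by simp
    qed auto
    then have "AE x in lborel. ennreal (max 0 (k x)) = ennreal (max 0 (- k x))"
      by (intro sigma_finite_measure.density_unique[OF sigma_finite_lborel]) auto
    then have "AE x in lborel. k x = 0" by eventually_elim (auto simp: max_def split: if_splits)
    then show ?thesis by (simp add: k_def)
  qed
  then have "AE x in lborel. \<forall>N. indicator {-real N..real N} x * g x = 0" unfolding AE_all_countable by blast
  then show ?thesis
  proof eventually_elim
    fix x assume a: "\<forall>N. indicator {-real N..real N} x * g x = 0"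
    obtain N where "\<bar>x\<bar> \<le> real N" using real_arch_simple by blast
    then have "x \<in> {- real N..real N}" by auto
    then show "g x = 0" using a[rule_format, of N] by simp
  qed
qed

section \<open>The Sobolev space of order one\<close>

lemma primitive_on_exists:
  assumes "\<And>a b. set_integrable lborel {a..b} v"
  obtains U where "primitive_on UNIV U v"
proof -
  define U where "U = (\<lambda>x. if 0 \<le> x then integral {0..x} v else - integral {x..0} v)"
  have i: "v integrable_on {a..b}" "(LBINT x:{a..b}. v x) = integral {a..b} v" for a b
    using set_borel_integral_eq_integral[OF assms] by auto
  have "U b - U a = integral {a..b} v" if "a \<le> b" for a b
  proof -
    consider "0 \<le> a" | "a < 0" "0 \<le> b" | "b < 0" by linarith
    then show ?thesis
    proof cases
      case 1
      then show ?thesis using that Henstock_Kurzweil_Integration.integral_combine[OF _ that i(1), of 0] by (simp add: U_def)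
    next
      case 2
      then show ?thesis using that Henstock_Kurzweil_Integration.integral_combine[OF _ _ i(1), of a 0 b] by (simp add: U_def)
    next
      case 3
      then show ?thesis using that Henstock_Kurzweil_Integration.integral_combine[OF that _ i(1), of 0] by (simp add: U_def)
    qed
  qed
  then have "primitive_on UNIV U v"
    unfolding primitive_on_def using assms i(2) by auto
  then show ?thesis by (rule that)
qed

text \<open>A primitive of \<open>u'\<close> has the same weak derivative as \<open>u\<close>, so
  the two differ by a constant, which is absorbed into the representative.\<close>

lemma in_H1_representative:
  assumes "in_H1 u u'"
  obtains U where "primitive_on UNIV U u'" "continuous_on UNIV U" "AE x in lborel. u x = U x"
proof -
  have L2: "in_L2 u" "in_L2 u'" and weak: "weak_deriv u u'" using assms by (auto simp: in_H1_def)
  obtain U where U: "primitive_on UNIV U u'"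
    using primitive_on_exists[OF in_L2_set_integrable[OF L2(2)]] by blast
  have w: "(LBINT x. u x * deriv \<phi> x) = - (LBINT x. u' x * \<phi> x)" if "test_fun UNIV \<phi>" for \<phi>
    using weak that unfolding weak_deriv_def by blast
  obtain c where "\<And>a b. {a..b} \<subseteq> UNIV \<Longrightarrow> set_integrable lborel {a..b} (\<lambda>x. u x - U x - c)"
    "\<And>a b. {a..b} \<subseteq> UNIV \<Longrightarrow> (LBINT x:{a..b}. u x - U x - c) = 0"
    by (rule du_Bois_Reymond[OF open_UNIV is_interval_univ UNIV_not_empty U in_L2_set_integrable[OF L2(1)] w])
       (assumption, rule that)
  then have c: "\<And>a b. set_integrable lborel {a..b} (\<lambda>x. u x - U x - c)"
    "\<And>a b. (LBINT x:{a..b}. u x - U x - c) = 0" by auto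
  have P: "primitive_on UNIV (\<lambda>x. U x + c) u'" using U by (simp add: primitive_on_def)
  have "isCont (\<lambda>x. U x + c) x" for x
    using primitive_on_continuous[OF primitive_on_subset[OF P subset_UNIV], of "x - 1" "x + 1"]
    by (rule continuous_on_interior) (simp add: interior_atLeastAtMost_real)
  moreover have "AE x in lborel. u x = U x + c"
    using AE_zero_if_integrals_zero[OF c] by eventually_elim simp
  ultimately show ?thesis using that[of "\<lambda>x. U x + c"] P by (simp add: continuous_at_imp_continuous_on)
qed

lemma L2_norm_indicator: "a \<le> b \<Longrightarrow> L2_norm (indicator {a..b}) = sqrt (b - a)"
proof -
  assume "a \<le> b"
  moreover have "(\<lambda>x. (indicator {a..b} x :: real)\<^sup>2) = indicator {a..b}"
    by (auto simp: indicator_def)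
  ultimately show ?thesis by (simp add: L2_norm_def)
qed

lemma L2_set_integral_le:
  assumes "in_L2 u" "a \<le> b"
  shows "\<bar>LBINT x:{a..b}. u x\<bar> \<le> sqrt (b - a) * L2_norm u"
  using L2_Cauchy_Schwarz[OF in_L2_indicator[of a b] assms(1)] assms(2)
  by (simp add: set_lebesgue_integral_def L2_norm_indicator)

text \<open>By Cauchy-Schwarz, the function changes over [x, x + 1] by at most the L^2 norm of
  \<open>u'\<close>; averaging over this unit interval then compares its value at x with the L^2
  norm of \<open>u\<close>.\<close>

lemma H1_sup_bound:
  assumes H: "in_H1 u u'" and U: "primitive_on UNIV U u'" "continuous_on UNIV U" "AE x in lborel. u x = U x"
  shows "\<bar>U x\<bar> \<le> L2_norm u + L2_norm u'"
proof -
  have L2: "in_L2 u" "in_L2 u'" using H by (auto simp: in_H1_def)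
  note [measurable] = borel_measurable_continuous_onI[OF U(2)]
  have UL2: "in_L2 U"
    by (rule in_L2_bound[OF L2(1)]) (use U(3) in auto)
  have eq: "L2_norm u = L2_norm U"
    using U(3) in_L2_measurable[OF L2(1)] by (intro L2_norm_cong_AE) auto
  have le: "\<bar>U x\<bar> - L2_norm u' \<le> \<bar>U y\<bar>" if "y \<in> {x..x + 1}" for y
  proof -
    have "\<bar>U y - U x\<bar> = \<bar>LBINT z:{x..y}. u' z\<bar>"
      using primitive_on_diff[OF U(1), of x y] that by simp
    also have "\<dots> \<le> sqrt (y - x) * L2_norm u'"
      using that by (intro L2_set_integral_le L2) auto
    also have "\<dots> \<le> 1 * L2_norm u'"
      using that by (intro mult_right_mono) auto
    finally show ?thesis by linarith
  qed
  have i: "set_integrable lborel {x..x + 1} (\<lambda>y. \<bar>U y\<bar>)"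
    using in_L2_set_integrable[OF in_L2_abs[OF UL2]] .
  have c: "set_integrable lborel {x..x + 1} (\<lambda>y. c)" for c :: real
    by (intro borel_integrable_atLeastAtMost') auto
  have "\<bar>U x\<bar> - L2_norm u' = (LBINT y:{x..x+1}. \<bar>U x\<bar> - L2_norm u')"
    by (simp add: set_lebesgue_integral_def)
  also have "\<dots> \<le> (LBINT y:{x..x+1}. \<bar>U y\<bar>)"
    using le by (intro set_integral_mono c i) auto
  also have "\<dots> \<le> sqrt (x + 1 - x) * L2_norm (\<lambda>y. \<bar>U y\<bar>)"
    using L2_set_integral_le[OF in_L2_abs[OF UL2], of x "x + 1"] by linarith
  also have "\<dots> = L2_norm u" by (simp add: eq) (simp add: L2_norm_def)
  finally show ?thesis by simp
qed

lemma H1_AE_bound: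
  assumes H: "in_H1 u u'"
  shows "AE x in lborel. \<bar>u x\<bar> \<le> L2_norm u + L2_norm u'"
proof -
  obtain U where U: "primitive_on UNIV U u'" "continuous_on UNIV U" "AE x in lborel. u x = U x"
    by (rule in_H1_representative[OF H]) (rule that)
  show ?thesis using U(3) by eventually_elim (simp add: H1_sup_bound[OF H U])
qed

text \<open>An integrable function cannot stay away from 0 on a half-line. With G a product of two
  H^1 functions this disposes of the boundary terms at infinity: the interior integrals show that
  they converge, and integrability identifies the limit.\<close>

lemma integrable_odd_part_limit_zero:
  fixes G :: "real \<Rightarrow> real"
  assumes G: "integrable lborel G" and L: "((\<lambda>R. G R - G (- R)) \<longlongrightarrow> L) at_top"
  shows "L = 0"
proof (rule ccontr)
  assume "L \<noteq> 0"
  then have "\<bar>L\<bar> / 2 < \<bar>L\<bar>" by simp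
  moreover have "((\<lambda>R. \<bar>G R - G (- R)\<bar>) \<longlongrightarrow> \<bar>L\<bar>) at_top" using L by (rule tendsto_rabs)
  ultimately have "\<forall>\<^sub>F R in at_top. \<bar>L\<bar> / 2 < \<bar>G R - G (- R)\<bar>" by (metis order_tendstoD(1))
  then obtain N where N: "\<And>R. N \<le> R \<Longrightarrow> \<bar>L\<bar> / 2 < \<bar>G R - G (- R)\<bar>"
    by (auto simp: eventually_at_top_linorder)
  have "integrable lborel (\<lambda>R. G (0 + (- 1) * R))"
    using G lborel_integrable_real_affine_iff[of "-1" G 0] by simp
  then have J: "integrable lborel (\<lambda>R. \<bar>G R - G (- R)\<bar>)" using G by simp
  \<comment> \<open>On [N, N + k] the integrand exceeds |L| / 2, so the integral would exceed every
    multiple of this number.\<close>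
  have "real k * (\<bar>L\<bar> / 2) \<le> (LBINT R. \<bar>G R - G (- R)\<bar>)" for k
  proof -
    have "real k * (\<bar>L\<bar> / 2) = (LBINT R. indicator {N..N + real k} R * (\<bar>L\<bar> / 2))" by simp
    also have "\<dots> \<le> (LBINT R. \<bar>G R - G (- R)\<bar>)"
    proof (rule integral_mono[OF _ J])
      show "integrable lborel (\<lambda>R. indicator {N..N + real k} R * (\<bar>L\<bar> / 2))"
        by (intro integrable_mult_left) (simp add: integrable_indicator_iff)
      show "indicator {N..N + real k} R * (\<bar>L\<bar> / 2) \<le> \<bar>G R - G (- R)\<bar>" for R
        using N[of R] by (auto simp: indicator_def)
    qed
    finally show ?thesis .
  qed
  then show False using \<open>L \<noteq> 0\<close> reals_Archimedean3[of "\<bar>L\<bar> / 2"] by (metis half_gt_zero linorder_not_le zero_less_abs_iff)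
qed

text \<open>Integration by parts for the continuous representatives on [-R, R], with R tending to
  infinity. Neither factor is a test function, which is the case that the energy identity
  requires.\<close>

lemma H1_by_parts:
  assumes p: "in_H1 p p'" and q: "in_H1 q q'"
  shows "(LBINT x. p x * q' x) = - (LBINT x. p' x * q x)"
proof -
  have L2: "in_L2 p" "in_L2 p'" "in_L2 q" "in_L2 q'" using p q by (auto simp: in_H1_def)
  obtain P where P: "primitive_on UNIV P p'" "continuous_on UNIV P" "AE x in lborel. p x = P x"
    by (rule in_H1_representative[OF p]) (rule that)
  obtain Q where Q: "primitive_on UNIV Q q'" "continuous_on UNIV Q" "AE x in lborel. q x = Q x"
    by (rule in_H1_representative[OF q]) (rule that)
  note [measurable] = borel_measurable_continuous_onI[OF P(2)] borel_measurable_continuous_onI[OF Q(2)] L2[THEN in_L2_measurable]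
  have PL2: "in_L2 P" by (rule in_L2_bound[OF L2(1)]) (use P(3) in auto)
  have QL2: "in_L2 Q" by (rule in_L2_bound[OF L2(3)]) (use Q(3) in auto)
  have i1: "integrable lborel (\<lambda>x. p' x * Q x)" and i2: "integrable lborel (\<lambda>x. P x * q' x)"
    using L2 PL2 QL2 by (auto intro: in_L2_mult_integrable)
  define w where "w = (\<lambda>x. p' x * Q x + P x * q' x)"
  have w: "integrable lborel w" using i1 i2 by (simp add: w_def)
  note [measurable] = borel_measurable_integrable[OF w]
  define L where "L = (LBINT x. w x)"
  have "((\<lambda>R. LBINT x. indicator {-R..R} x * w x) \<longlongrightarrow> L) at_top"
    unfolding L_def
  proof (rule integral_dominated_convergence_at_top[where w="\<lambda>x. \<bar>w x\<bar>"])
    show "\<forall>\<^sub>F R in at_top. AE x in lborel. norm (indicator {-R..R} x * w x) \<le> \<bar>w x\<bar>"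
      by (intro always_eventually allI AE_I2) (auto simp: indicator_def)
    show "AE x in lborel. ((\<lambda>R. indicator {-R..R} x * w x) \<longlongrightarrow> w x) at_top"
    proof (rule AE_I2)
      fix x
      have "\<forall>\<^sub>F R in at_top. indicator {-R..R} x * w x = w x"
        using eventually_ge_at_top[of "\<bar>x\<bar>"] by eventually_elim (simp add: abs_le_iff)
      then show "((\<lambda>R. indicator {-R..R} x * w x) \<longlongrightarrow> w x) at_top" by (rule tendsto_eventually)
    qed
  qed (use w in auto)
  moreover have "\<forall>\<^sub>F R in at_top. (LBINT x. indicator {-R..R} x * w x) = P R * Q R - P (- R) * Q (- R)"
    using eventually_ge_at_top[of "0::real"]
  proof eventually_elim
    fix R :: real assume R: "0 \<le> R"
    have PQ: "primitive_on {-R..R} P p'" "primitive_on {-R..R} Q q'"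
      using P(1) Q(1) by (auto intro: primitive_on_subset)
    have "(LBINT x. indicator {-R..R} x * w x) = (LBINT x:{-R..R}. p' x * Q x + P x * q' x)"
      by (simp add: set_lebesgue_integral_def w_def)
    also have "\<dots> = (LBINT x:{-R..R}. p' x * Q x) + (LBINT x:{-R..R}. P x * q' x)"
      using integrable_mult_indicator[OF _ i1, of "{-R..R}"] integrable_mult_indicator[OF _ i2, of "{-R..R}"]
      by (intro set_integral_add) (simp_all add: set_integrable_def)
    also have "\<dots> = P R * Q R - P (- R) * Q (- R)"
      using R by (intro primitive_on_by_parts PQ) auto
    finally show "(LBINT x. indicator {-R..R} x * w x) = P R * Q R - P (- R) * Q (- R)" .
  qed
  ultimately have lim: "((\<lambda>R. P R * Q R - P (- R) * Q (- R)) \<longlongrightarrow> L) at_top"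
    by (rule Lim_transform_eventually)
  have "L = 0"
    by (rule integrable_odd_part_limit_zero[OF in_L2_mult_integrable[OF PL2 QL2] lim])
  then have "(LBINT x. p' x * Q x) + (LBINT x. P x * q' x) = 0"
    using i1 i2 by (simp add: L_def w_def)
  moreover have "(LBINT x. p' x * Q x) = (LBINT x. p' x * q x)"
    using Q(3) by (intro integral_cong_AE) auto
  moreover have "(LBINT x. P x * q' x) = (LBINT x. p x * q' x)"
    using P(3) by (intro integral_cong_AE) auto
  ultimately show ?thesis by simp
qed

lemma test_fun_deriv_integral: "test_fun UNIV \<phi> \<Longrightarrow> (LBINT x. deriv \<phi> x) = 0"
  using primitive_on_test_fun[of UNIV "\<lambda>x. 1" "\<lambda>x. 0" \<phi>] by (simp add: primitive_on_def set_integrable_def)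

text \<open>The continuous representative is constant, and a nonzero constant is not square
  integrable over the line.\<close>

lemma in_H1_deriv_zero:
  assumes "in_H1 u (\<lambda>x. 0)" shows "AE x in lborel. u x = 0"
proof -
  obtain U where U: "primitive_on UNIV U (\<lambda>x. 0)" "continuous_on UNIV U" "AE x in lborel. u x = U x"
    by (rule in_H1_representative[OF assms]) (rule that)
  have c: "U x = U 0" for x
    using primitive_on_diff[OF U(1), of 0 x] primitive_on_diff[OF U(1), of x 0]
    by (cases "0 \<le> x") auto
  have u: "in_L2 u" using assms by (simp add: in_H1_def)
  have AE: "AE x in lborel. (u x)\<^sup>2 = (U 0)\<^sup>2" using U(3) by eventually_elim (metis c)
  have le: "real n * (U 0)\<^sup>2 \<le> (L2_norm u)\<^sup>2" for n
  proof -
    have "real n * (U 0)\<^sup>2 = (LBINT x. indicator {0..real n} x * (U 0)\<^sup>2)" by simp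
    also have "\<dots> \<le> (LBINT x. (u x)\<^sup>2)"
    proof (rule integral_mono_AE[OF _ in_L2_square_integrable[OF u]])
      show "integrable lborel (\<lambda>x. indicator {0..real n} x * (U 0)\<^sup>2)"
        by (intro integrable_mult_left) (simp add: integrable_indicator_iff)
      show "AE x in lborel. indicator {0..real n} x * (U 0)\<^sup>2 \<le> (u x)\<^sup>2"
        using AE by eventually_elim (auto simp: indicator_def)
    qed
    finally show ?thesis by (simp add: L2_norm_sq)
  qed
  have "U 0 = 0"
  proof (rule ccontr)
    assume "U 0 \<noteq> 0"
    then obtain n where "(L2_norm u)\<^sup>2 < real n * (U 0)\<^sup>2" using reals_Archimedean3[of "(U 0)\<^sup>2"] by auto
    then show False using le[of n] by simp
  qed
  then show ?thesis using U(3) c by auto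
qed

lemma in_H1_cong_AE:
  assumes "in_H1 u u'" "AE x in lborel. u' x = v' x" and [measurable]: "v' \<in> borel_measurable borel"
  shows "in_H1 u v'"
proof -
  have L2: "in_L2 u" "in_L2 u'" and w: "weak_deriv u u'" using assms by (auto simp: in_H1_def)
  note [measurable] = in_L2_measurable[OF L2(2)]
  have "in_L2 v'" by (rule in_L2_bound[OF L2(2)]) (use assms(2) in auto)
  moreover have "(LBINT x. u' x * \<phi> x) = (LBINT x. v' x * \<phi> x)" if "test_fun UNIV \<phi>" for \<phi>
    using assms(2) test_fun_measurable[OF that] by (intro integral_cong_AE) auto
  ultimately show ?thesis using L2 w by (simp add: in_H1_def weak_deriv_def)
qed

lemma in_H1_diff:
  assumes u: "in_H1 u u'" and v: "in_H1 v v'"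
  shows "in_H1 (\<lambda>x. u x - v x) (\<lambda>x. u' x - v' x)"
  unfolding in_H1_def
proof (intro conjI)
  have L2: "in_L2 u" "in_L2 u'" "in_L2 v" "in_L2 v'" using u v by (auto simp: in_H1_def)
  then show "in_L2 (\<lambda>x. u x - v x)" "in_L2 (\<lambda>x. u' x - v' x)" by (auto intro: in_L2_diff)
  show "weak_deriv (\<lambda>x. u x - v x) (\<lambda>x. u' x - v' x)"
    unfolding weak_deriv_def
  proof (intro allI impI)
    fix \<phi> :: "real \<Rightarrow> real" assume \<phi>: "test_fun UNIV \<phi>"
    note t = test_fun_in_L2[OF \<phi>] test_fun_in_L2[OF test_fun_deriv[OF \<phi>]]
    show "(LBINT x. (u x - v x) * deriv \<phi> x) = - (LBINT x. (u' x - v' x) * \<phi> x)"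
      using u v \<phi> L2 t by (simp add: left_diff_distrib in_L2_mult_integrable in_H1_def weak_deriv_def)
  qed
qed

text \<open>The constant 1 is not square integrable, so the depth 1 - \<beta> b_0 is not itself in
  H^1 and its weak derivative is obtained separately.\<close>

lemma weak_deriv_affine:
  assumes "in_H1 b b'" shows "weak_deriv (\<lambda>x. 1 - \<beta> * b x) (\<lambda>x. - \<beta> * b' x)"
  unfolding weak_deriv_def
proof (intro allI impI)
  fix \<phi> :: "real \<Rightarrow> real" assume \<phi>: "test_fun UNIV \<phi>"
  have "in_L2 b" using assms by (simp add: in_H1_def)
  from in_L2_mult_integrable[OF this test_fun_in_L2[OF test_fun_deriv[OF \<phi>]]]
  show "(LBINT x. (1 - \<beta> * b x) * deriv \<phi> x) = - (LBINT x. - \<beta> * b' x * \<phi> x)"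
    using assms \<phi> test_fun_integrable[OF test_fun_deriv[OF \<phi>]] test_fun_deriv_integral[OF \<phi>]
    by (simp add: left_diff_distrib mult.assoc in_H1_def weak_deriv_def)
qed

text \<open>The weak derivative of \<open>h\<close> is tested with a product of two test functions.
  This makes h times a test function admissible in integration by parts against H^1
  functions.\<close>

lemma in_H1_mult_test_fun:
  assumes w: "weak_deriv h h'" and h': "in_L2 h'" and [measurable]: "h \<in> borel_measurable borel"
    and M: "AE x in lborel. \<bar>h x\<bar> \<le> M" and \<psi>: "test_fun UNIV \<psi>"
  shows "in_H1 (\<lambda>x. h x * \<psi> x) (\<lambda>x. h' x * \<psi> x + h x * deriv \<psi> x)"
  unfolding in_H1_def
proof (intro conjI)
  note [measurable] = test_fun_measurable[OF \<psi>] in_L2_measurable[OF h']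
  have hL2: "in_L2 (\<lambda>x. h x * \<phi> x)" if "test_fun UNIV \<phi>" for \<phi>
    by (rule in_L2_bounded_mult[OF test_fun_in_L2[OF that] _ M]) measurable
  have h'L2: "in_L2 (\<lambda>x. h' x * \<psi> x)"
  proof -
    obtain B where "\<And>x. \<bar>\<psi> x\<bar> \<le> B" using test_fun_bounded[OF \<psi>] by metis
    then have "in_L2 (\<lambda>x. \<psi> x * h' x)" by (intro in_L2_bounded_mult[OF h', where M=B]) auto
    then show ?thesis by (simp add: mult.commute)
  qed
  show "in_L2 (\<lambda>x. h x * \<psi> x)" by (rule hL2[OF \<psi>])
  show "in_L2 (\<lambda>x. h' x * \<psi> x + h x * deriv \<psi> x)" by (intro in_L2_add h'L2 hL2 test_fun_deriv \<psi>)
  show "weak_deriv (\<lambda>x. h x * \<psi> x) (\<lambda>x. h' x * \<psi> x + h x * deriv \<psi> x)"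
    unfolding weak_deriv_def
  proof (intro allI impI)
    fix \<phi> :: "real \<Rightarrow> real" assume \<phi>: "test_fun UNIV \<phi>"
    have s: "smooth \<psi>" "smooth \<phi>" using \<phi> \<psi> test_fun_smooth by auto
    have t: "test_fun UNIV (\<lambda>x. \<psi> x * \<phi> x)" by (rule test_fun_mult_left[OF s(1) \<phi>])
    have d: "deriv (\<lambda>x. \<psi> x * \<phi> x) = (\<lambda>x. \<psi> x * deriv \<phi> x + deriv \<psi> x * \<phi> x)"
      using s t by (simp add: deriv_eq_dir_deriv dir_deriv_mult test_fun_smooth)
    have i1: "integrable lborel (\<lambda>x. h x * \<psi> x * deriv \<phi> x)"
      by (intro in_L2_mult_integrable hL2[OF \<psi>] test_fun_in_L2[OF test_fun_deriv[OF \<phi>]])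
    have i2: "integrable lborel (\<lambda>x. h x * deriv \<psi> x * \<phi> x)"
      by (intro in_L2_mult_integrable hL2[OF test_fun_deriv[OF \<psi>]] test_fun_in_L2[OF \<phi>])
    have i3: "integrable lborel (\<lambda>x. h' x * \<psi> x * \<phi> x)"
      by (intro in_L2_mult_integrable h'L2 test_fun_in_L2[OF \<phi>])
    have "(LBINT x. h x * (\<psi> x * deriv \<phi> x + deriv \<psi> x * \<phi> x)) = - (LBINT x. h' x * (\<psi> x * \<phi> x))"
      using w t d unfolding weak_deriv_def by metis
    then show "(LBINT x. h x * \<psi> x * deriv \<phi> x) = - (LBINT x. (h' x * \<psi> x + h x * deriv \<psi> x) * \<phi> x)"
      using i1 i2 i3 by (simp add: algebra_simps)
  qed
qed

section \<open>Curves in the space of square integrable functions\<close>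

lemma C_L2_in_L2: "C_L2 v \<Longrightarrow> 0 \<le> t \<Longrightarrow> in_L2 (v t)"
  by (simp add: C_L2_def)

lemma C_L2_continuous: "C_L2 v \<Longrightarrow> 0 \<le> t \<Longrightarrow> ((\<lambda>s. L2_norm (\<lambda>x. v s x - v t x)) \<longlongrightarrow> 0) (at t within {0..})"
  by (simp add: C_L2_def)

text \<open>Nothing is assumed about \<open>v\<close> at negative times; the indicator function restores measurability.\<close>

lemma C_L2_measurable:
  assumes "C_L2 v"
  shows "(\<lambda>p. indicator {0..} (fst p) * v (fst p) (snd p)) \<in> borel_measurable (borel :: (real \<times> real) measure)"
proof -
  have "(\<lambda>p. indicator ({0..} \<times> UNIV) p *\<^sub>R v (fst p) (snd p)) \<in> borel_measurable (borel :: (real \<times> real) measure)"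
    using assms by (simp add: C_L2_def set_borel_measurable_def)
  moreover have "indicator ({0..} \<times> UNIV) p *\<^sub>R v (fst p) (snd p) = indicator {0..} (fst p) * v (fst p) (snd p)" for p :: "real \<times> real"
    by (cases p) (auto simp: indicator_def)
  ultimately show ?thesis by (simp only:)
qed

lemma C_L2_measurable_pair [measurable]:
  assumes "C_L2 v" and [measurable]: "f \<in> borel_measurable M" "g \<in> borel_measurable M"
  shows "(\<lambda>z. indicator {0..} (f z) * v (f z) (g z)) \<in> borel_measurable M"
proof -
  have "(\<lambda>z. (f z, g z)) \<in> M \<rightarrow>\<^sub>M (borel :: (real \<times> real) measure)"
    by (rule borel_measurable_Pair) measurable
  from measurable_compose[OF this C_L2_measurable[OF assms(1)]] show ?thesis by simp
qed

lemma tendsto_zero_comparison: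
  fixes F G :: "real \<Rightarrow> real"
  assumes "\<And>s. s \<noteq> t \<Longrightarrow> s \<in> {0..} \<Longrightarrow> norm (F s) \<le> G s" and "(G \<longlongrightarrow> 0) (at t within {0..})"
  shows "(F \<longlongrightarrow> 0) (at t within {0..})"
  by (rule Lim_null_comparison[OF _ assms(2)]) (auto simp: eventually_at_filter assms(1)[unfolded real_norm_def])

lemma C_L2_norm_continuous:
  assumes "C_L2 v" shows "continuous_on {0..} (\<lambda>t. L2_norm (v t))"
  unfolding continuous_on_def
proof
  fix t :: real assume t: "t \<in> {0..}"
  have "((\<lambda>s. L2_norm (v s) - L2_norm (v t)) \<longlongrightarrow> 0) (at t within {0..})"
  proof (rule tendsto_zero_comparison)
    fix s :: real assume "s \<noteq> t" "s \<in> {0..}"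
    then have L2: "in_L2 (v s)" "in_L2 (v t)" using assms t by (auto intro: C_L2_in_L2)
    show "norm (L2_norm (v s) - L2_norm (v t)) \<le> L2_norm (\<lambda>x. v s x - v t x)"
      using L2_norm_le_add_diff[OF L2] L2_norm_le_add_diff[OF L2(2,1)] L2_norm_diff_commute[of "v s" "v t"] by auto
  qed (use assms t in \<open>auto intro: C_L2_continuous\<close>)
  then show "((\<lambda>t. L2_norm (v t)) \<longlongrightarrow> L2_norm (v t)) (at t within {0..})"
    by (simp add: LIM_zero_iff)
qed

lemma C_L2_bounded:
  assumes "C_L2 v"
  obtains M where "0 \<le> M" "\<And>t. t \<in> {0..T} \<Longrightarrow> L2_norm (v t) \<le> M"
proof -
  have "compact ((\<lambda>t. L2_norm (v t)) ` {0..T})"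
    by (intro compact_continuous_image continuous_on_subset[OF C_L2_norm_continuous[OF assms]]) auto
  then obtain B where "\<forall>y\<in>(\<lambda>t. L2_norm (v t)) ` {0..T}. norm y \<le> B"
    using compact_imp_bounded bounded_iff by blast
  then have "L2_norm (v t) \<le> max B 0" if "t \<in> {0..T}" for t
    using that by (metis (no_types, lifting) abs_le_D1 imageI le_max_iff_disj real_norm_def)
  then show ?thesis using that[of "max B 0"] by simp
qed

lemma C_L2_const: assumes "in_L2 g" shows "C_L2 (\<lambda>t. g)"
proof -
  note [measurable] = in_L2_measurable[OF assms]
  have "(\<lambda>p::real\<times>real. g (snd p)) \<in> borel_measurable borel"
    unfolding borel_prod[symmetric] by measurable
  moreover have "{0..} \<times> UNIV \<in> sets (borel :: (real \<times> real) measure)"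
    by (intro borel_closed closed_Times) auto
  ultimately have "(\<lambda>p. indicator ({0..} \<times> UNIV) p *\<^sub>R g (snd p)) \<in> borel_measurable (borel :: (real \<times> real) measure)"
    by (intro borel_measurable_scaleR borel_measurable_indicator)
  then show ?thesis using assms by (simp add: C_L2_def set_borel_measurable_def)
qed

lemma C_L2_diff:
  assumes "C_L2 u" "C_L2 v" shows "C_L2 (\<lambda>t x. u t x - v t x)"
  unfolding C_L2_def
proof (intro conjI allI impI)
  show "set_borel_measurable lborel ({0..} \<times> UNIV) (\<lambda>p. u (fst p) (snd p) - v (fst p) (snd p))"
    using assms borel_measurable_diff unfolding C_L2_def set_borel_measurable_def real_vector.scale_right_diff_distrib
    by blast
  show "in_L2 (\<lambda>x. u t x - v t x)" if "0 \<le> t" for t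
    using assms that by (intro in_L2_diff C_L2_in_L2)
  fix t :: real assume t: "0 \<le> t"
  show "((\<lambda>s. L2_norm (\<lambda>x. u s x - v s x - (u t x - v t x))) \<longlongrightarrow> 0) (at t within {0..})"
  proof (rule tendsto_zero_comparison)
    fix s :: real assume "s \<noteq> t" "s \<in> {0..}"
    then have "in_L2 (\<lambda>x. u s x - u t x)" "in_L2 (\<lambda>x. v s x - v t x)"
      using assms t by (auto intro!: in_L2_diff intro: C_L2_in_L2)
    from L2_norm_diff_le[OF this]
    show "norm (L2_norm (\<lambda>x. u s x - v s x - (u t x - v t x))) \<le> L2_norm (\<lambda>x. u s x - u t x) + L2_norm (\<lambda>x. v s x - v t x)"
      by (simp add: algebra_simps)
  next
    show "((\<lambda>s. L2_norm (\<lambda>x. u s x - u t x) + L2_norm (\<lambda>x. v s x - v t x)) \<longlongrightarrow> 0) (at t within {0..})"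
      using tendsto_add[OF C_L2_continuous[OF assms(1) t] C_L2_continuous[OF assms(2) t]] by simp
  qed
qed

lemma C_L2_pairing_continuous:
  assumes v: "C_L2 v" and g: "in_L2 g"
  shows "continuous_on {0..} (\<lambda>t. LBINT x. v t x * g x)"
  unfolding continuous_on_def
proof
  fix t :: real assume t: "t \<in> {0..}"
  have "((\<lambda>s. (LBINT x. v s x * g x) - (LBINT x. v t x * g x)) \<longlongrightarrow> 0) (at t within {0..})"
  proof (rule tendsto_zero_comparison)
    fix s :: real assume "s \<noteq> t" "s \<in> {0..}"
    then have L2: "in_L2 (v s)" "in_L2 (v t)" using v t by (auto intro: C_L2_in_L2)
    have "(LBINT x. v s x * g x) - (LBINT x. v t x * g x) = (LBINT x. (v s x - v t x) * g x)"
      using in_L2_mult_integrable[OF L2(1) g] in_L2_mult_integrable[OF L2(2) g] by (simp add: left_diff_distrib)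
    then show "norm ((LBINT x. v s x * g x) - (LBINT x. v t x * g x)) \<le> L2_norm (\<lambda>x. v s x - v t x) * L2_norm g"
      using L2_Cauchy_Schwarz[OF in_L2_diff[OF L2] g] by simp
  next
    show "((\<lambda>s. L2_norm (\<lambda>x. v s x - v t x) * L2_norm g) \<longlongrightarrow> 0) (at t within {0..})"
      using v t by (intro tendsto_mult_left_zero C_L2_continuous) auto
  qed
  then show "((\<lambda>s. LBINT x. v s x * g x) \<longlongrightarrow> (LBINT x. v t x * g x)) (at t within {0..})"
    by (simp add: LIM_zero_iff)
qed

section \<open>Integration over the plane and over time sections\<close>

lemma C_L2_square_integrable:
  assumes v: "C_L2 v"
  shows "integrable (lborel \<Otimes>\<^sub>M lborel) (\<lambda>p. indicator {0..T} (fst p) * (v (fst p) (snd p))\<^sup>2)"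
proof (rule lborel_pair.Fubini_integrable)
  have eq: "indicator {0..T} t * (v t x)\<^sup>2 = indicator {0..T} t * (indicator {0..} t * v t x)\<^sup>2" for t x
    by (auto simp: indicator_def)
  show "(\<lambda>p. indicator {0..T} (fst p) * (v (fst p) (snd p))\<^sup>2) \<in> borel_measurable (lborel \<Otimes>\<^sub>M lborel)"
    unfolding eq using C_L2_measurable_pair[OF v, of fst "lborel \<Otimes>\<^sub>M lborel" snd] by simp
  have "set_integrable lborel {0..T} (\<lambda>t. (L2_norm (v t))\<^sup>2)"
    by (intro borel_integrable_atLeastAtMost' continuous_intros continuous_on_subset[OF C_L2_norm_continuous[OF v]]) auto
  then show "integrable lborel (\<lambda>x. LBINT y. norm (indicator {0..T} (fst (x, y)) * (v (fst (x, y)) (snd (x, y)))\<^sup>2))"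
    by (simp add: set_integrable_def L2_norm_sq abs_mult)
  show "AE x in lborel. integrable lborel (\<lambda>y. indicator {0..T} (fst (x, y)) * (v (fst (x, y)) (snd (x, y)))\<^sup>2)"
  proof (rule AE_I2)
    fix t show "integrable lborel (\<lambda>y. indicator {0..T} (fst (t, y)) * (v (fst (t, y)) (snd (t, y)))\<^sup>2)"
      using C_L2_in_L2[OF v, of t] by (cases "t \<in> {0..T}") (auto simp: in_L2_def)
  qed
qed

text \<open>Weights against which every curve in \<open>C_L2\<close> can be integrated over the
  plane: bounded support in time and a square integrable majorant in space. The majorant also makes
  the weight vanish at negative times, where curves are arbitrary.\<close>

definition time_kernel :: "(real \<times> real \<Rightarrow> real) \<Rightarrow> bool" where
  "time_kernel w \<longleftrightarrow> w \<in> borel_measurable borel \<and>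
     (\<exists>T g. in_L2 g \<and> (\<forall>t x. \<bar>w (t, x)\<bar> \<le> indicator {0..T} t * g x))"

lemma time_kernel_integrable:
  assumes v: "C_L2 v" and w: "time_kernel w"
  shows "integrable (lborel \<Otimes>\<^sub>M lborel) (\<lambda>p. v (fst p) (snd p) * w p)"
proof -
  obtain T g where g: "in_L2 g" and le: "\<And>t x. \<bar>w (t, x)\<bar> \<le> indicator {0..T} t * g x"
    and w[measurable]: "w \<in> borel_measurable borel" using w unfolding time_kernel_def by blast
  have w': "w \<in> borel_measurable (lborel \<Otimes>\<^sub>M lborel)" by (simp add: lborel_prod w)
  have eq: "v (fst p) (snd p) * w p = (indicator {0..} (fst p) * v (fst p) (snd p)) * w p" for p
    using le[of "fst p" "snd p"] by (cases "0 \<le> fst p") auto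
  show ?thesis
  proof (rule Bochner_Integration.integrable_bound)
    show "integrable (lborel \<Otimes>\<^sub>M lborel) (\<lambda>p. indicator {0..T} (fst p) * (v (fst p) (snd p))\<^sup>2 + indicator {0..T} (fst p) * (g (snd p))\<^sup>2)"
      using C_L2_square_integrable[OF v, of T] C_L2_square_integrable[OF C_L2_const[OF g], of T]
      by (rule Bochner_Integration.integrable_add)
    show "(\<lambda>p. v (fst p) (snd p) * w p) \<in> borel_measurable (lborel \<Otimes>\<^sub>M lborel)"
      unfolding eq using C_L2_measurable_pair[OF v, of fst "lborel \<Otimes>\<^sub>M lborel" snd] w' by simp
    show "AE p in lborel \<Otimes>\<^sub>M lborel. norm (v (fst p) (snd p) * w p) \<le> norm (indicator {0..T} (fst p) * (v (fst p) (snd p))\<^sup>2 + indicator {0..T} (fst p) * (g (snd p))\<^sup>2)"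
    proof (rule AE_I2)
      fix p :: "real \<times> real"
      obtain t x where p: "p = (t, x)" by force
      have "\<bar>v t x * w (t, x)\<bar> \<le> indicator {0..T} t * \<bar>v t x * g x\<bar>"
        using mult_left_mono[OF le[of t x], of "\<bar>v t x\<bar>"] le[of t x] by (cases "t \<in> {0..T}") (auto simp: abs_mult)
      also have "\<dots> \<le> indicator {0..T} t * ((v t x)\<^sup>2 + (g x)\<^sup>2)"
        using abs_mult_le_sum_squares by (intro mult_left_mono) auto
      also have "\<dots> \<le> norm (indicator {0..T} t * (v t x)\<^sup>2 + indicator {0..T} t * (g x)\<^sup>2)"
        by (simp add: algebra_simps)
      finally show "norm (v (fst p) (snd p) * w p) \<le> norm (indicator {0..T} (fst p) * (v (fst p) (snd p))\<^sup>2 + indicator {0..T} (fst p) * (g (snd p))\<^sup>2)"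
        by (simp add: p)
    qed
  qed
qed

lemma time_kernel_integral_t:
  assumes "C_L2 v" "time_kernel w"
  shows "(LBINT p. v (fst p) (snd p) * w p) = (LBINT t. LBINT x. v t x * w (t, x))"
  using lborel_pair.integral_fst'[OF time_kernel_integrable[OF assms]] by (simp add: lborel_prod)

lemma time_kernel_integral_x:
  assumes "C_L2 v" "time_kernel w"
  shows "(LBINT p. v (fst p) (snd p) * w p) = (LBINT x. LBINT t. v t x * w (t, x))"
proof -
  have "integrable (lborel \<Otimes>\<^sub>M lborel) (\<lambda>(t, x). v t x * w (t, x))"
    using time_kernel_integrable[OF assms] by (simp add: split_beta')
  from lborel_pair.integral_snd[OF this] show ?thesis by (simp add: lborel_prod split_beta')
qed

text \<open>Fubini gives square integrable time sections on [0, n] for almost every x; the integers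
  n are countably many, so one null set serves all T.\<close>

lemma C_L2_AE_time_in_L2:
  assumes v: "C_L2 v"
  shows "AE x in lborel. \<forall>T. in_L2 (\<lambda>t. indicator {0..T} t * v t x)"
proof -
  have "AE x in lborel. integrable lborel (\<lambda>t. indicator {0..real n} t * (v t x)\<^sup>2)" for n
    using lborel_pair.AE_integrable_snd[of "\<lambda>t x. indicator {0..real n} t * (v t x)\<^sup>2"] C_L2_square_integrable[OF v, of "real n"]
    by (simp add: split_beta')
  then have "AE x in lborel. \<forall>n. integrable lborel (\<lambda>t. indicator {0..real n} t * (v t x)\<^sup>2)"
    unfolding AE_all_countable by blast
  then show ?thesis
  proof eventually_elim
    fix x assume i: "\<forall>n. integrable lborel (\<lambda>t. indicator {0..real n} t * (v t x)\<^sup>2)"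
    show "\<forall>T. in_L2 (\<lambda>t. indicator {0..T} t * v t x)"
    proof
      fix T :: real
      obtain n where n: "T \<le> real n" using real_arch_simple by blast
      have m: "(\<lambda>t. indicator {0..T} t * v t x) \<in> borel_measurable borel" for T
      proof -
        have "(\<lambda>t. indicator {0..T} t * (indicator {0..} t * v t x)) \<in> borel_measurable borel"
          using C_L2_measurable_pair[OF v, of "\<lambda>t. t" borel "\<lambda>t. x"] by simp
        moreover have "indicator {0..T} t * (indicator {0..} t * v t x) = indicator {0..T} t * v t x" for t
          by (auto simp: indicator_def)
        ultimately show ?thesis by simp
      qed
      have "(\<lambda>t. (indicator {0..real n} t * v t x)\<^sup>2) = (\<lambda>t. indicator {0..real n} t * (v t x)\<^sup>2)"
        by (auto simp: indicator_def)
      then have "in_L2 (\<lambda>t. indicator {0..real n} t * v t x)" using m i by (simp add: in_L2_def)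
      then show "in_L2 (\<lambda>t. indicator {0..T} t * v t x)"
        by (rule in_L2_bound[OF _ m]) (use n in \<open>auto simp: indicator_def\<close>)
    qed
  qed
qed

lemma time_in_L2_set_integrable:
  assumes "\<forall>T. in_L2 (\<lambda>t. indicator {0..T} t * v t x)" "0 \<le> a"
  shows "set_integrable lborel {a..b} (\<lambda>t. v t x)"
proof -
  have "set_integrable lborel {a..b} (\<lambda>t. indicator {0..b} t * v t x)"
    using assms(1) in_L2_set_integrable by blast
  then show ?thesis
    by (rule set_integrable_cong[THEN iffD1, rotated -1]) (use assms(2) in auto)
qed

text \<open>The integral of the curve is taken pointwise in x, which keeps it jointly measurable. It
  is genuine for almost every x and 0 by convention where the section is not integrable; for
  negative t the interval is empty.\<close>

definition time_primitive :: "(real \<Rightarrow> real \<Rightarrow> real) \<Rightarrow> real \<Rightarrow> real \<Rightarrow> real" where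
  "time_primitive v t x = (LBINT s:{0..t}. v s x)"

lemma time_primitive_0 [simp]: "time_primitive v 0 x = 0"
proof -
  have "time_primitive v 0 x = (LBINT s. indicator {0..0} (s::real) * v 0 x)"
    unfolding time_primitive_def set_lebesgue_integral_def
    by (rule Bochner_Integration.integral_cong[OF refl]) (auto simp: indicator_def)
  also have "\<dots> = 0" by simp
  finally show ?thesis .
qed

lemma time_primitive_primitive_on:
  assumes i: "\<And>b. set_integrable lborel {0..b} (\<lambda>t. v t x)"
  shows "primitive_on {0..} (\<lambda>t. time_primitive v t x) (\<lambda>t. v t x)"
  unfolding primitive_on_def
proof (intro allI impI conjI)
  fix a b :: real assume ab: "a \<le> b" "{a..b} \<subseteq> {0..}"
  then have a: "0 \<le> a" by auto
  show iab: "set_integrable lborel {a..b} (\<lambda>t. v t x)"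
    by (rule set_integrable_subset[OF i[of b]]) (use a in auto)
  have "integral {0..a} (\<lambda>t. v t x) + integral {a..b} (\<lambda>t. v t x) = integral {0..b} (\<lambda>t. v t x)"
    using a ab set_borel_integral_eq_integral(1)[OF i[of b]] by (intro Henstock_Kurzweil_Integration.integral_combine) auto
  then show "time_primitive v b x - time_primitive v a x = (LBINT t:{a..b}. v t x)"
    using set_borel_integral_eq_integral(2)[OF i[of a]] set_borel_integral_eq_integral(2)[OF i[of b]] set_borel_integral_eq_integral(2)[OF iab]
    by (simp add: time_primitive_def)
qed

lemma C_L2_AE_primitive_on:
  assumes v: "C_L2 v"
  shows "AE x in lborel. primitive_on {0..} (\<lambda>t. time_primitive v t x) (\<lambda>t. v t x)"
  using C_L2_AE_time_in_L2[OF v]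
  by eventually_elim (intro time_primitive_primitive_on time_in_L2_set_integrable order_refl)

lemma time_primitive_measurable:
  assumes v: "C_L2 v"
  shows "(\<lambda>p. time_primitive v (fst p) (snd p)) \<in> borel_measurable (borel :: (real \<times> real) measure)"
proof -
  \<comment> \<open>A parametric integral of a jointly measurable function; the inserted indicator
    guards against the negative times.\<close>
  have "(\<lambda>p. LBINT s. (if 0 \<le> s \<and> s \<le> fst p then indicator {0..} s * v s (snd p) else 0)) \<in> borel_measurable (borel \<Otimes>\<^sub>M borel)"
  proof (rule lborel.borel_measurable_lebesgue_integral)
    note [measurable] = C_L2_measurable_pair[OF v]
    show "(\<lambda>(p, s). if 0 \<le> s \<and> s \<le> fst p then indicator {0..} s * v s (snd p) else 0)
       \<in> borel_measurable ((borel \<Otimes>\<^sub>M borel) \<Otimes>\<^sub>M lborel)"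
      unfolding split_beta' by measurable
  qed
  moreover have "(LBINT s. (if 0 \<le> s \<and> s \<le> fst p then indicator {0..} s * v s (snd p) else 0)) = time_primitive v (fst p) (snd p)" for p
    unfolding time_primitive_def set_lebesgue_integral_def by (rule Bochner_Integration.integral_cong[OF refl]) (auto simp: indicator_def)
  ultimately show ?thesis by (simp add: borel_prod)
qed

text \<open>Minkowski's inequality for the integral of a curve, obtained from the Cauchy-Schwarz
  inequality in time for almost every \<open>x\<close>.\<close>

lemma C_L2_integral_bound:
  assumes v: "C_L2 v" and ab: "0 \<le> a" "a \<le> b" and le: "\<And>t. t \<in> {a..b} \<Longrightarrow> L2_norm (v t) \<le> \<epsilon>"
  shows "in_L2 (\<lambda>x. LBINT t:{a..b}. v t x)"
    and "L2_norm (\<lambda>x. LBINT t:{a..b}. v t x) \<le> (b - a) * \<epsilon>"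
proof -
  let ?i = "indicator {a..b}"
  define I where "I = (\<lambda>x. LBINT t:{a..b}. v t x)"
  define S where "S = (\<lambda>x. LBINT t. ?i t * (v t x)\<^sup>2)"
  have "0 \<le> \<epsilon>" using le[of a] ab L2_norm_nonneg[of "v a"] by (simp del: L2_norm_nonneg)
  have "integrable (lborel \<Otimes>\<^sub>M lborel) (\<lambda>p. indicator ({a..b} \<times> UNIV) p *\<^sub>R (indicator {0..b} (fst p) * (v (fst p) (snd p))\<^sup>2))"
    by (intro integrable_mult_indicator C_L2_square_integrable v) auto
  moreover have "indicator ({a..b} \<times> UNIV) p *\<^sub>R (indicator {0..b} (fst p) * (v (fst p) (snd p))\<^sup>2) = ?i (fst p) * (v (fst p) (snd p))\<^sup>2" for p
    using ab by (cases p) (auto simp: indicator_def)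
  ultimately have sq: "integrable (lborel \<Otimes>\<^sub>M lborel) (\<lambda>(t, x). ?i t * (v t x)\<^sup>2)"
    unfolding split_beta' by (simp only:)
  have S: "integrable lborel S"
    unfolding S_def by (rule lborel_pair.integrable_snd[OF sq])
  \<comment> \<open>Exchanging the integrals turns the time-integrated squares into squared L^2
    norms, to which the hypothesis applies.\<close>
  have "(LBINT x. S x) = (LBINT t. ?i t * (L2_norm (v t))\<^sup>2)"
    unfolding S_def lborel_pair.Fubini_integral[OF sq] by (simp add: L2_norm_sq)
  also have "\<dots> \<le> (LBINT t. ?i t * \<epsilon>\<^sup>2)"
  proof (rule integral_mono)
    have "set_integrable lborel {a..b} (\<lambda>t. (L2_norm (v t))\<^sup>2)"
      using ab by (intro borel_integrable_atLeastAtMost' continuous_intros continuous_on_subset[OF C_L2_norm_continuous[OF v]]) auto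
    then show "integrable lborel (\<lambda>t. ?i t * (L2_norm (v t))\<^sup>2)" by (simp add: set_integrable_def)
    show "integrable lborel (\<lambda>t. ?i t * \<epsilon>\<^sup>2)"
      by (intro integrable_mult_left) (simp add: integrable_indicator_iff emeasure_lborel_Icc_eq)
    show "?i t * (L2_norm (v t))\<^sup>2 \<le> ?i t * \<epsilon>\<^sup>2" for t
      using le[of t] by (auto simp: indicator_def intro!: power_mono)
  qed
  also have "\<dots> = (b - a) * \<epsilon>\<^sup>2" using ab by simp
  finally have S_le: "(LBINT x. S x) \<le> (b - a) * \<epsilon>\<^sup>2" .
  have I: "AE x in lborel. (I x)\<^sup>2 \<le> (b - a) * S x"
    using C_L2_AE_time_in_L2[OF v]
  proof eventually_elim
    fix x assume x: "\<forall>T. in_L2 (\<lambda>t. indicator {0..T} t * v t x)"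
    have eq: "?i t * (indicator {0..b} t * v t x) = ?i t * v t x" for t
      using ab by (auto simp: indicator_def)
    have m: "(\<lambda>t. ?i t * (indicator {0..b} t * v t x)) \<in> borel_measurable borel"
      using x[rule_format, of b, THEN in_L2_measurable] by simp
    have vab: "in_L2 (\<lambda>t. ?i t * (indicator {0..b} t * v t x))"
      by (rule in_L2_bound[OF x[rule_format, of b] m]) (auto simp: indicator_def)
    have "\<bar>I x\<bar> = \<bar>LBINT t:{a..b}. ?i t * (indicator {0..b} t * v t x)\<bar>"
      unfolding I_def using ab by (intro arg_cong[where f=abs] set_lebesgue_integral_cong) (auto simp: indicator_def)
    also have "\<dots> \<le> sqrt (b - a) * L2_norm (\<lambda>t. ?i t * (indicator {0..b} t * v t x))"
      by (rule L2_set_integral_le[OF vab ab(2)])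
    finally have "(I x)\<^sup>2 \<le> (sqrt (b - a) * L2_norm (\<lambda>t. ?i t * (indicator {0..b} t * v t x)))\<^sup>2"
      by (metis abs_ge_zero power2_abs power_mono)
    also have "\<dots> = (b - a) * (LBINT t. (?i t * v t x)\<^sup>2)"
      using ab unfolding eq by (simp add: power_mult_distrib L2_norm_sq)
    also have "(LBINT t. (?i t * v t x)\<^sup>2) = S x"
      unfolding S_def by (rule Bochner_Integration.integral_cong[OF refl]) (auto simp: indicator_def)
    finally show "(I x)\<^sup>2 \<le> (b - a) * S x" .
  qed
  have ind: "?i s *\<^sub>R v s x = ?i s * (indicator {0..} s * v s x)" for s x
    using ab by (auto simp: indicator_def)
  note [measurable] = C_L2_measurable_pair[OF v]
  have [measurable]: "I \<in> borel_measurable borel"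
    unfolding I_def set_lebesgue_integral_def ind
    by (rule lborel.borel_measurable_lebesgue_integral) (simp add: split_beta')
  have int: "integrable lborel (\<lambda>x. (I x)\<^sup>2)"
  proof (rule Bochner_Integration.integrable_bound)
    show "integrable lborel (\<lambda>x. (b - a) * S x)" using S by simp
    show "AE x in lborel. norm ((I x)\<^sup>2) \<le> norm ((b - a) * S x)" using I by eventually_elim simp
  qed measurable
  then show "in_L2 (\<lambda>x. LBINT t:{a..b}. v t x)" by (simp add: in_L2_def I_def[symmetric])
  have "(L2_norm I)\<^sup>2 \<le> (LBINT x. (b - a) * S x)"
    unfolding L2_norm_sq using S by (intro integral_mono_AE int I) simp
  also have "\<dots> \<le> (b - a) * ((b - a) * \<epsilon>\<^sup>2)" using S_le ab by (simp add: mult_left_mono)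
  also have "\<dots> = ((b - a) * \<epsilon>)\<^sup>2" by (simp add: power2_eq_square)
  finally have "L2_norm I \<le> (b - a) * \<epsilon>" by (rule power2_le_imp_le) (use ab \<open>0 \<le> \<epsilon>\<close> in simp)
  then show "L2_norm (\<lambda>x. LBINT t:{a..b}. v t x) \<le> (b - a) * \<epsilon>" by (simp add: I_def)
qed

section \<open>Strong time derivatives and the energy\<close>

lemma time_primitive_in_L2:
  assumes v: "C_L2 v" and t: "0 \<le> t" shows "in_L2 (time_primitive v t)"
proof -
  obtain M where M: "0 \<le> M" "\<And>s. s \<in> {0..t} \<Longrightarrow> L2_norm (v s) \<le> M" by (rule C_L2_bounded[OF v]) (rule that)
  show ?thesis
    using C_L2_integral_bound(1)[OF v order_refl t M(2)] by (simp add: time_primitive_def[abs_def])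
qed

text \<open>For almost every x the function on the left is the integral of v - g over [a, b]. With g
  the value of the curve at a nearby time this shows that the difference quotients converge.\<close>

lemma time_primitive_increment_bound:
  assumes v: "C_L2 v" and g: "in_L2 g" and ab: "0 \<le> a" "a \<le> b"
    and le: "\<And>t. t \<in> {a..b} \<Longrightarrow> L2_norm (\<lambda>x. v t x - g x) \<le> \<epsilon>"
  shows "L2_norm (\<lambda>x. time_primitive v b x - time_primitive v a x - (b - a) * g x) \<le> (b - a) * \<epsilon>"
proof -
  let ?P = "time_primitive v"
  have d: "C_L2 (\<lambda>t x. v t x - g x)" by (intro C_L2_diff v C_L2_const g)
  note L2 = C_L2_integral_bound[OF d ab le]
  have "AE x in lborel. ?P b x - ?P a x - (b - a) * g x = (LBINT t:{a..b}. v t x - g x)"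
    using C_L2_AE_primitive_on[OF v]
  proof eventually_elim
    fix x assume P: "primitive_on {0..} (\<lambda>t. ?P t x) (\<lambda>t. v t x)"
    have i: "set_integrable lborel {a..b} (\<lambda>t. v t x)" "set_integrable lborel {a..b} (\<lambda>t. g x)"
      using primitive_on_integrable[OF P, of a b] ab by (auto intro: borel_integrable_atLeastAtMost')
    have "(LBINT t:{a..b}. g x) = (b - a) * g x" using ab by (simp add: set_lebesgue_integral_def)
    moreover have "?P b x - ?P a x = (LBINT t:{a..b}. v t x)"
      using ab by (intro primitive_on_diff[OF P]) auto
    ultimately show "?P b x - ?P a x - (b - a) * g x = (LBINT t:{a..b}. v t x - g x)"
      using set_integral_diff(2)[OF i] by simp
  qed
  then have "L2_norm (\<lambda>x. ?P b x - ?P a x - (b - a) * g x) = L2_norm (\<lambda>x. LBINT t:{a..b}. v t x - g x)"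
  proof (rule L2_norm_cong_AE)
    have "in_L2 (\<lambda>x. ?P b x - ?P a x - (b - a) * g x)"
      using ab by (intro in_L2_diff time_primitive_in_L2 v in_L2_cmult g) auto
    then show "(\<lambda>x. ?P b x - ?P a x - (b - a) * g x) \<in> borel_measurable borel"
      by (rule in_L2_measurable)
    show "(\<lambda>x. LBINT t:{a..b}. v t x - g x) \<in> borel_measurable borel"
      by (rule in_L2_measurable[OF L2(1)])
  qed
  then show ?thesis using L2(2) by simp
qed

text \<open>Differentiability in the L^2 norm on t \<ge> 0, one-sided at 0: the sense in which the
  energy is differentiated.\<close>

definition L2_deriv :: "(real \<Rightarrow> real \<Rightarrow> real) \<Rightarrow> (real \<Rightarrow> real \<Rightarrow> real) \<Rightarrow> bool" where
  "L2_deriv p p' \<longleftrightarrow> (\<forall>t\<ge>0. in_L2 (p t) \<and> in_L2 (p' t) \<and>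
     ((\<lambda>s. L2_norm (\<lambda>x. (p s x - p t x) / (s - t) - p' t x)) \<longlongrightarrow> 0) (at t within {0..}))"

lemma L2_deriv_time_primitive:
  assumes v: "C_L2 v" shows "L2_deriv (time_primitive v) v"
  unfolding L2_deriv_def
proof (intro allI impI conjI)
  let ?P = "time_primitive v"
  fix t :: real assume t: "0 \<le> t"
  show "in_L2 (?P t)" "in_L2 (v t)"
    using v t by (auto intro: time_primitive_in_L2 C_L2_in_L2)
  show "((\<lambda>s. L2_norm (\<lambda>x. (?P s x - ?P t x) / (s - t) - v t x)) \<longlongrightarrow> 0) (at t within {0..})"
  proof (rule tendstoI)
    fix \<epsilon> :: real assume "0 < \<epsilon>"
    then have "\<forall>\<^sub>F s in at t within {0..}. dist (L2_norm (\<lambda>x. v s x - v t x)) 0 < \<epsilon> / 2"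
      using C_L2_continuous[OF v t] by (intro tendstoD) auto
    then obtain d where d: "0 < d" "\<And>s. 0 \<le> s \<Longrightarrow> s \<noteq> t \<Longrightarrow> dist s t < d \<Longrightarrow> L2_norm (\<lambda>x. v s x - v t x) < \<epsilon> / 2"
      unfolding eventually_at by auto
    have d': "L2_norm (\<lambda>x. v s x - v t x) \<le> \<epsilon> / 2" if "0 \<le> s" "dist s t < d" for s
      using d(2)[of s] that \<open>0 < \<epsilon>\<close> by (cases "s = t") auto
    \<comment> \<open>Stated for two ordered times near t, one of which will be t itself, so that
      right and left difference quotients are covered at once.\<close>
    have main: "L2_norm (\<lambda>x. (?P b x - ?P a x) / (b - a) - v t x) \<le> \<epsilon> / 2"
      if ab: "0 \<le> a" "a < b" and "\<And>s. s \<in> {a..b} \<Longrightarrow> dist s t < d" for a b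
    proof -
      define q where "q = (\<lambda>x. ?P b x - ?P a x - (b - a) * v t x)"
      have "L2_norm q \<le> (b - a) * (\<epsilon> / 2)"
        unfolding q_def using that d' by (intro time_primitive_increment_bound v C_L2_in_L2[OF v t]) auto
      then have "1 / (b - a) * L2_norm q \<le> 1 / (b - a) * ((b - a) * (\<epsilon> / 2))"
        using ab by (intro mult_left_mono) auto
      moreover have "(\<lambda>x. (?P b x - ?P a x) / (b - a) - v t x) = (\<lambda>x. 1 / (b - a) * q x)"
        using ab by (auto simp: q_def field_simps)
      moreover have "L2_norm (\<lambda>x. 1 / (b - a) * q x) = 1 / (b - a) * L2_norm q"
        using ab by (subst L2_norm_cmult) simp
      ultimately show ?thesis using ab by simp
    qed
    have "L2_norm (\<lambda>x. (?P s x - ?P t x) / (s - t) - v t x) \<le> \<epsilon> / 2"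
      if s: "0 \<le> s" "s \<noteq> t" "dist s t < d" for s
    proof (cases "t < s")
      case True
      then show ?thesis using s t by (intro main) (auto simp: dist_real_def)
    next
      case False
      have "(?P s x - ?P t x) / (s - t) = (?P t x - ?P s x) / (t - s)" for x
        by (metis minus_diff_eq minus_divide_divide)
      moreover have "L2_norm (\<lambda>x. (?P t x - ?P s x) / (t - s) - v t x) \<le> \<epsilon> / 2"
        using s t False by (intro main) (auto simp: dist_real_def)
      ultimately show ?thesis by simp
    qed
    then show "\<forall>\<^sub>F s in at t within {0..}. dist (L2_norm (\<lambda>x. (?P s x - ?P t x) / (s - t) - v t x)) 0 < \<epsilon>"
      unfolding eventually_at using d(1) \<open>0 < \<epsilon>\<close> by (intro exI[of _ d]) fastforce
  qed
qed

lemma L2_deriv_continuous: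
  assumes p: "L2_deriv p p'" and t: "0 \<le> t"
  shows "((\<lambda>s. L2_norm (\<lambda>x. p s x - p t x)) \<longlongrightarrow> 0) (at t within {0..})"
proof (rule tendsto_zero_comparison)
  have p': "in_L2 (p' t)" using p t by (simp add: L2_deriv_def)
  fix s :: real assume s: "s \<noteq> t" "s \<in> {0..}"
  then have "in_L2 (\<lambda>x. p s x - p t x)" using p t by (intro in_L2_diff) (auto simp: L2_deriv_def)
  then have "in_L2 (\<lambda>x. (p s x - p t x) / (s - t))" using in_L2_cmult[of _ "1 / (s - t)"] by simp
  from L2_norm_le_add_diff[OF this p']
  have "\<bar>s - t\<bar> * L2_norm (\<lambda>x. (p s x - p t x) / (s - t)) \<le> \<bar>s - t\<bar> * (L2_norm (p' t) + L2_norm (\<lambda>x. (p s x - p t x) / (s - t) - p' t x))"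
    by (intro mult_left_mono) auto
  moreover have "\<bar>s - t\<bar> * L2_norm (\<lambda>x. (p s x - p t x) / (s - t)) = L2_norm (\<lambda>x. (s - t) * ((p s x - p t x) / (s - t)))"
    by (rule L2_norm_cmult[symmetric])
  ultimately show "norm (L2_norm (\<lambda>x. p s x - p t x)) \<le> \<bar>s - t\<bar> * (L2_norm (p' t) + L2_norm (\<lambda>x. (p s x - p t x) / (s - t) - p' t x))"
    using s by simp
next
  have "((\<lambda>s. \<bar>s - t\<bar> * (L2_norm (p' t) + L2_norm (\<lambda>x. (p s x - p t x) / (s - t) - p' t x))) \<longlongrightarrow> \<bar>t - t\<bar> * (L2_norm (p' t) + 0)) (at t within {0..})"
    using p t by (intro tendsto_intros) (auto simp: L2_deriv_def)
  then show "((\<lambda>s. \<bar>s - t\<bar> * (L2_norm (p' t) + L2_norm (\<lambda>x. (p s x - p t x) / (s - t) - p' t x))) \<longlongrightarrow> 0) (at t within {0..})"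
    by simp
qed

lemma C_L2_time_primitive:
  assumes v: "C_L2 v" shows "C_L2 (time_primitive v)"
  unfolding C_L2_def
proof (intro conjI allI impI)
  have "{0..} \<times> UNIV \<in> sets (borel :: (real \<times> real) measure)"
    by (intro borel_closed closed_Times) auto
  then show "set_borel_measurable lborel ({0..} \<times> UNIV) (\<lambda>p. time_primitive v (fst p) (snd p))"
    unfolding set_borel_measurable_def using time_primitive_measurable[OF v]
    by (simp add: borel_measurable_indicator borel_measurable_times)
qed (use v in \<open>auto intro: time_primitive_in_L2 L2_deriv_continuous L2_deriv_time_primitive\<close>)

text \<open>With q the increment and r the remainder of the difference quotient, the quotient of the
  squares is (r + p') (q + 2 p) = r (q + 2 p) + p' q + 2 p p', where p and p' are taken at t. The
  first two terms tend to 0 by Cauchy-Schwarz, as the weight is bounded.\<close>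

lemma L2_deriv_weighted_square:
  assumes p: "L2_deriv p p'" and [measurable]: "k \<in> borel_measurable borel"
    and M: "AE x in lborel. \<bar>k x\<bar> \<le> M" "0 \<le> M" and t: "0 \<le> t"
  shows "((\<lambda>s. LBINT x. k x * (p s x)\<^sup>2) has_real_derivative 2 * (LBINT x. k x * (p t x * p' t x))) (at t within {0..})"
  unfolding has_field_derivative_iff
proof -
  have L2: "in_L2 (p s)" "in_L2 (p' s)" if "0 \<le> s" for s using p that by (auto simp: L2_deriv_def)
  have k: "in_L2 (\<lambda>x. k x * u x)" "L2_norm (\<lambda>x. k x * u x) \<le> M * L2_norm u" if "in_L2 u" for u
    using in_L2_bounded_mult[OF that _ M(1)] L2_norm_bounded_mult_le[OF that M(2,1)] by auto
  have ki: "integrable lborel (\<lambda>x. k x * (u x * v x))" if "in_L2 u" "in_L2 v" for u v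
    using in_L2_mult_integrable[OF k(1)[OF that(1)] that(2)] by (simp add: mult.assoc)
  have kb: "\<bar>LBINT x. k x * (u x * v x)\<bar> \<le> M * L2_norm u * L2_norm v" if "in_L2 u" "in_L2 v" for u v
  proof -
    have "\<bar>LBINT x. (k x * u x) * v x\<bar> \<le> L2_norm (\<lambda>x. k x * u x) * L2_norm v"
      by (rule L2_Cauchy_Schwarz[OF k(1)[OF that(1)] that(2)])
    also have "\<dots> \<le> M * L2_norm u * L2_norm v" using k(2)[OF that(1)] by (intro mult_right_mono) auto
    finally show ?thesis by (simp add: mult.assoc)
  qed
  define r where "r = (\<lambda>s x. (p s x - p t x) / (s - t) - p' t x)"
  define q where "q = (\<lambda>s x. p s x - p t x)"
  have r0: "((\<lambda>s. L2_norm (r s)) \<longlongrightarrow> 0) (at t within {0..})"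
    using p t unfolding L2_deriv_def r_def by simp
  have q0: "((\<lambda>s. L2_norm (q s)) \<longlongrightarrow> 0) (at t within {0..})"
    unfolding q_def by (rule L2_deriv_continuous[OF p t])
  let ?B = "LBINT x. k x * (p t x * p' t x)"
  let ?E = "\<lambda>s. M * L2_norm (r s) * (L2_norm (q s) + 2 * L2_norm (p t)) + M * L2_norm (p' t) * L2_norm (q s)"
  let ?D = "\<lambda>s. ((LBINT x. k x * (p s x)\<^sup>2) - (LBINT x. k x * (p t x)\<^sup>2)) / (s - t)"
  have "((\<lambda>s. ?D s - 2 * ?B) \<longlongrightarrow> 0) (at t within {0..})"
  proof (rule tendsto_zero_comparison)
    fix s :: real assume s: "s \<noteq> t" "s \<in> {0..}"
    have q: "in_L2 (q s)" unfolding q_def using s t by (intro in_L2_diff L2) auto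
    then have "in_L2 (\<lambda>x. q s x / (s - t))" using in_L2_cmult[of _ "1 / (s - t)"] by simp
    then have r: "in_L2 (r s)" unfolding r_def q_def using t by (intro in_L2_diff L2)
    have sum: "in_L2 (\<lambda>x. q s x + 2 * p t x)" using t by (intro in_L2_add q in_L2_cmult L2)
    have pt: "in_L2 (p t)" "in_L2 (p' t)" "in_L2 (p s)" using L2 t s by auto
    have "?D s = (LBINT x. k x * (p s x)\<^sup>2 - k x * (p t x)\<^sup>2) / (s - t)"
      using ki[OF pt(1,1)] ki[OF pt(3,3)] by (simp add: power2_eq_square)
    also have "\<dots> = (LBINT x. (k x * (p s x)\<^sup>2 - k x * (p t x)\<^sup>2) / (s - t))"
      by simp
    also have "(\<lambda>x. (k x * (p s x)\<^sup>2 - k x * (p t x)\<^sup>2) / (s - t)) =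
      (\<lambda>x. k x * (r s x * (q s x + 2 * p t x)) + k x * (p' t x * q s x) + 2 * (k x * (p t x * p' t x)))"
      using s by (auto simp: r_def q_def fun_eq_iff field_simps power2_eq_square)
    also have "(LBINT x. k x * (r s x * (q s x + 2 * p t x)) + k x * (p' t x * q s x) + 2 * (k x * (p t x * p' t x))) =
      (LBINT x. k x * (r s x * (q s x + 2 * p t x))) + (LBINT x. k x * (p' t x * q s x)) + 2 * ?B"
      using ki[OF r sum] ki[OF pt(2) q] ki[OF pt(1,2)] by simp
    finally have "\<bar>?D s - 2 * ?B\<bar> \<le>
      \<bar>LBINT x. k x * (r s x * (q s x + 2 * p t x))\<bar> + \<bar>LBINT x. k x * (p' t x * q s x)\<bar>"
      by (simp only:)
    also have "\<dots> \<le> M * L2_norm (r s) * L2_norm (\<lambda>x. q s x + 2 * p t x) + M * L2_norm (p' t) * L2_norm (q s)"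
      by (intro add_mono kb r sum pt q)
    also have "\<dots> \<le> ?E s"
      using L2_norm_add_le[OF q in_L2_cmult[OF pt(1), of 2]] M(2)
      by (intro add_mono mult_left_mono order_refl) (auto simp: L2_norm_cmult)
    finally show "norm (?D s - 2 * ?B) \<le>
      ?E s" by simp
  next
    have "(?E \<longlongrightarrow>
      M * 0 * (0 + 2 * L2_norm (p t)) + M * L2_norm (p' t) * 0) (at t within {0..})"
      by (intro tendsto_intros r0 q0)
    then show "(?E \<longlongrightarrow> 0) (at t within {0..})"
      by simp
  qed
  then show "(?D \<longlongrightarrow> 2 * ?B) (at t within {0..})"
    by (simp add: LIM_zero_iff)
qed

text \<open>The energy identity for \<open>\<partial>\<^sub>t p = \<partial>\<^sub>x (h w)\<close>, \<open>\<partial>\<^sub>t w = \<partial>\<^sub>x p\<close>: the time derivative of the energy is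
  twice the integral of \<open>\<partial>\<^sub>x (p h w)\<close>.\<close>

lemma energy_conserved:
  assumes p: "L2_deriv p p'" and w: "L2_deriv w w'"
    and px: "\<And>t. 0 \<le> t \<Longrightarrow> in_H1 (p t) (w' t)" and wx: "\<And>t. 0 \<le> t \<Longrightarrow> in_H1 (\<lambda>x. h x * w t x) (p' t)"
    and h: "h \<in> borel_measurable borel" "AE x in lborel. \<bar>h x\<bar> \<le> M" "0 \<le> M" and t: "0 \<le> t"
  shows "(LBINT x. (p t x)\<^sup>2) + (LBINT x. h x * (w t x)\<^sup>2) =
    (LBINT x. (p 0 x)\<^sup>2) + (LBINT x. h x * (w 0 x)\<^sup>2)"
proof -
  define E where "E = (\<lambda>t. (LBINT x. (p t x)\<^sup>2) + (LBINT x. h x * (w t x)\<^sup>2))"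
  have "(E has_real_derivative 0) (at s within {0..})" if s: "0 \<le> s" for s
  proof -
    have "((\<lambda>t. (LBINT x. 1 * (p t x)\<^sup>2) + (LBINT x. h x * (w t x)\<^sup>2)) has_real_derivative
      2 * (LBINT x. 1 * (p s x * p' s x)) + 2 * (LBINT x. h x * (w s x * w' s x))) (at s within {0..})"
      by (intro DERIV_add L2_deriv_weighted_square[OF p _ _ _ s, where M=1] L2_deriv_weighted_square[OF w h s]) auto
    \<comment> \<open>The two contributions cancel: \<open>w'\<close> is the weak X-derivative of
      \<open>p\<close>, and \<open>p'\<close> is that of \<open>h w\<close>.\<close>
    moreover have "(LBINT x. p s x * p' s x) = - (LBINT x. h x * (w s x * w' s x))"
      using H1_by_parts[OF px[OF s] wx[OF s]] by (simp add: algebra_simps)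
    ultimately show ?thesis by (simp add: E_def)
  qed
  then have "E t = E 0"
    using t has_field_derivative_zero_constant[of "{0..}" E] by (metis atLeast_iff convex_real_interval(1) order_refl)
  then show ?thesis by (simp add: E_def)
qed

lemma C_L2_mult_time:
  assumes c: "continuous_on UNIV c" and v: "C_L2 v" shows "C_L2 (\<lambda>t x. c t * v t x)"
  unfolding C_L2_def
proof (intro conjI allI impI)
  have "(\<lambda>p::real\<times>real. c (fst p) * (indicator ({0..} \<times> UNIV) p *\<^sub>R v (fst p) (snd p))) \<in> borel_measurable borel"
  proof (rule borel_measurable_times)
    show "(\<lambda>p::real\<times>real. c (fst p)) \<in> borel_measurable borel"
      by (intro borel_measurable_continuous_onI continuous_on_compose2[OF c] continuous_intros) auto
    show "(\<lambda>p::real\<times>real. indicator ({0..} \<times> UNIV) p *\<^sub>R v (fst p) (snd p)) \<in> borel_measurable borel"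
      using v by (simp add: C_L2_def set_borel_measurable_def)
  qed
  then show "set_borel_measurable lborel ({0..} \<times> UNIV) (\<lambda>p. c (fst p) * v (fst p) (snd p))"
    by (simp add: set_borel_measurable_def ac_simps)
  show "in_L2 (\<lambda>x. c t * v t x)" if "0 \<le> t" for t using that v by (intro in_L2_cmult C_L2_in_L2)
  fix t :: real assume t: "0 \<le> t"
  show "((\<lambda>s. L2_norm (\<lambda>x. c s * v s x - c t * v t x)) \<longlongrightarrow> 0) (at t within {0..})"
  proof (rule tendsto_zero_comparison)
    fix s :: real assume s: "s \<noteq> t" "s \<in> {0..}"
    have L2: "in_L2 (v s)" "in_L2 (v t)" using v s t by (auto intro: C_L2_in_L2)
    have "(\<lambda>x. c s * v s x - c t * v t x) = (\<lambda>x. c s * (v s x - v t x) + (c s - c t) * v t x)" by (auto simp: algebra_simps)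
    then show "norm (L2_norm (\<lambda>x. c s * v s x - c t * v t x)) \<le> \<bar>c s\<bar> * L2_norm (\<lambda>x. v s x - v t x) + \<bar>c s - c t\<bar> * L2_norm (v t)"
      using L2_norm_add_le[OF in_L2_cmult[OF in_L2_diff[OF L2], of "c s"] in_L2_cmult[OF L2(2), of "c s - c t"]]
      by (simp add: L2_norm_cmult)
  next
    have "(c \<longlongrightarrow> c t) (at t within {0..})"
      using continuous_on_subset[OF c, of "{0..}"] t by (simp add: continuous_on_def)
    then have "((\<lambda>s. \<bar>c s\<bar> * L2_norm (\<lambda>x. v s x - v t x) + \<bar>c s - c t\<bar> * L2_norm (v t)) \<longlongrightarrow> \<bar>c t\<bar> * 0 + \<bar>c t - c t\<bar> * L2_norm (v t)) (at t within {0..})"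
      by (intro tendsto_intros C_L2_continuous[OF v t])
    then show "((\<lambda>s. \<bar>c s\<bar> * L2_norm (\<lambda>x. v s x - v t x) + \<bar>c s - c t\<bar> * L2_norm (v t)) \<longlongrightarrow> 0) (at t within {0..})" by simp
  qed
qed

lemma L2_deriv_const_diff:
  assumes p: "L2_deriv p p'" and g: "in_L2 g"
  shows "L2_deriv (\<lambda>t x. g x - p t x) (\<lambda>t x. - p' t x)"
  unfolding L2_deriv_def
proof (intro allI impI conjI)
  fix t :: real assume t: "0 \<le> t"
  show "in_L2 (\<lambda>x. g x - p t x)" "in_L2 (\<lambda>x. - p' t x)"
    using p g t by (auto intro: in_L2_diff in_L2_minus simp: L2_deriv_def)
  have "(\<lambda>x. (g x - p s x - (g x - p t x)) / (s - t) - - p' t x) = (\<lambda>x. - ((p s x - p t x) / (s - t) - p' t x))" for s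
    by (auto simp: diff_divide_distrib)
  then show "((\<lambda>s. L2_norm (\<lambda>x. (g x - p s x - (g x - p t x)) / (s - t) - - p' t x)) \<longlongrightarrow> 0) (at t within {0..})"
    using p t by (simp only: L2_norm_minus) (simp add: L2_deriv_def)
qed

text \<open>The coefficients of the system do not depend on time, so increments over a fixed step
  solve it again; this supplies their strong differentiability.\<close>

lemma L2_deriv_increment:
  assumes p: "L2_deriv p p'" and d: "0 \<le> d"
  shows "L2_deriv (\<lambda>t x. p (t + d) x - p t x) (\<lambda>t x. p' (t + d) x - p' t x)"
  unfolding L2_deriv_def
proof (intro allI impI conjI)
  have L2: "in_L2 (p t)" "in_L2 (p' t)" if "0 \<le> t" for t using p that by (auto simp: L2_deriv_def)
  fix t :: real assume t: "0 \<le> t"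
  show "in_L2 (\<lambda>x. p (t + d) x - p t x)" "in_L2 (\<lambda>x. p' (t + d) x - p' t x)"
    using t d by (auto intro!: in_L2_diff L2)
  define r where "r = (\<lambda>t s x. (p s x - p t x) / (s - t) - p' t x)"
  have r0: "((\<lambda>s. L2_norm (r t s)) \<longlongrightarrow> 0) (at t within {0..})" if "0 \<le> t" for t
    using p that unfolding L2_deriv_def r_def by simp
  have "filterlim (\<lambda>s. s + d) (at (t + d) within {0..}) (at t within {0..})"
    unfolding filterlim_at using d by (auto simp: eventually_at_filter intro!: tendsto_intros)
  then have rd: "((\<lambda>s. L2_norm (r (t + d) (s + d))) \<longlongrightarrow> 0) (at t within {0..})"
    using r0[of "t + d"] t d by (auto intro: filterlim_compose)
  show "((\<lambda>s. L2_norm (\<lambda>x. (p (s + d) x - p s x - (p (t + d) x - p t x)) / (s - t) - (p' (t + d) x - p' t x))) \<longlongrightarrow> 0) (at t within {0..})"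
  proof (rule tendsto_zero_comparison)
    show "((\<lambda>s. L2_norm (r (t + d) (s + d)) + L2_norm (r t s)) \<longlongrightarrow> 0) (at t within {0..})"
      using tendsto_add[OF rd r0[OF t]] by simp
    have rL2: "in_L2 (r t s)" if "0 \<le> t" "0 \<le> s" for t s
    proof -
      have "in_L2 (\<lambda>x. 1 / (s - t) * (p s x - p t x))" using that by (intro in_L2_cmult in_L2_diff L2)
      then show ?thesis unfolding r_def using that by (intro in_L2_diff L2) auto
    qed
    fix s :: real assume s: "s \<noteq> t" "s \<in> {0..}"
    have "(\<lambda>x. (p (s + d) x - p s x - (p (t + d) x - p t x)) / (s - t) - (p' (t + d) x - p' t x)) = (\<lambda>x. r (t + d) (s + d) x - r t s x)"
      by (auto simp: r_def diff_divide_distrib)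
    then show "norm (L2_norm (\<lambda>x. (p (s + d) x - p s x - (p (t + d) x - p t x)) / (s - t) - (p' (t + d) x - p' t x))) \<le> L2_norm (r (t + d) (s + d)) + L2_norm (r t s)"
      using L2_norm_diff_le[OF rL2[of "t + d" "s + d"] rL2[of t s]] s t d by simp
  qed
qed

section \<open>Weak equations in time\<close>

text \<open>Fubini, with the kernel that equals \<open>g\<close> for times in [0, t] and vanishes
  otherwise.\<close>

lemma time_primitive_pairing:
  assumes v: "C_L2 v" and g: "in_L2 g" and t: "0 \<le> t"
  shows "(LBINT x. time_primitive v t x * g x) = (LBINT s:{0..t}. LBINT x. v s x * g x)"
proof -
  define w where "w = (\<lambda>p::real\<times>real. indicator {0..t} (fst p) * g (snd p))"
  have w: "time_kernel w"
    unfolding time_kernel_def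
  proof (intro conjI exI[of _ t] exI[of _ "\<lambda>x. \<bar>g x\<bar>"] allI in_L2_abs g)
    note [measurable] = in_L2_measurable[OF g]
    show "w \<in> borel_measurable borel" unfolding w_def borel_prod[symmetric] by measurable
  qed (simp add: w_def abs_mult)
  have "(LBINT x. time_primitive v t x * g x) = (LBINT x. LBINT s. v s x * w (s, x))"
  proof (rule Bochner_Integration.integral_cong[OF refl])
    fix x
    have "time_primitive v t x * g x = (LBINT s. (indicator {0..t} s *\<^sub>R v s x) * g x)"
      unfolding time_primitive_def set_lebesgue_integral_def by simp
    then show "time_primitive v t x * g x = (LBINT s. v s x * w (s, x))"
      by (simp add: w_def ac_simps)
  qed
  also have "\<dots> = (LBINT s. LBINT x. v s x * w (s, x))"
    using time_kernel_integral_t[OF v w] time_kernel_integral_x[OF v w] by simp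
  also have "\<dots> = (LBINT s:{0..t}. LBINT x. v s x * g x)"
    unfolding set_lebesgue_integral_def
  proof (rule Bochner_Integration.integral_cong[OF refl])
    fix s
    have "(LBINT x. v s x * w (s, x)) = (LBINT x. indicator {0..t} s * (v s x * g x))"
      by (simp add: w_def ac_simps)
    then show "(LBINT x. v s x * w (s, x)) = indicator {0..t} s *\<^sub>R (LBINT x. v s x * g x)" by simp
  qed
  finally show ?thesis .
qed

text \<open>Fubini; the support of \<open>\<theta>\<close> in positive times keeps the kernel away
  from the times at which the curve is arbitrary.\<close>

lemma tensor_pairing:
  assumes v: "C_L2 v" and g: "in_L2 g" and \<theta>: "test_fun {0<..} \<theta>"
  shows "(LBINT p. v (fst p) (snd p) * (\<theta> (fst p) * g (snd p))) = (LBINT t. (LBINT x. v t x * g x) * \<theta> t)"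
proof -
  obtain B where B: "0 \<le> B" "\<And>t. \<bar>\<theta> t\<bar> \<le> B" by (rule test_fun_bounded[OF \<theta>]) (rule that)
  obtain a b where ab: "a \<le> b" "{a..b} \<subseteq> {0<..}" "\<And>t. \<theta> t \<noteq> 0 \<Longrightarrow> t \<in> {a..b}"
    by (rule test_fun_real_support[OF \<theta>]) (auto simp: is_interval_1 intro: that)
  have w: "time_kernel (\<lambda>p. \<theta> (fst p) * g (snd p))"
    unfolding time_kernel_def
  proof (intro conjI exI[of _ b] exI[of _ "\<lambda>x. B * \<bar>g x\<bar>"] allI in_L2_cmult in_L2_abs g)
    note [measurable] = in_L2_measurable[OF g] test_fun_measurable[OF \<theta>]
    show "(\<lambda>p. \<theta> (fst p) * g (snd p)) \<in> borel_measurable borel" unfolding borel_prod[symmetric] by measurable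
    fix t x
    have "\<bar>\<theta> t\<bar> \<le> indicator {0..b} t * B"
    proof (cases "\<theta> t = 0")
      case False
      then have "t \<in> {0..b}" using ab(2) ab(3)[of t] by auto
      then show ?thesis using B by simp
    qed (use B in simp)
    then show "\<bar>\<theta> (fst (t, x)) * g (snd (t, x))\<bar> \<le> indicator {0..b} t * (B * \<bar>g x\<bar>)"
      using mult_right_mono[of "\<bar>\<theta> t\<bar>" "indicator {0..b} t * B" "\<bar>g x\<bar>"] by (simp add: abs_mult mult.assoc)
  qed
  show ?thesis
    unfolding time_kernel_integral_t[OF v w]
  proof (rule Bochner_Integration.integral_cong[OF refl])
    fix t
    have "(LBINT x. v t x * (\<theta> (fst (t, x)) * g (snd (t, x)))) = (LBINT x. (v t x * g x) * \<theta> t)"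
      by (simp add: ac_simps)
    then show "(LBINT x. v t x * (\<theta> (fst (t, x)) * g (snd (t, x)))) = (LBINT x. v t x * g x) * \<theta> t" by simp
  qed
qed

text \<open>Test functions on t > 0 determine \<open>a\<close> there up to a constant. Continuity up
  to 0 identifies this constant, which is how the initial value enters.\<close>

lemma continuous_weak_time_derivative:
  fixes a c :: "real \<Rightarrow> real"
  assumes a: "continuous_on {0..} a" and c: "continuous_on {0..} c"
    and weak: "\<And>\<theta>. test_fun {0<..} \<theta> \<Longrightarrow> (LBINT t. a t * deriv \<theta> t) = - (LBINT t. c t * \<theta> t)"
    and t: "0 \<le> t"
  shows "a t = a 0 + (LBINT s:{0..t}. c s)"
proof -
  define U where "U = (\<lambda>t. time_primitive (\<lambda>t x. c t) t 0)"
  have ci: "set_integrable lborel {0..b} c" for b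
    by (intro borel_integrable_atLeastAtMost' continuous_on_subset[OF c]) auto
  have U: "primitive_on {0..} U c" unfolding U_def by (rule time_primitive_primitive_on[OF ci])
  then have U': "primitive_on {0<..} U c" by (rule primitive_on_subset) auto
  have ai: "set_integrable lborel {x..y} a" if "{x..y} \<subseteq> {0<..}" for x y
    using that by (intro borel_integrable_atLeastAtMost' continuous_on_subset[OF a]) auto
  obtain k where k: "\<And>x y. {x..y} \<subseteq> {0<..} \<Longrightarrow> set_integrable lborel {x..y} (\<lambda>x. a x - U x - k)"
    "\<And>x y. {x..y} \<subseteq> {0<..} \<Longrightarrow> (LBINT x:{x..y}. a x - U x - k) = 0"
    by (rule du_Bois_Reymond[OF open_greaterThan _ _ U' ai weak]) (auto simp: is_interval_1 intro: that)
  have Uc: "continuous_on {0..b} U" for b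
    using primitive_on_continuous[OF primitive_on_subset[OF U, of "{0..b}"]] by auto
  define D where "D = (\<lambda>x. a x - U x - k)"
  have Dc: "continuous_on {0..b} D" for b
    unfolding D_def by (intro continuous_intros Uc continuous_on_subset[OF a]) auto
  have D0: "D s = 0" if s: "0 < s" for s
  proof -
    \<comment> \<open>All integrals of the continuous \<open>D\<close> starting at s / 2 vanish,
      hence so does their derivative in the upper limit, which is \<open>D s\<close>.\<close>
    have "integral {s / 2..y} D = 0" for y
    proof -
      have "{s / 2..y} \<subseteq> {0<..}" using s by auto
      from k(2)[OF this] set_borel_integral_eq_integral(2)[OF k(1)[OF this]] show ?thesis by (simp add: D_def[abs_def])
    qed
    moreover have "((\<lambda>y. integral {s / 2..y} D) has_real_derivative D s) (at s within {s / 2..s + 1})"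
      using s by (intro integral_has_real_derivative continuous_on_subset[OF Dc[of "s + 1"]]) auto
    moreover have "at s within {s / 2..s + 1} = at s" using s by (intro at_within_Icc_at) auto
    ultimately have "((\<lambda>y. 0) has_real_derivative D s) (at s)" by simp
    then show ?thesis using DERIV_const DERIV_unique by blast
  qed
  have "D 0 = 0"
  proof -
    have "(D \<longlongrightarrow> D 0) (at 0 within {0..1})" using Dc[of 1] by (auto simp: continuous_on_def)
    moreover have "(D \<longlongrightarrow> 0) (at 0 within {0..1})"
      by (rule tendsto_eventually) (use D0 in \<open>auto simp: eventually_at_filter\<close>)
    moreover have "at 0 within {0..1::real} \<noteq> bot"
      by (simp add: at_within_Icc_at_right)
    ultimately show ?thesis using tendsto_unique by blast
  qed
  then have "D t = D 0" using D0 t by (cases "t = 0") auto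
  moreover have "U t = (LBINT s:{0..t}. c s)" "U 0 = 0"
    by (simp_all add: U_def) (simp add: time_primitive_def)
  ultimately show ?thesis by (simp add: D_def)
qed

lemma weak_time_derivative:
  assumes u: "C_L2 u" and v: "C_L2 v" and g: "in_L2 g" "in_L2 g'"
    and weak: "\<And>\<theta>. test_fun {0<..} \<theta> \<Longrightarrow>
      (LBINT p. u (fst p) (snd p) * (deriv \<theta> (fst p) * g (snd p))) = - (LBINT p. v (fst p) (snd p) * (\<theta> (fst p) * g' (snd p)))"
    and t: "0 \<le> t"
  shows "(LBINT x. u t x * g x) = (LBINT x. u 0 x * g x) + (LBINT s:{0..t}. LBINT x. v s x * g' x)"
proof (rule continuous_weak_time_derivative[OF _ _ _ t])
  fix \<theta> :: "real \<Rightarrow> real" assume \<theta>: "test_fun {0<..} \<theta>"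
  show "(LBINT t. (LBINT x. u t x * g x) * deriv \<theta> t) = - (LBINT t. (LBINT x. v t x * g' x) * \<theta> t)"
    using weak[OF \<theta>] tensor_pairing[OF u g(1) test_fun_deriv[OF \<theta>]] tensor_pairing[OF v g(2) \<theta>] by simp
qed (intro C_L2_pairing_continuous u v g)+

text \<open>Bounded support of \<open>\<phi>\<close> makes local square integrability of
  \<open>k\<close> enough; this admits the constant 1 and the depth, neither of which is in
  L^2.\<close>

lemma time_kernel_mult_test_fun:
  assumes k: "k \<in> borel_measurable borel" "\<And>R. in_L2 (\<lambda>x. indicator {-R..R} x * k x)"
    and \<phi>: "test_fun half_plane \<phi>"
  shows "time_kernel (\<lambda>p. k (snd p) * \<phi> p)"
proof -
  obtain B where B: "0 \<le> B" "\<And>p. \<bar>\<phi> p\<bar> \<le> B" by (rule test_fun_bounded[OF \<phi>]) (rule that)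
  obtain T R where TR: "0 < T" "0 < R" "\<And>t x. \<phi> (t, x) \<noteq> 0 \<Longrightarrow> t \<in> {0<..T} \<and> x \<in> {-R..R}"
    by (rule test_fun_half_plane_support[OF \<phi>]) (rule that)
  show ?thesis
    unfolding time_kernel_def
  proof (intro conjI exI[of _ T] exI[of _ "\<lambda>x. B * \<bar>indicator {-R..R} x * k x\<bar>"] allI in_L2_cmult in_L2_abs k(2))
    have "(\<lambda>p::real\<times>real. k (snd p)) \<in> borel_measurable borel"
      unfolding borel_prod[symmetric] using k(1) by measurable
    then show "(\<lambda>p. k (snd p) * \<phi> p) \<in> borel_measurable borel" using test_fun_measurable[OF \<phi>] by simp
    fix t x
    show "\<bar>k (snd (t, x)) * \<phi> (t, x)\<bar> \<le> indicator {0..T} t * (B * \<bar>indicator {-R..R} x * k x\<bar>)"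
    proof (cases "\<phi> (t, x) = 0")
      case False
      then have "t \<in> {0..T}" "x \<in> {-R..R}" using TR(3)[OF False] by auto
      then show ?thesis using mult_right_mono[OF B(2)[of "(t, x)"], of "\<bar>k x\<bar>"] by (simp add: abs_mult mult.commute)
    qed (use B in simp)
  qed
qed

text \<open>For almost every x this is integration by parts in time against the section of
  \<open>\<phi>\<close>, whose support in t > 0 leaves no boundary terms; Fubini then integrates in
  x.\<close>

lemma time_by_parts:
  assumes v: "C_L2 v" and k: "k \<in> borel_measurable borel" "\<And>R. in_L2 (\<lambda>x. indicator {-R..R} x * k x)"
    and \<phi>: "test_fun half_plane \<phi>"
  shows "(LBINT p. v (fst p) (snd p) * (k (snd p) * \<phi> p)) =
    - (LBINT p. time_primitive v (fst p) (snd p) * (k (snd p) * dir_deriv (1, 0) \<phi> p))"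
proof -
  let ?P = "time_primitive v"
  note K = time_kernel_mult_test_fun[OF k \<phi>] time_kernel_mult_test_fun[OF k test_fun_dir_deriv[OF \<phi>, of "(1, 0)"]]
  note P = C_L2_time_primitive[OF v]
  \<comment> \<open>The inner integrals must be measurable in x for an identity that holds almost
    everywhere to be integrated.\<close>
  have m: "(\<lambda>x. LBINT t. u t x * w (t, x)) \<in> borel_measurable lborel" if "C_L2 u" "time_kernel w" for u w
  proof -
    have "integrable (lborel \<Otimes>\<^sub>M lborel) (\<lambda>(t, x). u t x * w (t, x))"
      using time_kernel_integrable[OF that] by (simp add: split_beta')
    from lborel_pair.integrable_snd[OF this] show ?thesis by (rule borel_measurable_integrable)
  qed
  have "(LBINT x. LBINT t. v t x * (k (snd (t, x)) * \<phi> (t, x))) =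
    (LBINT x. - (LBINT t. ?P t x * (k (snd (t, x)) * dir_deriv (1, 0) \<phi> (t, x))))"
  proof (rule integral_cong_AE)
    show "AE x in lborel. (LBINT t. v t x * (k (snd (t, x)) * \<phi> (t, x))) =
      - (LBINT t. ?P t x * (k (snd (t, x)) * dir_deriv (1, 0) \<phi> (t, x)))"
      using C_L2_AE_primitive_on[OF v]
    proof eventually_elim
      fix x assume "primitive_on {0..} (\<lambda>t. ?P t x) (\<lambda>t. v t x)"
      then have "primitive_on {0<..} (\<lambda>t. ?P t x) (\<lambda>t. v t x)" by (rule primitive_on_subset) auto
      from primitive_on_test_fun[OF this _ _ test_fun_half_plane_section_t(1)[OF \<phi>]]
      have "(LBINT t. ?P t x * dir_deriv (1, 0) \<phi> (t, x)) = - (LBINT t. v t x * \<phi> (t, x))"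
        by (simp add: test_fun_half_plane_section_t(2)[OF \<phi>] is_interval_1)
      then have "k x * (LBINT t. v t x * \<phi> (t, x)) = - (k x * (LBINT t. ?P t x * dir_deriv (1, 0) \<phi> (t, x)))"
        by simp
      then have "(LBINT t. k x * (v t x * \<phi> (t, x))) = - (LBINT t. k x * (?P t x * dir_deriv (1, 0) \<phi> (t, x)))"
        by simp
      then show "(LBINT t. v t x * (k (snd (t, x)) * \<phi> (t, x))) =
      - (LBINT t. ?P t x * (k (snd (t, x)) * dir_deriv (1, 0) \<phi> (t, x)))"
        by (simp only: snd_conv mult.left_commute)
    qed
  qed (use m[OF v K(1)] m[OF P K(2)] in auto)
  then show ?thesis
    using time_kernel_integral_x[OF v K(1)] time_kernel_integral_x[OF P K(2)] by simp
qed

section \<open>The first-order system\<close>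

text \<open>The bound \<open>M\<close> makes multiplication by \<open>h\<close> bounded on L^2, and
  \<open>m\<close> makes the energy coercive.\<close>

locale first_order_system =
  fixes h h' f f' :: "real \<Rightarrow> real" and \<zeta> V :: "real \<Rightarrow> real \<Rightarrow> real" and M m :: real
  assumes h_measurable: "h \<in> borel_measurable borel" and h'_L2: "in_L2 h'" and h_weak: "weak_deriv h h'"
    and h_upper: "AE x in lborel. \<bar>h x\<bar> \<le> M" and M_pos: "0 \<le> M"
    and h_lower: "AE x in lborel. m \<le> h x" and m_pos: "0 < m"
    and f_H1: "in_H1 f f'"
    and solution: "first_order_solution h (\<lambda>x. 0) f' \<zeta> V"
begin

lemma C_L2: "C_L2 \<zeta>" "C_L2 V"
  using solution by (auto simp: first_order_solution_def)

lemma f_L2: "in_L2 f" "in_L2 f'"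
  using f_H1 by (auto simp: in_H1_def)

lemma initial: "AE x in lborel. \<zeta> 0 x = 0" "AE x in lborel. V 0 x = f' x"
  using solution by (auto simp: first_order_solution_def)

lemma h_mult_L2: "in_L2 u \<Longrightarrow> in_L2 (\<lambda>x. h x * u x)"
  by (rule in_L2_bounded_mult[OF _ h_measurable h_upper])

lemma h_local_L2: "in_L2 (\<lambda>x. indicator {-R..R} x * h x)"
  using h_mult_L2[OF in_L2_indicator[of "-R" R]] by (simp add: mult.commute)

lemma h'_local_L2: "in_L2 (\<lambda>x. indicator {-R..R} x * h' x)"
  by (rule in_L2_bound[OF h'_L2]) (auto simp: indicator_def intro!: borel_measurable_times in_L2_measurable[OF h'_L2])

lemma mass_equation:
  assumes "test_fun half_plane \<phi>"
  shows "(LBINT p. \<zeta> (fst p) (snd p) * dir_deriv (1, 0) \<phi> p) =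
    - (LBINT p. V (fst p) (snd p) * (h (snd p) * dir_deriv (0, 1) \<phi> p))"
proof -
  have "Dt (distr_of \<zeta>) \<phi> + DX (distr_of (\<lambda>t x. h x * V t x)) \<phi> = 0"
    using solution assms by (simp add: first_order_solution_def distr_eq_def)
  then show ?thesis by (simp add: Dt_def DX_def distr_of_def ac_simps)
qed

lemma momentum_equation:
  assumes "test_fun half_plane \<phi>"
  shows "(LBINT p. V (fst p) (snd p) * dir_deriv (1, 0) \<phi> p) =
    - (LBINT p. \<zeta> (fst p) (snd p) * dir_deriv (0, 1) \<phi> p)"
proof -
  have "Dt (distr_of V) \<phi> + DX (distr_of \<zeta>) \<phi> = 0"
    using solution assms by (simp add: first_order_solution_def distr_eq_def)
  then show ?thesis by (simp add: Dt_def DX_def distr_of_def)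
qed

section \<open>The system integrated in time\<close>

definition "Z = time_primitive \<zeta>"
definition "W = time_primitive V"

lemma C_L2_primitives: "C_L2 Z" "C_L2 W"
  unfolding Z_def W_def by (intro C_L2_time_primitive C_L2)+

lemma deriv_primitives: "L2_deriv Z \<zeta>" "L2_deriv W V"
  unfolding Z_def W_def by (intro L2_deriv_time_primitive C_L2)+

lemma primitives_L2: "0 \<le> t \<Longrightarrow> in_L2 (Z t)" "0 \<le> t \<Longrightarrow> in_L2 (W t)"
  using C_L2_primitives C_L2_in_L2 by auto

lemma curves_L2: "0 \<le> t \<Longrightarrow> in_L2 (\<zeta> t)" "0 \<le> t \<Longrightarrow> in_L2 (V t)"
  using C_L2 C_L2_in_L2 by auto

text \<open>Tensor test functions in the mass equation make the pairing of \<zeta> with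
  \<open>\<psi>\<close> an antiderivative of the flux pairing; the zero initial value removes the
  constant.\<close>

lemma zeta_pairing:
  assumes \<psi>: "test_fun UNIV \<psi>" and t: "0 \<le> t"
  shows "(LBINT x. \<zeta> t x * \<psi> x) = (LBINT s:{0..t}. LBINT x. V s x * (h x * deriv \<psi> x))"
proof -
  have "(LBINT x. \<zeta> t x * \<psi> x) = (LBINT x. \<zeta> 0 x * \<psi> x) + (LBINT s:{0..t}. LBINT x. V s x * (h x * deriv \<psi> x))"
  proof (rule weak_time_derivative[OF C_L2 test_fun_in_L2[OF \<psi>] h_mult_L2[OF test_fun_in_L2[OF test_fun_deriv[OF \<psi>]]] _ t])
    fix \<theta> :: "real \<Rightarrow> real" assume \<theta>: "test_fun {0<..} \<theta>"
    note T = test_fun_tensor[OF \<theta> \<psi>]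
    show "(LBINT p. \<zeta> (fst p) (snd p) * (deriv \<theta> (fst p) * \<psi> (snd p))) =
       - (LBINT p. V (fst p) (snd p) * (\<theta> (fst p) * (h (snd p) * deriv \<psi> (snd p))))"
      using mass_equation[OF T(1)] by (simp add: T(2,3) mult.left_commute)
  qed
  moreover have "(LBINT x. \<zeta> 0 x * \<psi> x) = 0"
    using initial(1) by (intro integral_eq_zero_AE) auto
  ultimately show ?thesis by simp
qed

lemma V_pairing:
  assumes \<psi>: "test_fun UNIV \<psi>" and t: "0 \<le> t"
  shows "(LBINT x. V t x * \<psi> x) = (LBINT x. f' x * \<psi> x) + (LBINT s:{0..t}. LBINT x. \<zeta> s x * deriv \<psi> x)"
proof -
  have "(LBINT x. V t x * \<psi> x) = (LBINT x. V 0 x * \<psi> x) + (LBINT s:{0..t}. LBINT x. \<zeta> s x * deriv \<psi> x)"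
  proof (rule weak_time_derivative[OF C_L2(2,1) test_fun_in_L2[OF \<psi>] test_fun_in_L2[OF test_fun_deriv[OF \<psi>]] _ t])
    fix \<theta> :: "real \<Rightarrow> real" assume \<theta>: "test_fun {0<..} \<theta>"
    note T = test_fun_tensor[OF \<theta> \<psi>]
    show "(LBINT p. V (fst p) (snd p) * (deriv \<theta> (fst p) * \<psi> (snd p))) =
       - (LBINT p. \<zeta> (fst p) (snd p) * (\<theta> (fst p) * deriv \<psi> (snd p)))"
      using momentum_equation[OF T(1)] by (simp add: T(2,3))
  qed
  moreover have "(LBINT x. V 0 x * \<psi> x) = (LBINT x. f' x * \<psi> x)"
    using initial(2) curves_L2(2)[of 0, THEN in_L2_measurable] f_L2(2)[THEN in_L2_measurable] test_fun_measurable[OF \<psi>]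
    by (intro integral_cong_AE) auto
  ultimately show ?thesis by simp
qed

text \<open>Pairing the time integral of \<zeta> with a derivative reproduces the time-integrated
  momentum equation, whose other terms involve only \<open>V\<close> and \<open>f'\<close>.\<close>

lemma Z_H1: assumes t: "0 \<le> t" shows "in_H1 (Z t) (\<lambda>x. f' x - V t x)"
  unfolding in_H1_def weak_deriv_def
proof (intro conjI allI impI)
  show "in_L2 (Z t)" by (rule primitives_L2(1)[OF t])
  show "in_L2 (\<lambda>x. f' x - V t x)" by (intro in_L2_diff f_L2 curves_L2 t)
  fix \<psi> :: "real \<Rightarrow> real" assume \<psi>: "test_fun UNIV \<psi>"
  have "(LBINT x. Z t x * deriv \<psi> x) = (LBINT s:{0..t}. LBINT x. \<zeta> s x * deriv \<psi> x)"
    unfolding Z_def by (rule time_primitive_pairing[OF C_L2(1) test_fun_in_L2[OF test_fun_deriv[OF \<psi>]] t])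
  then show "(LBINT x. Z t x * deriv \<psi> x) = - (LBINT x. (f' x - V t x) * \<psi> x)"
    using V_pairing[OF \<psi> t] in_L2_mult_integrable[OF f_L2(2) test_fun_in_L2[OF \<psi>]] in_L2_mult_integrable[OF curves_L2(2)[OF t] test_fun_in_L2[OF \<psi>]]
    by (simp add: left_diff_distrib)
qed

text \<open>The gain of a derivative is stated for \<open>h W\<close>, whose product with the
  potential f - Z is the energy flux.\<close>

lemma W_H1: assumes t: "0 \<le> t" shows "in_H1 (\<lambda>x. h x * W t x) (\<lambda>x. - \<zeta> t x)"
  unfolding in_H1_def weak_deriv_def
proof (intro conjI allI impI)
  show "in_L2 (\<lambda>x. h x * W t x)" by (intro h_mult_L2 primitives_L2 t)
  show "in_L2 (\<lambda>x. - \<zeta> t x)" by (intro in_L2_minus curves_L2 t)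
  fix \<psi> :: "real \<Rightarrow> real" assume \<psi>: "test_fun UNIV \<psi>"
  have "(LBINT x. W t x * (h x * deriv \<psi> x)) = (LBINT s:{0..t}. LBINT x. V s x * (h x * deriv \<psi> x))"
    unfolding W_def by (rule time_primitive_pairing[OF C_L2(2) h_mult_L2[OF test_fun_in_L2[OF test_fun_deriv[OF \<psi>]]] t])
  then show "(LBINT x. h x * W t x * deriv \<psi> x) = - (LBINT x. - \<zeta> t x * \<psi> x)"
    using zeta_pairing[OF \<psi> t] by (simp add: ac_simps)
qed

lemma potential_H1: assumes t: "0 \<le> t" shows "in_H1 (\<lambda>x. f x - Z t x) (V t)"
  using in_H1_diff[OF f_H1 Z_H1[OF t]] by simp

lemma potential_deriv: "L2_deriv (\<lambda>t x. f x - Z t x) (\<lambda>t x. - \<zeta> t x)"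
  by (rule L2_deriv_const_diff[OF deriv_primitives(1) f_L2(1)])

section \<open>Bounds uniform in time\<close>

lemma h_square_nonneg: "0 \<le> (LBINT x. h x * (u x)\<^sup>2)"
  using h_lower m_pos by (intro integral_nonneg_AE) (auto elim!: eventually_mono)

lemma h_square_lower:
  assumes "in_L2 u" shows "m * (L2_norm u)\<^sup>2 \<le> (LBINT x. h x * (u x)\<^sup>2)"
proof -
  have "(LBINT x. m * (u x)\<^sup>2) \<le> (LBINT x. h x * (u x)\<^sup>2)"
  proof (rule integral_mono_AE)
    show "integrable lborel (\<lambda>x. h x * (u x)\<^sup>2)"
      using in_L2_mult_integrable[OF h_mult_L2[OF assms] assms] by (simp add: power2_eq_square mult.assoc)
    show "AE x in lborel. m * (u x)\<^sup>2 \<le> h x * (u x)\<^sup>2"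
      using h_lower by eventually_elim (simp add: mult_right_mono)
  qed (use in_L2_square_integrable[OF assms] in simp)
  then show ?thesis by (simp add: L2_norm_sq)
qed

lemma h_square_upper:
  assumes "in_L2 u" shows "(LBINT x. h x * (u x)\<^sup>2) \<le> M * (L2_norm u)\<^sup>2"
proof -
  have "(LBINT x. h x * (u x)\<^sup>2) \<le> (LBINT x. M * (u x)\<^sup>2)"
  proof (rule integral_mono_AE)
    show "integrable lborel (\<lambda>x. h x * (u x)\<^sup>2)"
      using in_L2_mult_integrable[OF h_mult_L2[OF assms] assms] by (simp add: power2_eq_square mult.assoc)
    show "AE x in lborel. h x * (u x)\<^sup>2 \<le> M * (u x)\<^sup>2"
      using h_upper by eventually_elim (auto intro!: mult_right_mono)
  qed (use in_L2_square_integrable[OF assms] in simp)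
  then show ?thesis by (simp add: L2_norm_sq)
qed

text \<open>\<open>Z\<close> and \<open>W\<close> vanish at time 0, so the initial energy consists
  of \<open>f\<close> alone.\<close>

lemma potential_energy:
  assumes t: "0 \<le> t"
  shows "(LBINT x. (f x - Z t x)\<^sup>2) + (LBINT x. h x * (W t x)\<^sup>2) = (LBINT x. (f x)\<^sup>2)"
  using energy_conserved[OF potential_deriv deriv_primitives(2) potential_H1 W_H1 h_measurable h_upper M_pos t]
  by (simp add: Z_def W_def)

lemma Z_bound:
  assumes t: "0 \<le> t" shows "L2_norm (Z t) \<le> 2 * L2_norm f"
proof -
  have "(L2_norm (\<lambda>x. f x - Z t x))\<^sup>2 \<le> (L2_norm f)\<^sup>2"
    using potential_energy[OF t] h_square_nonneg[of "W t"] by (simp add: L2_norm_sq)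
  then have "L2_norm (\<lambda>x. f x - Z t x) \<le> L2_norm f" by (rule power2_le_imp_le) simp
  \<comment> \<open>The potential f - Z has at most the norm of f, and Z differs from f by it: hence
    the factor 2.\<close>
  then show ?thesis
    using L2_norm_le_add_diff[OF primitives_L2(1)[OF t] f_L2(1)] L2_norm_diff_commute[of "Z t" f] by simp
qed

text \<open>The same energy identity for the increments over a time step \<open>d\<close> controls
  \<open>V\<close>, the limit of their difference quotients as \<open>d\<close> tends to zero.\<close>

lemma V_bound: obtains C where "\<And>t. 0 \<le> t \<Longrightarrow> L2_norm (V t) \<le> C"
proof -
  obtain A where A: "0 \<le> A" "\<And>t. t \<in> {0..1} \<Longrightarrow> L2_norm (\<zeta> t) \<le> A" by (rule C_L2_bounded[OF C_L2(1)]) (rule that)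
  obtain B where B: "0 \<le> B" "\<And>t. t \<in> {0..1} \<Longrightarrow> L2_norm (V t) \<le> B" by (rule C_L2_bounded[OF C_L2(2)]) (rule that)
  \<comment> \<open>At time 0 the increments over a step d have norms at most d A and d B, hence
    energy at most d^2 (A^2 + M B^2); dividing by \<open>m\<close> bounds the squared norm of the
    increment of \<open>W\<close> at all times. Only the times in [0, 1] enter \<open>A\<close> and
    \<open>B\<close>.\<close>
  define C where "C = sqrt ((A\<^sup>2 + M * B\<^sup>2) / m)"
  have incr: "L2_norm (\<lambda>x. W (t + d) x - W t x) \<le> d * C" if t: "0 \<le> t" and d: "0 \<le> d" "d \<le> 1" for t d
  proof -
    define w where "w = (\<lambda>t x. W (t + d) x - W t x)"
    define p where "p = (\<lambda>t x. (f x - Z (t + d) x) - (f x - Z t x))"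
    have w: "L2_deriv w (\<lambda>t x. V (t + d) x - V t x)"
      unfolding w_def by (rule L2_deriv_increment[OF deriv_primitives(2) d(1)])
    have p: "L2_deriv p (\<lambda>t x. - \<zeta> (t + d) x - - \<zeta> t x)"
      unfolding p_def by (rule L2_deriv_increment[OF potential_deriv d(1)])
    have wL2: "in_L2 (w t)" if "0 \<le> t" for t using w that by (simp add: L2_deriv_def)
    have "(LBINT x. (p t x)\<^sup>2) + (LBINT x. h x * (w t x)\<^sup>2) = (LBINT x. (p 0 x)\<^sup>2) + (LBINT x. h x * (w 0 x)\<^sup>2)"
    proof (rule energy_conserved[OF p w _ _ h_measurable h_upper M_pos t])
      fix s :: real assume s: "0 \<le> s"
      show "in_H1 (p s) (\<lambda>x. V (s + d) x - V s x)"
        unfolding p_def using s d by (intro in_H1_diff potential_H1) auto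
      show "in_H1 (\<lambda>x. h x * w s x) (\<lambda>x. - \<zeta> (s + d) x - - \<zeta> s x)"
        unfolding w_def right_diff_distrib using s d by (intro in_H1_diff W_H1) auto
    qed
    \<comment> \<open>At time 0 the increment of the potential is the negative of
      \<open>Z d\<close>.\<close>
    moreover have "(LBINT x. (p 0 x)\<^sup>2) \<le> d\<^sup>2 * A\<^sup>2"
    proof -
      have "L2_norm (Z d) \<le> (d - 0) * A"
        using C_L2_integral_bound(2)[OF C_L2(1) order_refl d(1), of A] A d by (simp add: Z_def time_primitive_def[abs_def])
      then have "(L2_norm (Z d))\<^sup>2 \<le> (d * A)\<^sup>2" by (intro power_mono) auto
      then show ?thesis by (simp add: p_def Z_def L2_norm_sq power_mult_distrib)
    qed
    moreover have "(LBINT x. h x * (w 0 x)\<^sup>2) \<le> M * (d\<^sup>2 * B\<^sup>2)"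
    proof -
      have "L2_norm (W d) \<le> (d - 0) * B"
        using C_L2_integral_bound(2)[OF C_L2(2) order_refl d(1), of B] B d by (simp add: W_def time_primitive_def[abs_def])
      then have "(L2_norm (w 0))\<^sup>2 \<le> (d * B)\<^sup>2" by (intro power_mono) (auto simp: w_def W_def)
      then have "M * (L2_norm (w 0))\<^sup>2 \<le> M * (d\<^sup>2 * B\<^sup>2)" using M_pos by (intro mult_left_mono) (auto simp: power_mult_distrib)
      then show ?thesis using h_square_upper[OF wL2[OF order_refl]] by linarith
    qed
    moreover have "m * (L2_norm (w t))\<^sup>2 \<le> (LBINT x. h x * (w t x)\<^sup>2)" by (rule h_square_lower[OF wL2[OF t]])
    moreover have "0 \<le> (LBINT x. (p t x)\<^sup>2)" by simp
    ultimately have "m * (L2_norm (w t))\<^sup>2 \<le> d\<^sup>2 * A\<^sup>2 + M * (d\<^sup>2 * B\<^sup>2)" by linarith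
    then have "m * (L2_norm (w t))\<^sup>2 \<le> d\<^sup>2 * (A\<^sup>2 + M * B\<^sup>2)" by (simp add: algebra_simps)
    then have "(L2_norm (w t))\<^sup>2 \<le> d\<^sup>2 * ((A\<^sup>2 + M * B\<^sup>2) / m)" using m_pos by (simp add: field_simps)
    also have "\<dots> = (d * C)\<^sup>2" using m_pos M_pos by (simp add: C_def power_mult_distrib)
    finally have "L2_norm (w t) \<le> d * C"
      by (rule power2_le_imp_le) (use d m_pos M_pos in \<open>simp add: C_def\<close>)
    then show ?thesis by (simp add: w_def)
  qed
  have "L2_norm (V t) \<le> C" if t: "0 \<le> t" for t
  proof (rule field_le_epsilon)
    fix e :: real assume "0 < e"
    have "((\<lambda>s. L2_norm (\<lambda>x. (W s x - W t x) / (s - t) - V t x)) \<longlongrightarrow> 0) (at t within {0..})"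
      using deriv_primitives(2) t by (simp add: L2_deriv_def)
    from tendstoD[OF this \<open>0 < e\<close>] obtain \<delta> where \<delta>: "0 < \<delta>" and
      near: "\<And>s. 0 \<le> s \<Longrightarrow> s \<noteq> t \<Longrightarrow> dist s t < \<delta> \<Longrightarrow> L2_norm (\<lambda>x. (W s x - W t x) / (s - t) - V t x) < e"
      unfolding eventually_at by auto
    \<comment> \<open>At most 1, for the bound on increments, and smaller than
      \<open>\<delta>\<close>, so that the difference quotient is close to
      \<open>V t\<close>.\<close>
    define d where "d = min 1 (\<delta> / 2)"
    have d: "0 < d" "d \<le> 1" "d < \<delta>" using \<delta> by (auto simp: d_def)
    define q where "q = (\<lambda>x. 1 / d * (W (t + d) x - W t x))"
    have q: "in_L2 q" unfolding q_def using t d by (intro in_L2_cmult in_L2_diff primitives_L2) auto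
    have "L2_norm q = 1 / d * L2_norm (\<lambda>x. W (t + d) x - W t x)" unfolding q_def using d by (subst L2_norm_cmult) simp
    also have "\<dots> \<le> 1 / d * (d * C)" using incr[OF t, of d] d by (intro mult_left_mono) auto
    finally have "L2_norm q \<le> C" using d by simp
    moreover have "L2_norm (\<lambda>x. q x - V t x) < e" using near[of "t + d"] t d by (simp add: q_def dist_real_def)
    ultimately show "L2_norm (V t) \<le> C + e"
      using L2_norm_le_add_diff[OF curves_L2(2)[OF t] q] L2_norm_diff_commute[of q "V t"] by simp
  qed
  then show ?thesis by (rule that)
qed

text \<open>The pointwise bound is the Sobolev inequality for \<open>Z t\<close>, whose weak
  derivative f' - V t is bounded uniformly in time because \<open>V\<close> is.\<close>

lemma Z_uniform_bound:
  obtains C where "\<And>t. 0 \<le> t \<Longrightarrow> L2_norm (Z t) \<le> C" "\<And>t. 0 \<le> t \<Longrightarrow> AE x in lborel. \<bar>Z t x\<bar> \<le> C"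
proof -
  obtain B where B: "\<And>t. 0 \<le> t \<Longrightarrow> L2_norm (V t) \<le> B" by (rule V_bound) (rule that)
  have "0 \<le> B" using B[of 0] L2_norm_nonneg[of "V 0"] by linarith
  \<comment> \<open>The first term bounds \<open>Z t\<close> in L^2, the bracket its weak
    X-derivative.\<close>
  define C where "C = 2 * L2_norm f + (L2_norm f' + B)"
  have "L2_norm (Z t) \<le> C" if "0 \<le> t" for t
    using Z_bound[OF that] \<open>0 \<le> B\<close> L2_norm_nonneg[of f'] unfolding C_def by linarith
  moreover have "AE x in lborel. \<bar>Z t x\<bar> \<le> C" if t: "0 \<le> t" for t
  proof -
    have "L2_norm (\<lambda>x. f' x - V t x) \<le> L2_norm f' + B"
      using L2_norm_diff_le[OF f_L2(2) curves_L2(2)[OF t]] B[OF t] by simp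
    then have "L2_norm (Z t) + L2_norm (\<lambda>x. f' x - V t x) \<le> C" using Z_bound[OF t] by (simp add: C_def)
    then show ?thesis using H1_AE_bound[OF Z_H1[OF t]] by (auto elim!: eventually_mono)
  qed
  ultimately show ?thesis by (rule that)
qed

text \<open>The momentum equation tested with \<open>h \<theta>\<close>, which is only \<open>H\<^sup>1\<close> in \<open>x\<close>.\<close>

lemma momentum_equation_weighted:
  assumes \<theta>: "test_fun half_plane \<theta>"
  shows "(LBINT p. \<zeta> (fst p) (snd p) * (h (snd p) * dir_deriv (0, 1) \<theta> p)) + (LBINT p. \<zeta> (fst p) (snd p) * (h' (snd p) * \<theta> p)) =
    - (LBINT p. V (fst p) (snd p) * (h (snd p) * dir_deriv (1, 0) \<theta> p))"
proof -
  let ?L = "(LBINT p. \<zeta> (fst p) (snd p) * (h (snd p) * dir_deriv (0, 1) \<theta> p)) + (LBINT p. \<zeta> (fst p) (snd p) * (h' (snd p) * \<theta> p))"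
  define \<theta>t where "\<theta>t = dir_deriv (1, 0) \<theta>"
  have \<theta>t: "test_fun half_plane \<theta>t" unfolding \<theta>t_def by (rule test_fun_dir_deriv[OF \<theta>])
  define \<theta>tx where "\<theta>tx = dir_deriv (0, 1) \<theta>t"
  have \<theta>tx: "test_fun half_plane \<theta>tx" unfolding \<theta>tx_def by (rule test_fun_dir_deriv[OF \<theta>t])
  have comm: "dir_deriv (1, 0) (dir_deriv (0, 1) \<theta>) = \<theta>tx"
    unfolding \<theta>tx_def \<theta>t_def by (rule dir_deriv_commute[OF test_fun_smooth[OF \<theta>]])
  note h = h_measurable h_local_L2 and h' = in_L2_measurable[OF h'_L2] h'_local_L2
  note k1 = time_kernel_mult_test_fun[OF h \<theta>tx] and k2 = time_kernel_mult_test_fun[OF h' \<theta>t] and k3 = time_kernel_mult_test_fun[OF h \<theta>t]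
  note i1 = time_kernel_integrable[OF C_L2_primitives(1) k1] and i2 = time_kernel_integrable[OF C_L2_primitives(1) k2]
  \<comment> \<open>The time derivative of a test function integrates to 0 in time; this removes the
    time-independent term with \<open>f'\<close> at the end.\<close>
  have tz: "(LBINT t. \<theta>t (t, x)) = 0" for x
    using test_fun_deriv_integral[OF test_fun_UNIV[OF test_fun_half_plane_section_t(1)[OF \<theta>]], of x]
    by (simp add: test_fun_half_plane_section_t(2)[OF \<theta>] \<theta>t_def)
  have k12: "time_kernel (\<lambda>p. h (snd p) * \<theta>tx p + h' (snd p) * \<theta>t p)"
  proof -
    obtain T1 g1 where 1: "in_L2 g1" "\<And>t x. \<bar>h (snd (t, x)) * \<theta>tx (t, x)\<bar> \<le> indicator {0..T1} t * g1 x"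
      using k1 unfolding time_kernel_def by blast
    obtain T2 g2 where 2: "in_L2 g2" "\<And>t x. \<bar>h' (snd (t, x)) * \<theta>t (t, x)\<bar> \<le> indicator {0..T2} t * g2 x"
      using k2 unfolding time_kernel_def by blast
    have le: "indicator {0..T} t * g x \<le> indicator {0..max T1 T2} t * \<bar>g x\<bar>" if "T \<le> max T1 T2" for T t x and g :: "real \<Rightarrow> real"
      using that by (auto simp: indicator_def)
    show ?thesis
      unfolding time_kernel_def
    proof (intro conjI exI[of _ "max T1 T2"] exI[of _ "\<lambda>x. \<bar>g1 x\<bar> + \<bar>g2 x\<bar>"] allI in_L2_add in_L2_abs 1(1) 2(1))
      show "(\<lambda>p. h (snd p) * \<theta>tx p + h' (snd p) * \<theta>t p) \<in> borel_measurable borel"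
        using k1 k2 unfolding time_kernel_def by (intro borel_measurable_add) auto
      show "\<bar>h (snd (t, x)) * \<theta>tx (t, x) + h' (snd (t, x)) * \<theta>t (t, x)\<bar> \<le> indicator {0..max T1 T2} t * (\<bar>g1 x\<bar> + \<bar>g2 x\<bar>)" for t x
        using 1(2)[of t x] 2(2)[of t x] le[of T1 t g1 x] le[of T2 t g2 x] abs_triangle_ineq[of "h x * \<theta>tx (t, x)" "h' x * \<theta>t (t, x)"]
        by (simp add: distrib_left)
    qed
  qed
  \<comment> \<open>One time derivative passes to the test function and replaces \<zeta> by
    \<open>Z\<close>, which has a square integrable weak X-derivative at every t \<ge> 0.\<close>
  have "?L
    = - ((LBINT p. Z (fst p) (snd p) * (h (snd p) * \<theta>tx p)) + (LBINT p. Z (fst p) (snd p) * (h' (snd p) * \<theta>t p)))"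
    using time_by_parts[OF C_L2(1) h test_fun_dir_deriv[OF \<theta>, of "(0, 1)"]] time_by_parts[OF C_L2(1) h' \<theta>]
    by (simp add: comm Z_def \<theta>t_def[symmetric])
  also have "(LBINT p. Z (fst p) (snd p) * (h (snd p) * \<theta>tx p)) + (LBINT p. Z (fst p) (snd p) * (h' (snd p) * \<theta>t p))
    = (LBINT p. Z (fst p) (snd p) * (h (snd p) * \<theta>tx p + h' (snd p) * \<theta>t p))"
    using i1 i2 by (simp add: distrib_left lborel_prod)
  also have "\<dots> = (LBINT t. LBINT x. Z t x * (h x * \<theta>tx (t, x) + h' x * \<theta>t (t, x)))"
    using time_kernel_integral_t[OF C_L2_primitives(1) k12] by simp
  \<comment> \<open>Integration by parts in X at fixed time, between \<open>Z t\<close> and h times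
    \<open>\<theta>t\<close>, both in H^1.\<close>
  also have "\<dots> = (LBINT t. LBINT x. (V t x - f' x) * (h x * \<theta>t (t, x)))"
  proof (rule Bochner_Integration.integral_cong[OF refl])
    fix t :: real
    show "(LBINT x. Z t x * (h x * \<theta>tx (t, x) + h' x * \<theta>t (t, x))) = (LBINT x. (V t x - f' x) * (h x * \<theta>t (t, x)))"
    proof (cases "0 \<le> t")
      case True
      note s = test_fun_section_x[OF \<theta>t, of t]
      have H: "in_H1 (\<lambda>x. h x * \<theta>t (t, x)) (\<lambda>x. h' x * \<theta>t (t, x) + h x * \<theta>tx (t, x))"
        using in_H1_mult_test_fun[OF h_weak h'_L2 h_measurable h_upper s(1)] unfolding s(2) \<theta>tx_def .
      have "(LBINT x. Z t x * (h x * \<theta>tx (t, x) + h' x * \<theta>t (t, x))) = - (LBINT x. (f' x - V t x) * (h x * \<theta>t (t, x)))"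
        using H1_by_parts[OF Z_H1[OF True] H] by (simp add: add.commute)
      also have "\<dots> = (LBINT x. - ((f' x - V t x) * (h x * \<theta>t (t, x))))" by simp
      also have "\<dots> = (LBINT x. (V t x - f' x) * (h x * \<theta>t (t, x)))" by (simp add: algebra_simps)
      finally show ?thesis .
    next
      case False
      \<comment> \<open>For t < 0 both integrands vanish together with the test functions.\<close>
      have "\<phi> (t, x) = 0" if "test_fun half_plane \<phi>" for \<phi> x
        using that closure_subset[of "{x. \<phi> x \<noteq> 0}"] False unfolding test_fun_def half_plane_def by force
      from this[OF \<theta>t] this[OF \<theta>tx] show ?thesis by simp
    qed
  qed
  also have "\<dots> = (LBINT p. (V (fst p) (snd p) - f' (snd p)) * (h (snd p) * \<theta>t p))"
    using time_kernel_integral_t[OF C_L2_diff[OF C_L2(2) C_L2_const[OF f_L2(2)]] k3] by simp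
  also have "\<dots> = (LBINT p. V (fst p) (snd p) * (h (snd p) * \<theta>t p)) - (LBINT p. f' (snd p) * (h (snd p) * \<theta>t p))"
    using time_kernel_integrable[OF C_L2(2) k3] time_kernel_integrable[OF C_L2_const[OF f_L2(2)] k3]
    by (simp add: left_diff_distrib lborel_prod)
  also have "(LBINT p. f' (snd p) * (h (snd p) * \<theta>t p)) = (LBINT x. f' x * (h x * (LBINT t. \<theta>t (t, x))))"
    using time_kernel_integral_x[OF C_L2_const[OF f_L2(2)] k3] by simp
  also have "\<dots> = 0" by (simp add: tz)
  finally show ?thesis by (simp add: \<theta>t_def)
qed

section \<open>The wave equation and its initial data\<close>

lemma wave_equation:
  "distr_eq (\<lambda>\<phi>. Dt (Dt (distr_of (\<lambda>t x. t * \<zeta> t x))) \<phi> - DX (mult_DX h h' (\<lambda>t x. t * \<zeta> t x)) \<phi>) (Dt (Dt (distr_of (\<lambda>t x. 2 * Z t x))))"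
  unfolding distr_eq_def
proof (intro allI impI)
  fix \<phi> assume \<phi>: "test_fun half_plane \<phi>"
  define \<phi>t where "\<phi>t = dir_deriv (1, 0) \<phi>"
  define \<phi>x where "\<phi>x = dir_deriv (0, 1) \<phi>"
  define \<phi>tt where "\<phi>tt = dir_deriv (1, 0) \<phi>t"
  define \<phi>xx where "\<phi>xx = dir_deriv (0, 1) \<phi>x"
  define \<phi>tx where "\<phi>tx = dir_deriv (0, 1) \<phi>t"
  have t: "test_fun half_plane \<phi>t" "test_fun half_plane \<phi>x" "test_fun half_plane \<phi>tt" "test_fun half_plane \<phi>xx" "test_fun half_plane \<phi>tx"
    unfolding \<phi>t_def \<phi>x_def \<phi>tt_def \<phi>xx_def \<phi>tx_def by (intro test_fun_dir_deriv \<phi>)+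
  have comm: "dir_deriv (1, 0) \<phi>x = \<phi>tx"
    unfolding \<phi>x_def \<phi>tx_def \<phi>t_def by (rule dir_deriv_commute[OF test_fun_smooth[OF \<phi>]])
  have one: "(\<lambda>x::real. 1::real) \<in> borel_measurable borel" "in_L2 (\<lambda>x. indicator {-R..R} x * 1)" for R :: real
    by (simp_all add: in_L2_indicator)
  note h = h_measurable h_local_L2
  have int1: "integrable lborel (\<lambda>p. v (fst p) (snd p) * \<theta> p)" if "C_L2 v" "test_fun half_plane \<theta>" for v \<theta>
    using time_kernel_integrable[OF that(1) time_kernel_mult_test_fun[OF one that(2)]] by (simp add: lborel_prod)
  have inth: "integrable lborel (\<lambda>p. v (fst p) (snd p) * (h (snd p) * \<theta> p))" if "C_L2 v" "test_fun half_plane \<theta>" for v \<theta>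
    using time_kernel_integrable[OF that(1) time_kernel_mult_test_fun[OF h that(2)]] by (simp add: lborel_prod)
  have tm: "test_fun half_plane (\<lambda>p. fst p * \<theta> p)" if "test_fun half_plane \<theta>" for \<theta>
    by (rule test_fun_time_mult(1)[OF that])
  define I where "I = (\<lambda>\<theta>. LBINT p. \<zeta> (fst p) (snd p) * \<theta> p)"
  define J where "J = (\<lambda>\<theta>. LBINT p. V (fst p) (snd p) * (h (snd p) * \<theta> p))"
  have I_add: "I (\<lambda>p. \<theta> p + \<eta> p) = I \<theta> + I \<eta>" if "test_fun half_plane \<theta>" "test_fun half_plane \<eta>" for \<theta> \<eta>
    using int1[OF C_L2(1) that(1)] int1[OF C_L2(1) that(2)] by (simp add: I_def distrib_left)
  have J_add: "J (\<lambda>p. \<theta> p + \<eta> p) = J \<theta> + J \<eta>" if "test_fun half_plane \<theta>" "test_fun half_plane \<eta>" for \<theta> \<eta>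
    using inth[OF C_L2(2) that(1)] inth[OF C_L2(2) that(2)] by (simp add: J_def distrib_left)
  have mass: "I (dir_deriv (1, 0) \<theta>) = - J (dir_deriv (0, 1) \<theta>)" if "test_fun half_plane \<theta>" for \<theta>
    using mass_equation[OF that] by (simp add: I_def J_def)
  \<comment> \<open>The mass equation is tested with \<phi> and t \<phi>_t, the weighted momentum
    equation with t \<phi>_x. The terms J (t \<phi>_tx) cancel between 2 and 3. The product rule
    leaves - I \<phi>_t in 2, and J \<phi>_x in 3, which by 1 is another - I \<phi>_t: this is the
    factor 2 in b_m, and 4 expresses it through \<open>Z\<close>.\<close>
  have 1: "I \<phi>t = - J \<phi>x" using mass[OF \<phi>] by (simp add: \<phi>t_def \<phi>x_def)
  have 2: "I \<phi>t + I (\<lambda>p. fst p * \<phi>tt p) = - J (\<lambda>p. fst p * \<phi>tx p)"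
    using mass[OF tm[OF t(1)]] I_add[OF t(1) tm[OF t(3)]] by (simp add: test_fun_time_mult(2,3)[OF t(1)] \<phi>tt_def \<phi>tx_def)
  have 3: "(LBINT p. \<zeta> (fst p) (snd p) * (h (snd p) * (fst p * \<phi>xx p))) + (LBINT p. \<zeta> (fst p) (snd p) * (h' (snd p) * (fst p * \<phi>x p)))
    = - (J \<phi>x + J (\<lambda>p. fst p * \<phi>tx p))"
    using momentum_equation_weighted[OF tm[OF t(2)]] J_add[OF t(2) tm[OF t(5)]]
    by (simp add: test_fun_time_mult(2,3)[OF t(2)] comm \<phi>xx_def J_def)
  have 4: "I \<phi>t = - (LBINT p. Z (fst p) (snd p) * \<phi>tt p)"
    using time_by_parts[OF C_L2(1) one t(1)] by (simp add: I_def Z_def \<phi>tt_def)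
  have "Dt (Dt (distr_of (\<lambda>t x. t * \<zeta> t x))) \<phi> = I (\<lambda>p. fst p * \<phi>tt p)"
    by (simp add: Dt_def distr_of_def I_def \<phi>tt_def \<phi>t_def ac_simps)
  moreover have "DX (mult_DX h h' (\<lambda>t x. t * \<zeta> t x)) \<phi> =
    (LBINT p. \<zeta> (fst p) (snd p) * (h (snd p) * (fst p * \<phi>xx p))) + (LBINT p. \<zeta> (fst p) (snd p) * (h' (snd p) * (fst p * \<phi>x p)))"
    by (simp add: DX_def mult_DX_def distr_of_def \<phi>xx_def \<phi>x_def ac_simps)
  moreover have "Dt (Dt (distr_of (\<lambda>t x. 2 * Z t x))) \<phi> = 2 * (LBINT p. Z (fst p) (snd p) * \<phi>tt p)"
    by (simp add: Dt_def distr_of_def \<phi>tt_def \<phi>t_def mult.assoc)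
  ultimately show "Dt (Dt (distr_of (\<lambda>t x. t * \<zeta> t x))) \<phi> - DX (mult_DX h h' (\<lambda>t x. t * \<zeta> t x)) \<phi> = Dt (Dt (distr_of (\<lambda>t x. 2 * Z t x))) \<phi>"
    using 1 2 3 4 by linarith
qed

text \<open>The product rule \<zeta> + t \<partial>_t \<zeta>, with \<partial>_t \<zeta> = -
  \<partial>_X (h V) in weak form.\<close>

definition "zeta1_deriv t \<psi> = (LBINT x. \<zeta> t x * \<psi> x) + t * (LBINT x. V t x * (h x * deriv \<psi> x))"

lemma H1_norm_test_ge: "L2_norm \<psi> \<le> H1_norm_test \<psi>" "L2_norm (deriv \<psi>) \<le> H1_norm_test \<psi>"
  unfolding H1_norm_test_def by (simp_all add: real_le_rsqrt)

text \<open>Applied to the values of the curves this bounds the time derivative in H^-1; applied to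
  their increments it gives its continuity in time.\<close>

lemma H1_dual_bound:
  assumes "in_L2 u" "in_L2 w" "test_fun UNIV \<psi>"
  shows "\<bar>(LBINT x. u x * \<psi> x) + (LBINT x. w x * (h x * deriv \<psi> x))\<bar> \<le> (L2_norm u + L2_norm w * M) * H1_norm_test \<psi>"
proof -
  note L2 = test_fun_in_L2[OF assms(3)] test_fun_in_L2[OF test_fun_deriv[OF assms(3)]]
  have "\<bar>LBINT x. u x * \<psi> x\<bar> \<le> L2_norm u * H1_norm_test \<psi>"
    using L2_Cauchy_Schwarz[OF assms(1) L2(1)] mult_left_mono[OF H1_norm_test_ge(1), of "L2_norm u" \<psi>] by simp
  moreover have "L2_norm (\<lambda>x. h x * deriv \<psi> x) \<le> M * H1_norm_test \<psi>"
    using L2_norm_bounded_mult_le[OF L2(2) M_pos h_upper] mult_left_mono[OF H1_norm_test_ge(2)[of \<psi>] M_pos] by simp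
  then have "\<bar>LBINT x. w x * (h x * deriv \<psi> x)\<bar> \<le> L2_norm w * (M * H1_norm_test \<psi>)"
    using L2_Cauchy_Schwarz[OF assms(2) h_mult_L2[OF L2(2)]] mult_left_mono[of _ _ "L2_norm w"] by fastforce
  ultimately show ?thesis by (simp add: algebra_simps)
qed

text \<open>The pairing of \<zeta> with a test function is the time integral of a continuous
  function, hence differentiable up to t = 0. The H^-1 bounds hold because the X-derivative falls on
  the test function.\<close>

lemma zeta1_time_deriv: "time_deriv_Hm1 (\<lambda>t x. t * \<zeta> t x) zeta1_deriv"
  unfolding time_deriv_Hm1_def
proof (intro conjI allI impI)
  fix \<psi> :: "real \<Rightarrow> real" and t :: real assume \<psi>: "test_fun UNIV \<psi>" and t: "0 \<le> t"
  define c where "c = (\<lambda>s. LBINT x. V s x * (h x * deriv \<psi> x))"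
  define a where "a = (\<lambda>s. LBINT x. \<zeta> s x * \<psi> x)"
  have c: "continuous_on {0..} c"
    unfolding c_def by (intro C_L2_pairing_continuous C_L2 h_mult_L2 test_fun_in_L2[OF test_fun_deriv[OF \<psi>]])
  have ci: "set_integrable lborel {0..b} c" for b
    by (intro borel_integrable_atLeastAtMost' continuous_on_subset[OF c]) auto
  have a_eq: "a s = integral {0..s} c" if "0 \<le> s" for s
    using zeta_pairing[OF \<psi> that] set_borel_integral_eq_integral(2)[OF ci] by (simp add: a_def c_def)
  have "((\<lambda>s. integral {0..s} c) has_real_derivative c t) (at t within {0..t + 1})"
    using t by (intro integral_has_real_derivative continuous_on_subset[OF c]) auto
  moreover have "at t within {0..t + 1} = at t within {0..}"
    by (rule at_within_nhd[of t "{..<t + 1}"]) auto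
  ultimately have "((\<lambda>s. integral {0..s} c) has_real_derivative c t) (at t within {0..})" by simp
  then have "(a has_real_derivative c t) (at t within {0..})"
    by (rule has_field_derivative_transform_within[where d=1]) (use t a_eq in auto)
  then have "((\<lambda>s. s * a s) has_real_derivative a t + t * c t) (at t within {0..})"
    by (auto intro!: derivative_eq_intros)
  then show "((\<lambda>s. LBINT x. s * \<zeta> s x * \<psi> x) has_real_derivative zeta1_deriv t \<psi>) (at t within {0..})"
    by (simp add: a_def c_def zeta1_deriv_def mult.assoc)
next
  have eq: "zeta1_deriv t = (\<lambda>\<psi>. (LBINT x. \<zeta> t x * \<psi> x) + (LBINT x. (t * V t x) * (h x * deriv \<psi> x)))" for t
    by (simp add: zeta1_deriv_def fun_eq_iff mult.assoc)
  have tV: "C_L2 (\<lambda>t x. t * V t x)" by (rule C_L2_mult_time[OF continuous_on_id C_L2(2)])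
  {
    fix t :: real assume "0 \<le> t"
    then show "\<exists>K. \<forall>\<psi>. test_fun UNIV \<psi> \<longrightarrow> \<bar>zeta1_deriv t \<psi>\<bar> \<le> K * H1_norm_test \<psi>"
      unfolding eq using H1_dual_bound curves_L2(1) C_L2_in_L2[OF tV] by blast
  next
    fix t \<epsilon> :: real assume t: "0 \<le> t" and "0 < \<epsilon>"
    let ?N = "\<lambda>s. L2_norm (\<lambda>x. \<zeta> s x - \<zeta> t x) + L2_norm (\<lambda>x. s * V s x - t * V t x) * M"
    have "(?N \<longlongrightarrow> 0 + 0 * M) (at t within {0..})"
      by (intro tendsto_intros C_L2_continuous[OF C_L2(1) t] C_L2_continuous[OF tV t])
    then have "\<forall>\<^sub>F s in at t within {0..}. ?N s < \<epsilon>"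
      using order_tendstoD(2)[of _ 0 _ \<epsilon>] \<open>0 < \<epsilon>\<close> by simp
    moreover have "\<forall>\<^sub>F s in at t within {0..}. 0 \<le> s" by (simp add: eventually_at_filter)
    ultimately show "\<forall>\<^sub>F s in at t within {0..}. \<forall>\<psi>. test_fun UNIV \<psi> \<longrightarrow> \<bar>zeta1_deriv s \<psi> - zeta1_deriv t \<psi>\<bar> \<le> \<epsilon> * H1_norm_test \<psi>"
    proof eventually_elim
      case (elim s)
      show ?case
      proof (intro allI impI)
        fix \<psi> :: "real \<Rightarrow> real" assume \<psi>: "test_fun UNIV \<psi>"
        note L2 = test_fun_in_L2[OF \<psi>] h_mult_L2[OF test_fun_in_L2[OF test_fun_deriv[OF \<psi>]]]
        have i: "integrable lborel (\<lambda>x. \<zeta> r x * \<psi> x)" "integrable lborel (\<lambda>x. (r * V r x) * (h x * deriv \<psi> x))" if "0 \<le> r" for r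
          by (intro in_L2_mult_integrable curves_L2 C_L2_in_L2[OF tV] that L2)+
        have d: "zeta1_deriv s \<psi> - zeta1_deriv t \<psi> = (LBINT x. (\<zeta> s x - \<zeta> t x) * \<psi> x) + (LBINT x. (s * V s x - t * V t x) * (h x * deriv \<psi> x))"
          unfolding left_diff_distrib eq using i[OF t] i[OF elim(2)] by simp
        have "\<bar>zeta1_deriv s \<psi> - zeta1_deriv t \<psi>\<bar> \<le> ?N s * H1_norm_test \<psi>"
          unfolding d by (intro H1_dual_bound in_L2_diff curves_L2 C_L2_in_L2[OF tV] elim t \<psi>)
        also have "\<dots> \<le> \<epsilon> * H1_norm_test \<psi>"
          using elim(1) order_trans[OF L2_norm_nonneg H1_norm_test_ge(1)[of \<psi>]] by (intro mult_right_mono) auto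
        finally show "\<bar>zeta1_deriv s \<psi> - zeta1_deriv t \<psi>\<bar> \<le> \<epsilon> * H1_norm_test \<psi>" .
      qed
    qed
  }
qed

lemma zeta1_deriv_0: "zeta1_deriv 0 \<psi> = 0"
  unfolding zeta1_deriv_def using initial(1) by (auto intro: integral_eq_zero_AE)

lemma zeta1_wave_solution: "wave_solution h h' (\<lambda>t x. 2 * Z t x) (\<lambda>t x. t * \<zeta> t x)"
  unfolding wave_solution_def
  using C_L2_mult_time[OF continuous_on_const C_L2_primitives(1)] C_L2_mult_time[OF continuous_on_id C_L2(1)] wave_equation zeta1_time_deriv zeta1_deriv_0 by auto

text \<open>If \<open>\<zeta>\<close> vanishes then so does \<open>Z\<close>, and the energy identity leaves no room for \<open>W\<close>.\<close>

lemma zeta1_nontrivial: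
  assumes f: "\<not> (AE x in lborel. f x = 0)"
  shows "nontrivial (\<lambda>t x. t * \<zeta> t x)"
  unfolding nontrivial_def
proof
  assume AE: "AE p in lborel. p \<in> half_plane \<longrightarrow> fst p * \<zeta> (fst p) (snd p) = 0"
  \<comment> \<open>The inserted indicator restores measurability in the plane, which is required to
    exchange the order of the two almost-everywhere quantifiers.\<close>
  have P: "AE p in lborel \<Otimes>\<^sub>M lborel. 0 < fst p \<longrightarrow> indicator {0..} (fst p) * \<zeta> (fst p) (snd p) = 0"
    using AE unfolding lborel_prod by eventually_elim (auto simp: half_plane_def)
  have "AE t in lborel. AE x in lborel. 0 < t \<longrightarrow> indicator {0..} t * \<zeta> t x = 0"
    using lborel_pair.AE_pair[OF P] by simp
  then have "AE x in lborel. AE t in lborel. 0 < t \<longrightarrow> indicator {0..} t * \<zeta> t x = 0"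
  proof (rule lborel_pair.AE_commute[THEN iffD1, rotated])
    note [measurable] = C_L2_measurable_pair[OF C_L2(1)]
    show "{p \<in> space (lborel \<Otimes>\<^sub>M lborel). 0 < fst p \<longrightarrow> indicator {0..} (fst p) * \<zeta> (fst p) (snd p) = 0} \<in> sets (lborel \<Otimes>\<^sub>M lborel)"
      by measurable
  qed
  then have Z0: "AE x in lborel. \<forall>t. Z t x = 0"
  proof eventually_elim
    fix x assume x: "AE t in lborel. 0 < t \<longrightarrow> indicator {0..} t * \<zeta> t x = 0"
    have "Z t x = 0" for t
      unfolding Z_def time_primitive_def set_lebesgue_integral_def
    proof (rule integral_eq_zero_AE)
      show "AE s in lborel. indicator {0..t} s *\<^sub>R \<zeta> s x = 0"
        using x AE_lborel_singleton[of 0] by eventually_elim (auto simp: indicator_def)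
    qed
    then show "\<forall>t. Z t x = 0" ..
  qed
  have "L2_norm (W t) = 0" if t: "0 \<le> t" for t
  proof -
    have "(LBINT x. (f x - Z t x)\<^sup>2) = (LBINT x. (f x)\<^sup>2)"
      using Z0 f_L2(1)[THEN in_L2_measurable] primitives_L2(1)[OF t, THEN in_L2_measurable]
      by (intro integral_cong_AE) (auto elim!: eventually_mono)
    then have "m * (L2_norm (W t))\<^sup>2 \<le> 0"
      using potential_energy[OF t] h_square_lower[OF primitives_L2(2)[OF t]] by simp
    then show ?thesis using m_pos by (simp add: mult_le_0_iff)
  qed
  then have W0: "AE x in lborel. W t x = 0" if "0 \<le> t" for t
    using that L2_norm_eq_0_iff[OF primitives_L2(2)] by blast
  \<comment> \<open>\<open>V 0\<close> is the strong derivative at 0 of \<open>W\<close>, which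
    vanishes almost everywhere at each time; so the initial velocity \<open>f'\<close>
    vanishes.\<close>
  have "((\<lambda>s. L2_norm (\<lambda>x. (W s x - W 0 x) / (s - 0) - V 0 x)) \<longlongrightarrow> 0) (at 0 within {0..})"
    using deriv_primitives(2)[unfolded L2_deriv_def, rule_format, OF order_refl] by blast
  moreover have "\<forall>\<^sub>F s in at 0 within {0..}. L2_norm (\<lambda>x. (W s x - W 0 x) / (s - 0) - V 0 x) = L2_norm (V 0)"
    unfolding eventually_at_filter
  proof (intro always_eventually allI impI)
    fix s :: real assume s: "s \<noteq> 0" "s \<in> {0..}"
    have "L2_norm (\<lambda>x. (W s x - W 0 x) / (s - 0) - V 0 x) = L2_norm (\<lambda>x. - V 0 x)"
    proof (rule L2_norm_cong_AE)
      show "AE x in lborel. (W s x - W 0 x) / (s - 0) - V 0 x = - V 0 x"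
        using W0[of s] W0[of 0] s by (auto elim: eventually_elim2)
    qed (use primitives_L2(2)[of s, THEN in_L2_measurable] primitives_L2(2)[of 0, THEN in_L2_measurable] curves_L2(2)[of 0, THEN in_L2_measurable] s in auto)
    then show "L2_norm (\<lambda>x. (W s x - W 0 x) / (s - 0) - V 0 x) = L2_norm (V 0)" by (simp add: L2_norm_minus)
  qed
  ultimately have "((\<lambda>s. L2_norm (V 0)) \<longlongrightarrow> 0) (at (0::real) within {0..})"
    by (rule Lim_transform_eventually)
  moreover have "at (0::real) within {0..} \<noteq> bot" by (simp add: at_within_Ici_at_right)
  ultimately have "L2_norm (V 0) = 0" by (simp add: tendsto_const_iff)
  then have "AE x in lborel. V 0 x = 0" using L2_norm_eq_0_iff[OF curves_L2(2)[of 0]] by simp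
  then have "AE x in lborel. f' x = 0" using initial(2) by eventually_elim simp
  \<comment> \<open>A square integrable function with weak derivative 0 vanishes, contrary to the
    assumption on \<open>f\<close>.\<close>
  then have "in_H1 f (\<lambda>x. 0)" by (intro in_H1_cong_AE[OF f_H1]) auto
  then show False using in_H1_deriv_zero f by blast
qed

end

text \<open>Integrals of non-integrable functions are 0 by convention. The integrability clause
  makes the integral in \<open>b\<^sub>m\<close> a genuine one for almost every X, and
  \<open>in_L2\<close> does the same for the L^2 norm in the final bound.\<close>

theorem proposition3p7:
  fixes \<beta> h_min :: real
    and b\<^sub>0 b\<^sub>0' h\<^sub>0 h\<^sub>0' f f' :: "real \<Rightarrow> real"
    and \<zeta>\<^sub>3 V\<^sub>3 \<zeta>\<^sub>1 b\<^sub>m :: "real \<Rightarrow> real \<Rightarrow> real"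
  assumes "0 < \<beta>" and "\<beta> \<le> 1"
    and "in_H1 b\<^sub>0 b\<^sub>0'"
    and "h\<^sub>0 = (\<lambda>X. 1 - \<beta> * b\<^sub>0 X)" and "h\<^sub>0' = (\<lambda>X. - \<beta> * b\<^sub>0' X)"
    and "0 < h_min" and "AE X in lborel. h_min \<le> h\<^sub>0 X"
    and "in_H1 f f'" and "\<not> (AE X in lborel. f X = 0)"
    and "first_order_solution h\<^sub>0 (\<lambda>X. 0) f' \<zeta>\<^sub>3 V\<^sub>3"
    and "\<zeta>\<^sub>1 = (\<lambda>t X. t * \<zeta>\<^sub>3 t X)"
    and "b\<^sub>m = (\<lambda>t X. 2 * (LINT s:{0..t}|lborel. \<zeta>\<^sub>3 s X))"
  shows "(\<forall>t\<ge>0. AE X in lborel. set_integrable lborel {0..t} (\<lambda>s. \<zeta>\<^sub>3 s X)) \<and>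
         wave_solution h\<^sub>0 h\<^sub>0' b\<^sub>m \<zeta>\<^sub>1 \<and> nontrivial \<zeta>\<^sub>1 \<and>
         (\<exists>C::real. \<forall>t\<ge>0. in_L2 (b\<^sub>m t) \<and>
            ereal (L2_norm (b\<^sub>m t)) + Linf_norm (b\<^sub>m t) \<le> ereal C)"
proof -
  have b: "in_L2 b\<^sub>0" "in_L2 b\<^sub>0'" using assms(3) by (auto simp: in_H1_def)
  \<comment> \<open>The Sobolev bound for b_0, scaled by |\<beta>|, plus the constant depth
    1.\<close>
  define M where "M = 1 + \<bar>\<beta>\<bar> * (L2_norm b\<^sub>0 + L2_norm b\<^sub>0')"
  interpret first_order_system h\<^sub>0 h\<^sub>0' f f' \<zeta>\<^sub>3 V\<^sub>3 M h_min
  proof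
    show "h\<^sub>0 \<in> borel_measurable borel" unfolding assms(4) using in_L2_measurable[OF b(1)] by measurable
    show "in_L2 h\<^sub>0'" unfolding assms(5) by (rule in_L2_cmult[OF b(2)])
    show "weak_deriv h\<^sub>0 h\<^sub>0'" unfolding assms(4,5) by (rule weak_deriv_affine[OF assms(3)])
    show "AE x in lborel. \<bar>h\<^sub>0 x\<bar> \<le> M"
      using H1_AE_bound[OF assms(3)]
    proof eventually_elim
      fix x assume "\<bar>b\<^sub>0 x\<bar> \<le> L2_norm b\<^sub>0 + L2_norm b\<^sub>0'"
      then have "\<bar>\<beta> * b\<^sub>0 x\<bar> \<le> \<bar>\<beta>\<bar> * (L2_norm b\<^sub>0 + L2_norm b\<^sub>0')"
        unfolding abs_mult by (intro mult_left_mono) auto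
      then show "\<bar>h\<^sub>0 x\<bar> \<le> M" by (simp add: assms(4) M_def)
    qed
    show "0 \<le> M" unfolding M_def by simp
  qed (use assms in auto)
  have b\<^sub>m: "b\<^sub>m = (\<lambda>t x. 2 * Z t x)" by (simp add: assms(12) Z_def time_primitive_def)
  have "AE X in lborel. \<forall>t. set_integrable lborel {0..t} (\<lambda>s. \<zeta>\<^sub>3 s X)"
    using C_L2_AE_time_in_L2[OF C_L2(1)]
    by eventually_elim (blast intro: time_in_L2_set_integrable)
  then have "\<forall>t\<ge>0. AE X in lborel. set_integrable lborel {0..t} (\<lambda>s. \<zeta>\<^sub>3 s X)"
    by (auto elim!: eventually_mono)
  moreover have "wave_solution h\<^sub>0 h\<^sub>0' b\<^sub>m \<zeta>\<^sub>1"
    unfolding assms(11) b\<^sub>m by (rule zeta1_wave_solution)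
  moreover have "nontrivial \<zeta>\<^sub>1"
    unfolding assms(11) by (rule zeta1_nontrivial[OF assms(9)])
  moreover have "\<exists>C::real. \<forall>t\<ge>0. in_L2 (b\<^sub>m t) \<and> ereal (L2_norm (b\<^sub>m t)) + Linf_norm (b\<^sub>m t) \<le> ereal C"
  proof -
    obtain C where C: "\<And>t. 0 \<le> t \<Longrightarrow> L2_norm (Z t) \<le> C" "\<And>t. 0 \<le> t \<Longrightarrow> AE x in lborel. \<bar>Z t x\<bar> \<le> C"
      by (rule Z_uniform_bound) (rule that)
    \<comment> \<open>b_m is twice \<open>Z\<close>, and C bounds \<open>Z\<close> in both norms:
      hence 2 C for each of them.\<close>
    have "in_L2 (b\<^sub>m t) \<and> ereal (L2_norm (b\<^sub>m t)) + Linf_norm (b\<^sub>m t) \<le> ereal (2 * C + 2 * C)" if t: "0 \<le> t" for t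
    proof
      have L2: "in_L2 (\<lambda>x. 2 * Z t x)" by (rule in_L2_cmult[OF primitives_L2(1)[OF t]])
      then show "in_L2 (b\<^sub>m t)" by (simp add: b\<^sub>m)
      have "L2_norm (b\<^sub>m t) \<le> 2 * C" using C(1)[OF t] by (simp add: b\<^sub>m L2_norm_cmult)
      moreover have "Linf_norm (b\<^sub>m t) \<le> ereal (2 * C)"
        unfolding Linf_norm_def
      proof (rule esssup_I)
        show "(\<lambda>x. ereal \<bar>b\<^sub>m t x\<bar>) \<in> borel_measurable lborel"
          using in_L2_measurable[OF L2] by (simp add: b\<^sub>m)
        show "AE x in lborel. ereal \<bar>b\<^sub>m t x\<bar> \<le> ereal (2 * C)"
          using C(2)[OF t] by eventually_elim (simp add: b\<^sub>m abs_mult)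
      qed
      ultimately show "ereal (L2_norm (b\<^sub>m t)) + Linf_norm (b\<^sub>m t) \<le> ereal (2 * C + 2 * C)"
        unfolding plus_ereal.simps(1)[symmetric] by (intro add_mono) auto
    qed
    then show ?thesis by blast
  qed
  ultimately show ?thesis by blast
qed

end
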